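(* Let $S$ be a connected solvable Lie group. Then $S$ is of real type if and only if $m_S>0$. Moreover, in that case there is a constant $C(S)>0$ depending only on $S$ such that $|\mathrm{R}_g|\leq C(S)\,|\mathrm{scal}_g|$ for all $g\in\mathcal{C}_S$.
   Context: A solvable Lie group $S$ with Lie algebra $\mathfrak{s}$ is of real type if for every $X\in\mathfrak{s}$ such that all eigenvalues of $\mathrm{ad}\,X$ are purely imaginary (i.e. in $i\mathbb{R}$, $0$ included), the operator $\mathrm{ad}\,X$ is nilpotent. $\mathcal{C}_S$ denotes the set of all non-flat left-invariant Riemannian metrics on $S$. For $g\in\mathcal{C}_S$, $\mathrm{R}_g$, $\mathrm{Ric}_g$ and $\mathrm{scal}_g$ denote the Riemann curvature tensor, Ricci operator and scalar curvature of $g$ (their norms are the ones induced by $g$; they are constant on $S$), and $$F(g):=\frac{\mathrm{scal}_g^2}{|\mathrm{Ric}_g|^2},\qquad |\mathrm{Ric}_g|^2=\mathrm{tr}\,\mathrm{Ric}_g^2 ,$$ which is well defined since a Ricci flat homogeneous Riemannian manifold is flat. Finally $m_S:=\inf F|_{\mathcal{C}_S}$ (with $\inf\emptyset=+\infty$, relevant only if $S$ is abelian). *)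

theory Defs
  imports
    "HOL-Analysis.Analysis"
    "HOL-Algebra.Solvable_Groups"
begin

section \<open>Smooth maps between normed spaces\<close>

text \<open>Meant for open \<open>S\<close>: all iterated directional derivatives exist on \<open>S\<close> and are continuous.\<close>

primrec k_smooth_on ::
  "nat \<Rightarrow> 'v::real_normed_vector set \<Rightarrow> ('v \<Rightarrow> 'w::real_normed_vector) \<Rightarrow> bool" where
  "k_smooth_on 0 S f \<longleftrightarrow> continuous_on S f"
| "k_smooth_on (Suc k) S f \<longleftrightarrow>
     (\<forall>x\<in>S. f differentiable (at x)) \<and>
     (\<forall>v. k_smooth_on k S (\<lambda>x. frechet_derivative f (at x) v))"

definition smooth_on :: "'v::real_normed_vector set \<Rightarrow> ('v \<Rightarrow> 'w::real_normed_vector) \<Rightarrow> bool" where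
  "smooth_on S f \<longleftrightarrow> (\<forall>k. k_smooth_on k S f)"


section \<open>Smooth manifolds\<close>

text \<open>The underlying space of a manifold is a whole (Hausdorff, second countable) type
  \<open>'a\<close>; the model space is \<open>'e\<close>. A chart is its domain together with its coordinate map,
  and a manifold is given by a (not necessarily maximal) smooth atlas.\<close>

type_synonym ('a, 'e) chart = "'a set \<times> ('a \<Rightarrow> 'e)"

abbreviation cdom :: "('a, 'e) chart \<Rightarrow> 'a set" where
  "cdom c \<equiv> fst c"

abbreviation coord :: "('a, 'e) chart \<Rightarrow> 'a \<Rightarrow> 'e" where
  "coord c \<equiv> snd c"

abbreviation param :: "('a, 'e) chart \<Rightarrow> 'e \<Rightarrow> 'a" where
  "param c \<equiv> inv_into (cdom c) (coord c)"

definition is_chart :: "('a::topological_space, 'e::real_normed_vector) chart \<Rightarrow> bool" where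
  "is_chart c \<longleftrightarrow>
     open (cdom c) \<and> open (coord c ` cdom c) \<and>
     homeomorphism (cdom c) (coord c ` cdom c) (coord c) (param c)"

definition smooth_atlas :: "('a::topological_space, 'e::real_normed_vector) chart set \<Rightarrow> bool" where
  "smooth_atlas A \<longleftrightarrow>
     (\<forall>c\<in>A. is_chart c) \<and> (\<Union>c\<in>A. cdom c) = UNIV \<and>
     (\<forall>c\<in>A. \<forall>d\<in>A. smooth_on (coord c ` (cdom c \<inter> cdom d)) (coord d \<circ> param c))"

definition smooth_map ::
  "('a::topological_space, 'e::real_normed_vector) chart set \<Rightarrow>
   ('b::topological_space, 'f::real_normed_vector) chart set \<Rightarrow> ('a \<Rightarrow> 'b) \<Rightarrow> bool" where
  "smooth_map A B h \<longleftrightarrow>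
     continuous_on UNIV h \<and>
     (\<forall>c\<in>A. \<forall>d\<in>B. smooth_on (coord c ` (cdom c \<inter> h -` cdom d)) (coord d \<circ> h \<circ> param c))"

definition smooth_fun ::
  "('a::topological_space, 'e::real_normed_vector) chart set \<Rightarrow> ('a \<Rightarrow> 'w::real_normed_vector) \<Rightarrow> bool" where
  "smooth_fun A f \<longleftrightarrow> (\<forall>c\<in>A. smooth_on (coord c ` cdom c) (f \<circ> param c))"

definition prod_atlas :: "('a, 'e) chart set \<Rightarrow> ('b, 'f) chart set \<Rightarrow> ('a \<times> 'b, 'e \<times> 'f) chart set" where
  "prod_atlas A B = {(cdom c \<times> cdom d, map_prod (coord c) (coord d)) |c d. c \<in> A \<and> d \<in> B}"


section \<open>Tangent vectors and vector fields\<close>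

text \<open>The tangent space at \<open>p\<close> is the model space \<open>'e\<close>: a tangent vector is represented by its
  components with respect to one fixed chart \<open>chart_at A p\<close> around \<open>p\<close>. The choice of that chart
  varies with \<open>p\<close> in an arbitrary way, so smoothness of fields and metrics is always
  expressed through the components in a chart of the atlas, never through this representation.\<close>

definition chart_at :: "('a, 'e) chart set \<Rightarrow> 'a \<Rightarrow> ('a, 'e) chart" where
  "chart_at A p = (SOME c. c \<in> A \<and> p \<in> cdom c)"

text \<open>The derivative of a vector-valued function \<open>f\<close> at \<open>p\<close> along \<open>v \<in> T\<^sub>p\<close>. For a chart \<open>c\<close> around
  \<open>p\<close>, \<open>dfun A (coord c) p v\<close> are the components of \<open>v\<close> in \<open>c\<close>.\<close>

definition dfun ::
  "('a, 'e::real_normed_vector) chart set \<Rightarrow> ('a \<Rightarrow> 'w::real_normed_vector) \<Rightarrow> 'a \<Rightarrow> 'e \<Rightarrow> 'w" where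
  "dfun A f p v =
     frechet_derivative (f \<circ> param (chart_at A p)) (at (coord (chart_at A p) p)) v"

text \<open>The differential \<open>T\<^sub>p \<rightarrow> T\<^sub>h\<^sub>(\<^sub>p\<^sub>)\<close> of a smooth self-map \<open>h\<close>.\<close>

definition dmap :: "('a, 'e::real_normed_vector) chart set \<Rightarrow> ('a \<Rightarrow> 'a) \<Rightarrow> 'a \<Rightarrow> 'e \<Rightarrow> 'e" where
  "dmap A h p v = dfun A (coord (chart_at A (h p)) \<circ> h) p v"

text \<open>The tangent vector at \<open>p\<close> whose components in the chart \<open>c\<close> are \<open>u\<close>.\<close>

definition coord_vec ::
  "('a, 'e::real_normed_vector) chart set \<Rightarrow> ('a, 'e) chart \<Rightarrow> 'a \<Rightarrow> 'e \<Rightarrow> 'e" where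
  "coord_vec A c p u = frechet_derivative (coord (chart_at A p) \<circ> param c) (at (coord c p)) u"

definition vector_fields :: "('a::topological_space, 'e::real_normed_vector) chart set \<Rightarrow> ('a \<Rightarrow> 'e) set" where
  "vector_fields A =
     {X. \<forall>c\<in>A. smooth_on (coord c ` cdom c) ((\<lambda>p. dfun A (coord c) p (X p)) \<circ> param c)}"

definition vf_apply ::
  "('a, 'e::real_normed_vector) chart set \<Rightarrow> ('a \<Rightarrow> 'e) \<Rightarrow> ('a \<Rightarrow> 'w::real_normed_vector) \<Rightarrow> 'a \<Rightarrow> 'w" where
  "vf_apply A X f p = dfun A f p (X p)"

text \<open>The components of \<open>[X, Y]\<close> at \<open>p\<close> in a chart with coordinate functions \<open>x\<^sup>i\<close> are
  \<open>X (Y x\<^sup>i) - Y (X x\<^sup>i)\<close>.\<close>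

definition vf_bracket ::
  "('a, 'e::real_normed_vector) chart set \<Rightarrow> ('a \<Rightarrow> 'e) \<Rightarrow> ('a \<Rightarrow> 'e) \<Rightarrow> 'a \<Rightarrow> 'e" where
  "vf_bracket A X Y p =
     (let x = coord (chart_at A p)
      in vf_apply A X (vf_apply A Y x) p - vf_apply A Y (vf_apply A X x) p)"


section \<open>Riemannian metrics and curvature\<close>

definition riemannian_metric ::
  "('a::topological_space, 'e::real_normed_vector) chart set \<Rightarrow> ('a \<Rightarrow> 'e \<Rightarrow> 'e \<Rightarrow> real) \<Rightarrow> bool" where
  "riemannian_metric A g \<longleftrightarrow>
     (\<forall>p. bilinear (g p) \<and> (\<forall>u v. g p u v = g p v u) \<and> (\<forall>u. u \<noteq> 0 \<longrightarrow> g p u u > 0)) \<and>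
     (\<forall>c\<in>A. \<forall>u v. smooth_on (coord c ` cdom c)
        ((\<lambda>p. g p (coord_vec A c p u) (coord_vec A c p v)) \<circ> param c))"

definition levi_civita ::
  "('a::topological_space, 'e::real_normed_vector) chart set \<Rightarrow> ('a \<Rightarrow> 'e \<Rightarrow> 'e \<Rightarrow> real) \<Rightarrow>
   (('a \<Rightarrow> 'e) \<Rightarrow> ('a \<Rightarrow> 'e) \<Rightarrow> ('a \<Rightarrow> 'e)) \<Rightarrow> bool" where
  "levi_civita A g D \<longleftrightarrow>
     (\<forall>X\<in>vector_fields A. \<forall>Y\<in>vector_fields A. \<forall>Z\<in>vector_fields A. \<forall>f. smooth_fun A f \<longrightarrow>
        D X Y \<in> vector_fields A \<and>
        (\<forall>p. D (\<lambda>q. X q + Y q) Z p = D X Z p + D Y Z p) \<and>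
        (\<forall>p. D (\<lambda>q. f q *\<^sub>R X q) Y p = f p *\<^sub>R D X Y p) \<and>
        (\<forall>p. D X (\<lambda>q. Y q + Z q) p = D X Y p + D X Z p) \<and>
        (\<forall>p. D X (\<lambda>q. f q *\<^sub>R Y q) p = vf_apply A X f p *\<^sub>R Y p + f p *\<^sub>R D X Y p) \<and>
        (\<forall>p. D X Y p - D Y X p = vf_bracket A X Y p) \<and>
        (\<forall>p. vf_apply A X (\<lambda>q. g q (Y q) (Z q)) p = g p (D X Y p) (Z p) + g p (Y p) (D X Z p)))"

text \<open>\<open>R(u, v) w\<close> at \<open>p\<close>, where \<open>R(X, Y) Z = \<nabla>\<^sub>X \<nabla>\<^sub>Y Z - \<nabla>\<^sub>Y \<nabla>\<^sub>X Z - \<nabla>\<^bsub>[X,Y]\<^esub> Z\<close>; by tensoriality the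
  value depends only on the vectors \<open>u, v, w\<close> at \<open>p\<close> and not on the fields extending them.\<close>

definition riem ::
  "('a::topological_space, 'e::real_normed_vector) chart set \<Rightarrow> ('a \<Rightarrow> 'e \<Rightarrow> 'e \<Rightarrow> real) \<Rightarrow>
   'a \<Rightarrow> 'e \<Rightarrow> 'e \<Rightarrow> 'e \<Rightarrow> 'e" where
  "riem A g p u v w =
     (THE r. \<exists>D. levi_civita A g D \<and>
        (\<exists>X\<in>vector_fields A. \<exists>Y\<in>vector_fields A. \<exists>Z\<in>vector_fields A.
           X p = u \<and> Y p = v \<and> Z p = w \<and>
           r = D X (D Y Z) p - D Y (D X Z) p - D (vf_bracket A X Y) Z p))"

definition flat ::
  "('a::topological_space, 'e::real_normed_vector) chart set \<Rightarrow> ('a \<Rightarrow> 'e \<Rightarrow> 'e \<Rightarrow> real) \<Rightarrow> bool" where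
  "flat A g \<longleftrightarrow> (\<forall>p u v w. riem A g p u v w = 0)"

definition tr :: "('e::euclidean_space \<Rightarrow> 'e) \<Rightarrow> real" where
  "tr T = (\<Sum>b\<in>Basis. T b \<bullet> b)"

definition ricci_form ::
  "('a::topological_space, 'e::euclidean_space) chart set \<Rightarrow> ('a \<Rightarrow> 'e \<Rightarrow> 'e \<Rightarrow> real) \<Rightarrow>
   'a \<Rightarrow> 'e \<Rightarrow> 'e \<Rightarrow> real" where
  "ricci_form A g p u v = tr (\<lambda>x. riem A g p x u v)"

definition Ric ::
  "('a::topological_space, 'e::euclidean_space) chart set \<Rightarrow> ('a \<Rightarrow> 'e \<Rightarrow> 'e \<Rightarrow> real) \<Rightarrow>
   'a \<Rightarrow> 'e \<Rightarrow> 'e" where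
  "Ric A g p u = (THE w. \<forall>v. g p w v = ricci_form A g p u v)"

definition scal ::
  "('a::topological_space, 'e::euclidean_space) chart set \<Rightarrow> ('a \<Rightarrow> 'e \<Rightarrow> 'e \<Rightarrow> real) \<Rightarrow> 'a \<Rightarrow> real" where
  "scal A g p = tr (Ric A g p)"

definition orthonormal_basis :: "('e::real_vector \<Rightarrow> 'e \<Rightarrow> real) \<Rightarrow> 'e set \<Rightarrow> bool" where
  "orthonormal_basis h B \<longleftrightarrow> span B = UNIV \<and> (\<forall>u\<in>B. \<forall>v\<in>B. h u v = (if u = v then 1 else 0))"

text \<open>The tensor norm of the curvature tensor induced by \<open>g\<close>; it does not depend on the
  orthonormal basis chosen.\<close>

definition riem_norm ::
  "('a::topological_space, 'e::euclidean_space) chart set \<Rightarrow> ('a \<Rightarrow> 'e \<Rightarrow> 'e \<Rightarrow> real) \<Rightarrow> 'a \<Rightarrow> real" where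
  "riem_norm A g p =
     (let B = (SOME B. orthonormal_basis (g p) B)
      in sqrt (\<Sum>u\<in>B. \<Sum>v\<in>B. \<Sum>w\<in>B. g p (riem A g p u v w) (riem A g p u v w)))"


section \<open>Lie groups\<close>

definition lie_group ::
  "'a::{t2_space, second_countable_topology} monoid \<Rightarrow> ('a, 'e::euclidean_space) chart set \<Rightarrow> bool" where
  "lie_group G A \<longleftrightarrow>
     group G \<and> carrier G = UNIV \<and> smooth_atlas A \<and>
     smooth_map (prod_atlas A A) A (\<lambda>(p, q). p \<otimes>\<^bsub>G\<^esub> q) \<and>
     smooth_map A A (\<lambda>p. inv\<^bsub>G\<^esub> p)"

definition left_field ::
  "('a, 'b) monoid_scheme \<Rightarrow> ('a, 'e::real_normed_vector) chart set \<Rightarrow> 'e \<Rightarrow> 'a \<Rightarrow> 'e" where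
  "left_field G A u p = dmap A (\<lambda>q. p \<otimes>\<^bsub>G\<^esub> q) \<one>\<^bsub>G\<^esub> u"

text \<open>The Lie algebra is the tangent space at the identity, with the bracket of left-invariant
  vector fields.\<close>

definition lie_bracket ::
  "('a, 'b) monoid_scheme \<Rightarrow> ('a, 'e::real_normed_vector) chart set \<Rightarrow> 'e \<Rightarrow> 'e \<Rightarrow> 'e" where
  "lie_bracket G A u v = vf_bracket A (left_field G A u) (left_field G A v) \<one>\<^bsub>G\<^esub>"

text \<open>\<open>z\<close> is an eigenvalue of the complexification of the real operator \<open>T\<close>:
  \<open>T x + i T y = z (x + i y)\<close> with \<open>x + i y \<noteq> 0\<close>.\<close>

definition complex_eigenvalue :: "('e::real_vector \<Rightarrow> 'e) \<Rightarrow> complex \<Rightarrow> bool" where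
  "complex_eigenvalue T z \<longleftrightarrow>
     (\<exists>x y. \<not> (x = 0 \<and> y = 0) \<and>
        T x = Re z *\<^sub>R x - Im z *\<^sub>R y \<and> T y = Im z *\<^sub>R x + Re z *\<^sub>R y)"

definition nilpotent_op :: "('e::real_vector \<Rightarrow> 'e) \<Rightarrow> bool" where
  "nilpotent_op T \<longleftrightarrow> (\<exists>k. \<forall>x. (T ^^ k) x = 0)"

definition real_type ::
  "('a, 'b) monoid_scheme \<Rightarrow> ('a, 'e::real_normed_vector) chart set \<Rightarrow> bool" where
  "real_type G A \<longleftrightarrow>
     (\<forall>u. (\<forall>z. complex_eigenvalue (lie_bracket G A u) z \<longrightarrow> Re z = 0) \<longrightarrow>
          nilpotent_op (lie_bracket G A u))"

definition left_invariant ::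
  "('a, 'b) monoid_scheme \<Rightarrow> ('a, 'e::real_normed_vector) chart set \<Rightarrow>
   ('a \<Rightarrow> 'e \<Rightarrow> 'e \<Rightarrow> real) \<Rightarrow> bool" where
  "left_invariant G A g \<longleftrightarrow>
     (\<forall>a p u v. g (a \<otimes>\<^bsub>G\<^esub> p) (dmap A (\<lambda>q. a \<otimes>\<^bsub>G\<^esub> q) p u) (dmap A (\<lambda>q. a \<otimes>\<^bsub>G\<^esub> q) p v) = g p u v)"

definition nonflat_metrics ::
  "('a::topological_space, 'b) monoid_scheme \<Rightarrow> ('a, 'e::euclidean_space) chart set \<Rightarrow>
   ('a \<Rightarrow> 'e \<Rightarrow> 'e \<Rightarrow> real) set" where
  "nonflat_metrics G A = {g. riemannian_metric A g \<and> left_invariant G A g \<and> \<not> flat A g}"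

text \<open>All curvature quantities of a left-invariant metric are constant on the group; \<open>F\<close> takes
  their value at the identity.\<close>

definition F_pinch ::
  "('a::topological_space, 'b) monoid_scheme \<Rightarrow> ('a, 'e::euclidean_space) chart set \<Rightarrow>
   ('a \<Rightarrow> 'e \<Rightarrow> 'e \<Rightarrow> real) \<Rightarrow> real" where
  "F_pinch G A g =
     (scal A g \<one>\<^bsub>G\<^esub>)\<^sup>2 / tr (Ric A g \<one>\<^bsub>G\<^esub> \<circ> Ric A g \<one>\<^bsub>G\<^esub>)"

definition m_inf ::
  "('a::topological_space, 'b) monoid_scheme \<Rightarrow> ('a, 'e::euclidean_space) chart set \<Rightarrow> ereal" where
  "m_inf G A = (INF g\<in>nonflat_metrics G A. ereal (F_pinch G A g))"

end

theory Submission
  imports Defs "HOL-Computational_Algebra.Fundamental_Theorem_Algebra"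
begin

text \<open>Left translations identify vector fields with functions into the Lie algebra, and the curvature
  of a left-invariant metric becomes a quadratic expression in the bracket; so the curvature estimate
  amounts to bounding the norm of the bracket, squared, by \<open>|scal|\<close>. On a solvable Lie algebra \<open>scal\<close>
  dominates the part of the bracket inside the derived algebra and the symmetric parts of \<open>ad x\<close> for
  \<open>x\<close> orthogonal to it. The remaining skew parts are controlled by \<open>- tr (ad x)\<^sup>2\<close>, the sum of
  \<open>(Im \<lambda>)\<^sup>2 - (Re \<lambda>)\<^sup>2\<close> over the weights \<open>\<lambda>\<close> of \<open>x\<close> given by Lie's theorem. Real type says that the
  linear forms \<open>Im \<lambda>\<close> vanish wherever all the \<open>Re \<lambda>\<close> do, hence are dominated by them, and each
  \<open>|Re \<lambda>|\<close> is at most the norm of the symmetric part of \<open>ad x\<close>.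

  Conversely, if \<open>ad X\<close> has imaginary spectrum but is not nilpotent, suitable metrics make the bracket
  converge to that of a semidirect product in which \<open>X\<close> acts by an almost skew map; there \<open>scal\<close> is
  quadratic in the deviation from skewness and the Ricci operator only linear, so the pinching
  functional tends to 0.\<close>

section \<open>Calculus of smooth maps\<close>

text \<open>The constant must be uniform over all metrics. This is possible because the weights of
  \<open>ad\<close> belong to the Lie algebra alone: the domination of the forms
  \<open>Im \<lambda>\<close> by the forms \<open>Re \<lambda>\<close> is settled before an inner
  product appears, and the inner product enters only through the symmetric part of
  \<open>ad x\<close>, which bounds \<open>Re \<lambda>\<close> from above. The skew parts are the
  real obstacle, since a skew \<open>ad x\<close> costs no curvature at all: a line acting on an
  abelian ideal by a skew map \<open>D\<close> gives a flat metric. Near it the scalar curvature of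
  a traceless \<open>D\<close> is minus the squared norm of its symmetric part, while the Ricci
  operator contains the commutator of \<open>D\<close> with its transpose; hence second order
  against first order. Exactly skew limits are useless because the quotient is then undefined.
  Solvability is a hypothesis on the abstract group. The subgroups of its derived series need not be
  closed, so they come without Lie algebras; spans of initial velocities of curves replace these.
  Tangent vectors are components in charts picked arbitrarily point by point, so smoothness can be
  tested only after passing to a fixed chart or to the Maurer-Cartan form \<open>mc\<close>.\<close>

lemma frechet_derivative_cong_open:
  assumes "open S" "x \<in> S" "\<And>y. y \<in> S \<Longrightarrow> f y = g y"
  shows "frechet_derivative f (at x) = frechet_derivative g (at x)"
proof -
  have "(f has_derivative D) (at x) \<longleftrightarrow> (g has_derivative D) (at x)" for D
    using assms has_derivative_transform_within_open[of f D x UNIV S g]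
      has_derivative_transform_within_open[of g D x UNIV S f] by auto
  then show ?thesis unfolding frechet_derivative_def by simp
qed

lemma differentiable_cong_open:
  assumes "open S" "x \<in> S" "\<And>y. y \<in> S \<Longrightarrow> f y = g y" "f differentiable (at x)"
  shows "g differentiable (at x)"
  using assms has_derivative_transform_within_open[of f _ x UNIV S g]
  unfolding differentiable_def by blast

lemma frechet_has_derivative:
  "f differentiable (at x) \<Longrightarrow> (f has_derivative frechet_derivative f (at x)) (at x)"
  by (simp add: frechet_derivative_works[symmetric])

lemma k_smooth_on_cong:
  assumes "open S" "\<And>x. x \<in> S \<Longrightarrow> f x = g x" "k_smooth_on k S f"
  shows "k_smooth_on k S g"
  using assms(2,3)
proof (induction k arbitrary: f g)
  case 0
  then show ?case by (auto cong: continuous_on_cong)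
next
  case (Suc k)
  have "k_smooth_on k S (\<lambda>x. frechet_derivative g (at x) v)" for v
    by (rule Suc.IH[of "\<lambda>x. frechet_derivative f (at x) v"])
      (use Suc.prems frechet_derivative_cong_open[OF assms(1), of _ f g] in auto)
  moreover have "g differentiable (at x)" if "x \<in> S" for x
    using differentiable_cong_open[OF assms(1) that, of f g] Suc.prems that by auto
  ultimately show ?case by simp
qed

text \<open>The subset need not be open: derivatives are taken at a point of the whole space, not
  within the set.\<close>

lemma k_smooth_on_subset: "k_smooth_on k S f \<Longrightarrow> T \<subseteq> S \<Longrightarrow> k_smooth_on k T f"
  by (induction k arbitrary: f) (auto intro: continuous_on_subset)

lemma k_smooth_on_SucD: "k_smooth_on (Suc k) S f \<Longrightarrow> k_smooth_on k S f"
proof (induction k arbitrary: f)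
  case 0
  then show ?case
    by (auto intro!: continuous_at_imp_continuous_on differentiable_imp_continuous_within)
next
  case (Suc k)
  then show ?case by (metis k_smooth_on.simps(2))
qed

lemma k_smooth_on_local:
  assumes "\<And>x. x \<in> S \<Longrightarrow> \<exists>U. open U \<and> x \<in> U \<and> k_smooth_on k U f"
  shows "k_smooth_on k S f"
  using assms
proof (induction k arbitrary: f)
  case 0
  have "isCont f x" if "x \<in> S" for x
    using 0[OF that] by (auto simp: continuous_on_eq_continuous_at)
  then show ?case by (auto intro: continuous_at_imp_continuous_on)
next
  case (Suc k)
  then show ?case by simp metis
qed

lemma k_smooth_on_const: "k_smooth_on k S (\<lambda>x. c)"
  by (induction k arbitrary: c) auto

lemma frechet_derivative_eq: "(f has_derivative D) (at x) \<Longrightarrow> frechet_derivative f (at x) = D"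
  by (metis frechet_derivative_at)

text \<open>Lets an explicit derivative replace \<open>frechet_derivative\<close>, so that the usual
  differentiation rules drive the inductions below.\<close>

lemma k_smooth_on_SucI:
  assumes "open S" "\<And>x. x \<in> S \<Longrightarrow> (f has_derivative D x) (at x)"
    "\<And>v. k_smooth_on k S (\<lambda>x. D x v)"
  shows "k_smooth_on (Suc k) S f"
proof -
  have "k_smooth_on k S (\<lambda>x. frechet_derivative f (at x) v)" for v
    by (rule k_smooth_on_cong[OF assms(1) _ assms(3)[of v]]) (simp add: frechet_derivative_eq[OF assms(2)])
  then show ?thesis using assms(2) by (auto simp: differentiable_def)
qed

lemma k_smooth_on_linear: "bounded_linear h \<Longrightarrow> open S \<Longrightarrow> k_smooth_on k S h"
proof (cases k)
  case 0
  assume "bounded_linear h"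
  then show ?thesis using 0 by (simp add: linear_continuous_on)
next
  case (Suc m)
  assume *: "bounded_linear h" "open S"
  show ?thesis unfolding Suc
    by (rule k_smooth_on_SucI[OF *(2), where D="\<lambda>x. h"]) (use * in \<open>auto intro: bounded_linear_imp_has_derivative k_smooth_on_const\<close>)
qed

lemma k_smooth_on_add:
  assumes "open S"
  shows "k_smooth_on k S f \<Longrightarrow> k_smooth_on k S g \<Longrightarrow> k_smooth_on k S (\<lambda>x. f x + g x)"
proof (induction k arbitrary: f g)
  case 0
  then show ?case by (auto intro: continuous_intros)
next
  case (Suc k)
  show ?case
    by (rule k_smooth_on_SucI[OF assms, where
        D="\<lambda>x v. frechet_derivative f (at x) v + frechet_derivative g (at x) v"])
      (use Suc in \<open>auto intro!: has_derivative_add frechet_has_derivative\<close>)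
qed

text \<open>The Leibniz rule returns sums of the same shape with one factor differentiated, so the
  induction runs over both factors at once; the undifferentiated factor only has to be lowered by
  one order.\<close>

lemma k_smooth_on_bilinear:
  assumes "open S" "bounded_bilinear m"
  shows "k_smooth_on k S f \<Longrightarrow> k_smooth_on k S g \<Longrightarrow> k_smooth_on k S (\<lambda>x. m (f x) (g x))"
proof (induction k arbitrary: f g)
  case 0
  then show ?case using bounded_bilinear.continuous_on[OF assms(2)] by auto
next
  case (Suc k)
  have fg: "k_smooth_on k S f" "k_smooth_on k S g"
    using Suc.prems k_smooth_on_SucD by blast+
  show ?case
    by (rule k_smooth_on_SucI[OF assms(1), where
        D="\<lambda>x v. m (f x) (frechet_derivative g (at x) v) + m (frechet_derivative f (at x) v) (g x)"])
      (use Suc fg in \<open>auto intro!: k_smooth_on_add[OF assms(1)] bounded_bilinear.FDERIV[OF assms(2)] frechet_has_derivative\<close>)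
qed

lemma k_smooth_on_sum:
  assumes "open S" "\<And>i. i \<in> I \<Longrightarrow> k_smooth_on k S (f i)"
  shows "k_smooth_on k S (\<lambda>x. \<Sum>i\<in>I. f i x)"
proof (cases "finite I")
  case True
  then show ?thesis using assms(2)
  proof (induction I)
    case (insert i I)
    then have "k_smooth_on k S (\<lambda>x. f i x + (\<Sum>i\<in>I. f i x))"
      using k_smooth_on_add[OF assms(1), of k "f i"] by simp
    then show ?case using insert by simp
  qed (simp add: k_smooth_on_const)
qed (simp add: k_smooth_on_const)

text \<open>Smoothness speaks of derivatives in fixed directions only. This expansion reduces a
  derivative along a varying direction to finitely many fixed ones.\<close>

lemma linear_expand:
  fixes D :: "'e::euclidean_space \<Rightarrow> 'w::real_vector"
  assumes "linear D" shows "D v = (\<Sum>b\<in>Basis. (v \<bullet> b) *\<^sub>R D b)"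
proof -
  have "D (\<Sum>b\<in>Basis. (v \<bullet> b) *\<^sub>R b) = (\<Sum>b\<in>Basis. (v \<bullet> b) *\<^sub>R D b)"
    by (simp add: linear_sum[OF assms] linear_scale[OF assms])
  then show ?thesis by (simp add: euclidean_representation)
qed

text \<open>The chain rule differentiates \<open>g\<close> along the moving vector
  \<open>f'(x) v\<close>. Expanding that vector in \<open>Basis\<close> leaves products of scalars
  with fixed directional derivatives of \<open>g\<close>, to which the induction hypothesis
  applies.\<close>

lemma k_smooth_on_compose:
  fixes f :: "'v::real_normed_vector \<Rightarrow> 'e::euclidean_space" and g :: "'e \<Rightarrow> 'w::real_normed_vector"
  assumes "open S" "open T" "f ` S \<subseteq> T"
  shows "k_smooth_on k S f \<Longrightarrow> k_smooth_on k T g \<Longrightarrow> k_smooth_on k S (\<lambda>x. g (f x))"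
proof (induction k arbitrary: g)
  case 0
  then show ?case using assms(3) by (auto intro: continuous_on_compose2)
next
  case (Suc k)
  have f: "k_smooth_on k S f" using Suc.prems k_smooth_on_SucD by blast
  show ?case
  proof (rule k_smooth_on_SucI[OF assms(1), where
        D="\<lambda>x v. \<Sum>b\<in>Basis. (frechet_derivative f (at x) v \<bullet> b) *\<^sub>R frechet_derivative g (at (f x)) b"])
    fix x assume x: "x \<in> S"
    have g': "(g has_derivative frechet_derivative g (at (f x))) (at (f x))"
      using Suc.prems x assms(3) by (auto intro!: frechet_has_derivative)
    have f': "(f has_derivative frechet_derivative f (at x)) (at x)"
      using Suc.prems x by (auto intro!: frechet_has_derivative)
    show "((\<lambda>x. g (f x)) has_derivative
      (\<lambda>v. \<Sum>b\<in>Basis. (frechet_derivative f (at x) v \<bullet> b) *\<^sub>R frechet_derivative g (at (f x)) b)) (at x)"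
      using has_derivative_compose[OF f' g']
      by (subst (asm) linear_expand[OF has_derivative_linear[OF g']]) simp
  next
    fix v
    show "k_smooth_on k S (\<lambda>x. \<Sum>b\<in>Basis. (frechet_derivative f (at x) v \<bullet> b) *\<^sub>R frechet_derivative g (at (f x)) b)"
      using Suc.prems f
      by (intro k_smooth_on_sum[OF assms(1)] k_smooth_on_bilinear[OF assms(1) bounded_bilinear_scaleR]
          k_smooth_on_bilinear[OF assms(1) bounded_bilinear_inner] k_smooth_on_const Suc.IH) auto
  qed
qed

lemma smooth_on_cong:
  "open S \<Longrightarrow> (\<And>x. x \<in> S \<Longrightarrow> f x = g x) \<Longrightarrow> smooth_on S f \<Longrightarrow> smooth_on S g"
  unfolding smooth_on_def using k_smooth_on_cong by blast

lemma smooth_on_subset: "smooth_on S f \<Longrightarrow> T \<subseteq> S \<Longrightarrow> smooth_on T f"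
  unfolding smooth_on_def using k_smooth_on_subset by blast

lemma smooth_on_local:
  assumes "\<And>x. x \<in> S \<Longrightarrow> \<exists>U. open U \<and> x \<in> U \<and> smooth_on U f"
  shows "smooth_on S f"
proof (unfold smooth_on_def, rule allI, rule k_smooth_on_local)
  fix k x assume "x \<in> S"
  then obtain U where "open U" "x \<in> U" "smooth_on U f" using assms by blast
  then show "\<exists>U. open U \<and> x \<in> U \<and> k_smooth_on k U f" by (auto simp: smooth_on_def)
qed

lemma smooth_on_const: "smooth_on S (\<lambda>x. c)"
  unfolding smooth_on_def using k_smooth_on_const by blast

lemma smooth_on_linear: "bounded_linear h \<Longrightarrow> open S \<Longrightarrow> smooth_on S h"
  unfolding smooth_on_def using k_smooth_on_linear by blast

lemma smooth_on_add:
  "open S \<Longrightarrow> smooth_on S f \<Longrightarrow> smooth_on S g \<Longrightarrow> smooth_on S (\<lambda>x. f x + g x)"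
  unfolding smooth_on_def using k_smooth_on_add by blast

lemma smooth_on_bilinear:
  "open S \<Longrightarrow> bounded_bilinear m \<Longrightarrow> smooth_on S f \<Longrightarrow> smooth_on S g \<Longrightarrow> smooth_on S (\<lambda>x. m (f x) (g x))"
  unfolding smooth_on_def using k_smooth_on_bilinear by blast

lemma smooth_on_sum:
  "open S \<Longrightarrow> (\<And>i. i \<in> I \<Longrightarrow> smooth_on S (f i)) \<Longrightarrow> smooth_on S (\<lambda>x. \<Sum>i\<in>I. f i x)"
  unfolding smooth_on_def using k_smooth_on_sum[of S I _ f] by blast

lemma smooth_on_compose:
  fixes f :: "'v::real_normed_vector \<Rightarrow> 'e::euclidean_space" and g :: "'e \<Rightarrow> 'w::real_normed_vector"
  assumes "open S" "open T" "f ` S \<subseteq> T" "smooth_on S f" "smooth_on T g"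
  shows "smooth_on S (\<lambda>x. g (f x))"
  using k_smooth_on_compose[OF assms(1,2,3)] assms(4,5) unfolding smooth_on_def by blast

lemma smooth_on_compose_linear:
  fixes f :: "'v::real_normed_vector \<Rightarrow> 'e::euclidean_space"
  assumes "open S" "bounded_linear h" "smooth_on S f"
  shows "smooth_on S (\<lambda>x. h (f x))"
  by (rule smooth_on_compose[OF assms(1) open_UNIV _ assms(3) smooth_on_linear[OF assms(2) open_UNIV]]) simp

lemma smooth_on_Pair:
  fixes f :: "'v::real_normed_vector \<Rightarrow> 'e::euclidean_space" and g :: "'v \<Rightarrow> 'f::euclidean_space"
  assumes "open S" "smooth_on S f" "smooth_on S g"
  shows "smooth_on S (\<lambda>x. (f x, g x))"
proof -
  have "smooth_on S (\<lambda>x. (f x, 0) + (0, g x))"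
    by (intro smooth_on_add assms smooth_on_compose_linear[OF assms(1) _ assms(2), of "\<lambda>x. (x, 0)"]
        smooth_on_compose_linear[OF assms(1) _ assms(3), of "\<lambda>x. (0, x)"]
        bounded_linear_Pair bounded_linear_ident bounded_linear_zero)
  then show ?thesis by simp
qed

lemma smooth_on_differentiable: "smooth_on S f \<Longrightarrow> x \<in> S \<Longrightarrow> f differentiable (at x)"
  unfolding smooth_on_def by (metis k_smooth_on.simps(2))

lemma smooth_on_has_derivative:
  "smooth_on S f \<Longrightarrow> x \<in> S \<Longrightarrow> (f has_derivative frechet_derivative f (at x)) (at x)"
  by (intro frechet_has_derivative smooth_on_differentiable)

lemma smooth_on_continuous: "smooth_on S f \<Longrightarrow> continuous_on S f"
  unfolding smooth_on_def by (metis k_smooth_on.simps(1))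

lemma smooth_on_directional:
  "smooth_on S f \<Longrightarrow> smooth_on S (\<lambda>x. frechet_derivative f (at x) v)"
  unfolding smooth_on_def by (metis k_smooth_on.simps(2))

lemma smooth_on_derivative:
  fixes f :: "'e::euclidean_space \<Rightarrow> 'w::real_normed_vector" and g :: "'v::real_normed_vector \<Rightarrow> 'e"
    and w :: "'v \<Rightarrow> 'e"
  assumes "open T" "open S" "g ` T \<subseteq> S" "smooth_on T g" "smooth_on S f" "smooth_on T w"
  shows "smooth_on T (\<lambda>x. frechet_derivative f (at (g x)) (w x))"
proof (rule smooth_on_cong[OF assms(1)])
  show "smooth_on T (\<lambda>x. \<Sum>b\<in>Basis. (w x \<bullet> b) *\<^sub>R frechet_derivative f (at (g x)) b)"
    by (intro smooth_on_sum assms smooth_on_bilinear[OF _ bounded_bilinear_scaleR]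
        smooth_on_bilinear[OF _ bounded_bilinear_inner] smooth_on_const
        smooth_on_compose[OF assms(1-4)] smooth_on_directional)
next
  fix x assume "x \<in> T"
  then have "linear (frechet_derivative f (at (g x)))"
    using assms smooth_on_has_derivative has_derivative_linear by blast
  then show "(\<Sum>b\<in>Basis. (w x \<bullet> b) *\<^sub>R frechet_derivative f (at (g x)) b) = frechet_derivative f (at (g x)) (w x)"
    using linear_expand by metis
qed

text \<open>The double difference quotient of \<open>f\<close> along \<open>u\<close> and \<open>v\<close>, which is symmetric in \<open>u\<close> and \<open>v\<close>,
  is by two applications of the mean value theorem a value of the mixed derivative.\<close>

lemma double_difference_mvt:
  fixes f :: "'v::real_normed_vector \<Rightarrow> real"
  assumes S: "open S" "smooth_on S f"
    and ball: "ball x r \<subseteq> S" and t: "0 < t" "t * (norm u + norm v) < r"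
  shows "\<exists>y. dist y x \<le> t * (norm u + norm v) \<and>
    f (x + t *\<^sub>R u + t *\<^sub>R v) - f (x + t *\<^sub>R u) - f (x + t *\<^sub>R v) + f x =
    t * t * frechet_derivative (\<lambda>z. frechet_derivative f (at z) u) (at y) v"
proof -
  let ?D = "\<lambda>z. frechet_derivative f (at z) u"
  have inS: "x + a *\<^sub>R u + b *\<^sub>R v \<in> S" "dist (x + a *\<^sub>R u + b *\<^sub>R v) x \<le> t * (norm u + norm v)"
    if "0 \<le> a" "a \<le> t" "0 \<le> b" "b \<le> t" for a b
  proof -
    have "norm (a *\<^sub>R u + b *\<^sub>R v) \<le> a * norm u + b * norm v"
      using norm_triangle_ineq[of "a *\<^sub>R u" "b *\<^sub>R v"] that by simp
    also have "\<dots> \<le> t * norm u + t * norm v" using that by (intro add_mono mult_right_mono) auto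
    finally have *: "norm (a *\<^sub>R u + b *\<^sub>R v) \<le> t * (norm u + norm v)" by (simp add: algebra_simps)
    then show "dist (x + a *\<^sub>R u + b *\<^sub>R v) x \<le> t * (norm u + norm v)"
      by (simp add: dist_norm add.assoc)
    then show "x + a *\<^sub>R u + b *\<^sub>R v \<in> S" using t ball by (auto simp: subset_eq dist_commute)
  qed
  define \<phi> where "\<phi> a = f (x + a *\<^sub>R u + t *\<^sub>R v) - f (x + a *\<^sub>R u)" for a
  have \<phi>': "(\<phi> has_derivative (\<lambda>h. h * (?D (x + a *\<^sub>R u + t *\<^sub>R v) - ?D (x + a *\<^sub>R u)))) (at a within {0..t})"
    if "0 \<le> a" "a \<le> t" for a
  proof -
    have d: "((\<lambda>a. f (x + a *\<^sub>R u + c)) has_derivative (\<lambda>h. h * ?D (x + a *\<^sub>R u + c))) (at a)"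
      if "x + a *\<^sub>R u + c \<in> S" for c
    proof -
      have l: "linear (frechet_derivative f (at (x + a *\<^sub>R u + c)))"
        using smooth_on_has_derivative[OF S(2) that] has_derivative_linear by blast
      have "((\<lambda>a. x + a *\<^sub>R u + c) has_derivative (\<lambda>h. h *\<^sub>R u)) (at a)"
        by (auto intro!: derivative_eq_intros)
      from has_derivative_compose[OF this smooth_on_has_derivative[OF S(2) that]]
      show ?thesis by (simp add: linear_scale[OF l])
    qed
    show ?thesis unfolding \<phi>_def right_diff_distrib
      using that t d[of "t *\<^sub>R v"] d[of 0] inS(1)[of a t] inS(1)[of a 0]
      by (intro has_derivative_at_withinI[OF has_derivative_diff]) auto
  qed
  obtain a where a: "0 < a" "a < t"
    "\<phi> t - \<phi> 0 = t * (?D (x + a *\<^sub>R u + t *\<^sub>R v) - ?D (x + a *\<^sub>R u))"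
    using mvt_simple[OF t(1) \<phi>'] by auto
  define \<psi> where "\<psi> b = ?D (x + a *\<^sub>R u + b *\<^sub>R v)" for b
  have \<psi>': "(\<psi> has_derivative (\<lambda>h. h * frechet_derivative ?D (at (x + a *\<^sub>R u + b *\<^sub>R v)) v)) (at b within {0..t})"
    if "0 \<le> b" "b \<le> t" for b
  proof -
    have s: "smooth_on S ?D" using S by (intro smooth_on_directional)
    have i: "x + a *\<^sub>R u + b *\<^sub>R v \<in> S" using inS(1) a that by auto
    have l: "linear (frechet_derivative ?D (at (x + a *\<^sub>R u + b *\<^sub>R v)))"
      using smooth_on_has_derivative[OF s i] has_derivative_linear by blast
    have "((\<lambda>b. (x + a *\<^sub>R u) + b *\<^sub>R v) has_derivative (\<lambda>h. 0 + h *\<^sub>R v)) (at b)"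
      by (intro has_derivative_add has_derivative_const
          bounded_linear_imp_has_derivative bounded_linear_scaleR_left)
    from has_derivative_compose[OF this smooth_on_has_derivative[OF s i]]
    have "(\<psi> has_derivative (\<lambda>h. frechet_derivative ?D (at (x + a *\<^sub>R u + b *\<^sub>R v)) (h *\<^sub>R v))) (at b)"
      by (simp add: \<psi>_def[abs_def])
    then show ?thesis using has_derivative_at_withinI by (simp only: linear_scale[OF l] real_scaleR_def) blast
  qed
  obtain b where b: "0 < b" "b < t"
    "\<psi> t - \<psi> 0 = t * frechet_derivative ?D (at (x + a *\<^sub>R u + b *\<^sub>R v)) v"
    using mvt_simple[OF t(1) \<psi>'] by auto
  show ?thesis
    using a b inS(2)[of a b] by (intro exI[of _ "x + a *\<^sub>R u + b *\<^sub>R v"]) (auto simp: \<phi>_def \<psi>_def algebra_simps)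
qed

lemma symmetric_second_derivative_real:
  fixes f :: "'v::real_normed_vector \<Rightarrow> real"
  assumes S: "open S" "smooth_on S f" "x \<in> S"
  shows "frechet_derivative (\<lambda>z. frechet_derivative f (at z) u) (at x) v =
    frechet_derivative (\<lambda>z. frechet_derivative f (at z) v) (at x) u" (is "?A x = ?B x")
proof -
  obtain r where r: "r > 0" "ball x r \<subseteq> S" using S by (auto simp: open_contains_ball)
  let ?n = "norm u + norm v + 1"
  \<comment> \<open>The step length keeps the whole parallelogram spanned by
    \<open>t n *\<^sub>R u\<close> and \<open>t n *\<^sub>R v\<close> inside the ball; the summand 1
    in \<open>?n\<close> avoids a division by zero.\<close>
  define t where "t n = (r / ?n) * inverse (real (Suc n))" for n :: nat
  have n1: "?n > 0" by (smt (verit) norm_ge_zero)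
  have tpos: "t n > 0" for n unfolding t_def using r n1 by simp
  have tr: "t n * (norm u + norm v) < r" for n
  proof -
    have "t n * (norm u + norm v) < t n * ?n" using tpos by simp
    also have "\<dots> = r * inverse (real (Suc n))" unfolding t_def using n1 by simp
    also have "\<dots> \<le> r * 1" using r by (intro mult_left_mono) (auto simp: inverse_eq_divide)
    finally show ?thesis by simp
  qed
  have t0: "t \<longlonglongrightarrow> 0"
    unfolding t_def using tendsto_mult[OF tendsto_const LIMSEQ_inverse_real_of_nat, of "r / ?n"] by simp
  \<comment> \<open>Applying the mean value theorem in the two possible orders gives different
    intermediate points \<open>y\<close> and \<open>z\<close>; both converge to \<open>x\<close>,
    where the mixed derivatives are continuous.\<close>
  have "\<exists>y z. dist y x \<le> t n * (norm u + norm v) \<and> dist z x \<le> t n * (norm u + norm v) \<and> ?A y = ?B z" for n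
  proof -
    obtain y where y: "dist y x \<le> t n * (norm u + norm v)"
      "f (x + t n *\<^sub>R u + t n *\<^sub>R v) - f (x + t n *\<^sub>R u) - f (x + t n *\<^sub>R v) + f x = t n * t n * ?A y"
      using double_difference_mvt[OF S(1,2) r(2) tpos tr] by blast
    have tr': "t n * (norm v + norm u) < r" using tr[of n] by (simp add: add.commute)
    obtain z where z: "dist z x \<le> t n * (norm v + norm u)"
      "f (x + t n *\<^sub>R v + t n *\<^sub>R u) - f (x + t n *\<^sub>R v) - f (x + t n *\<^sub>R u) + f x = t n * t n * ?B z"
      using double_difference_mvt[OF S(1,2) r(2) tpos tr'] by blast
    have "t n * t n * ?A y = t n * t n * ?B z" using y(2) z(2) by (simp add: algebra_simps)
    then have "?A y = ?B z" using tpos[of n] by simp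
    then show ?thesis using y z by (auto simp: add.commute)
  qed
  then obtain y z where yz: "\<And>n. dist (y n) x \<le> t n * (norm u + norm v)"
    "\<And>n. dist (z n) x \<le> t n * (norm u + norm v)" "\<And>n. ?A (y n) = ?B (z n)" by metis
  have lim: "w \<longlonglongrightarrow> x" if "\<And>n. dist (w n) x \<le> t n * (norm u + norm v)" for w
    by (rule metric_tendsto_imp_tendsto[of "\<lambda>n. t n * (norm u + norm v)" 0])
      (use that tpos t0 in \<open>auto intro!: always_eventually tendsto_mult_left_zero simp: less_imp_le\<close>)
  have "isCont ?A x" "isCont ?B x"
    using smooth_on_continuous[OF smooth_on_directional[OF smooth_on_directional[OF S(2)]]] S
    by (auto simp: continuous_on_eq_continuous_at)
  then have "(\<lambda>n. ?A (y n)) \<longlonglongrightarrow> ?A x" "(\<lambda>n. ?B (z n)) \<longlonglongrightarrow> ?B x"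
    using lim[OF yz(1)] lim[OF yz(2)] isCont_tendsto_compose by blast+
  then show ?thesis using yz(3) LIMSEQ_unique by fastforce
qed

text \<open>Taken componentwise, because the mean value argument needs real values.\<close>

lemma symmetric_second_derivative:
  fixes f :: "'v::real_normed_vector \<Rightarrow> 'w::euclidean_space"
  assumes S: "open S" "smooth_on S f" "x \<in> S"
  shows "frechet_derivative (\<lambda>z. frechet_derivative f (at z) u) (at x) v =
    frechet_derivative (\<lambda>z. frechet_derivative f (at z) v) (at x) u"
proof (rule euclidean_eqI)
  fix b :: 'w assume "b \<in> Basis"
  let ?g = "\<lambda>z. f z \<bullet> b"
  have g: "smooth_on S ?g" using S by (intro smooth_on_bilinear[OF _ bounded_bilinear_inner] smooth_on_const)
  have d: "frechet_derivative (\<lambda>z. h z \<bullet> b) (at y) w = frechet_derivative h (at y) w \<bullet> b"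
    if "smooth_on S h" "y \<in> S" for h :: "'v \<Rightarrow> 'w" and y w
    using frechet_derivative_eq[OF has_derivative_inner_left[OF smooth_on_has_derivative[OF that], of b]]
    by metis
  have "frechet_derivative (\<lambda>z. frechet_derivative ?g (at z) u') (at x) v' =
    frechet_derivative (\<lambda>z. frechet_derivative f (at z) u') (at x) v' \<bullet> b" for u' v'
    using frechet_derivative_cong_open[OF S(1,3), of "\<lambda>z. frechet_derivative ?g (at z) u'" "\<lambda>z. frechet_derivative f (at z) u' \<bullet> b"]
      d[OF S(2)] d[OF smooth_on_directional[OF S(2)] S(3)] by simp
  then show "frechet_derivative (\<lambda>z. frechet_derivative f (at z) u) (at x) v \<bullet> b =
    frechet_derivative (\<lambda>z. frechet_derivative f (at z) v) (at x) u \<bullet> b"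
    using symmetric_second_derivative_real[OF S(1) g S(3), of u v] by simp
qed


section \<open>Local smoothness on a manifold\<close>

text \<open>Smoothness near \<open>p\<close>, not merely at \<open>p\<close>, with one neighbourhood
  that serves all charts; the property is therefore open in \<open>p\<close>.\<close>

definition smooth_at ::
  "('a::topological_space, 'e::euclidean_space) chart set \<Rightarrow> ('a \<Rightarrow> 'w::real_normed_vector) \<Rightarrow> 'a \<Rightarrow> bool" where
  "smooth_at A f p \<longleftrightarrow>
     (\<exists>U. open U \<and> p \<in> U \<and> (\<forall>c\<in>A. smooth_on (coord c ` (cdom c \<inter> U)) (f \<circ> param c)))"

text \<open>The neighbourhood mapped into \<open>cdom c\<close> provides continuity. Without it
  \<open>coord c (h q)\<close> could be evaluated outside the chart, where it means nothing.\<close>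

definition smooth_map_at ::
  "('a::topological_space, 'e::euclidean_space) chart set \<Rightarrow> ('a \<Rightarrow> 'a) \<Rightarrow> 'a \<Rightarrow> bool" where
  "smooth_map_at A h p \<longleftrightarrow>
     (\<forall>c\<in>A. h p \<in> cdom c \<longrightarrow> (\<exists>U. open U \<and> p \<in> U \<and> h ` U \<subseteq> cdom c) \<and> smooth_at A (\<lambda>q. coord c (h q)) p)"

text \<open>Joint smoothness in two points, read in one pair of charts. This avoids treating the
  product as a manifold of its own.\<close>

definition smooth_at2 ::
  "('a::topological_space, 'e::euclidean_space) chart set \<Rightarrow> ('a \<Rightarrow> 'a \<Rightarrow> 'w::real_normed_vector) \<Rightarrow> 'a \<Rightarrow> 'a \<Rightarrow> bool" where
  "smooth_at2 A F a b \<longleftrightarrow>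
     (\<exists>c\<in>A. \<exists>d\<in>A. \<exists>S. a \<in> cdom c \<and> b \<in> cdom d \<and> open S \<and> (coord c a, coord d b) \<in> S \<and>
        S \<subseteq> (coord c ` cdom c) \<times> (coord d ` cdom d) \<and>
        smooth_on S (\<lambda>z. F (param c (fst z)) (param d (snd z))))"

locale smooth_manifold =
  fixes A :: "('a::topological_space, 'e::euclidean_space) chart set"
  assumes atlas: "smooth_atlas A"
begin

lemma chart: "c \<in> A \<Longrightarrow> is_chart c"
  using atlas by (auto simp: smooth_atlas_def)

lemma chart_at_props: "chart_at A p \<in> A" "p \<in> cdom (chart_at A p)"
proof -
  have "p \<in> (\<Union>c\<in>A. cdom c)" using atlas by (simp add: smooth_atlas_def)
  then have "\<exists>c. c \<in> A \<and> p \<in> cdom c" by blast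
  from someI_ex[OF this] show "chart_at A p \<in> A" "p \<in> cdom (chart_at A p)"
    by (auto simp: chart_at_def)
qed

lemma open_cdom: "c \<in> A \<Longrightarrow> open (cdom c)"
  and open_image: "c \<in> A \<Longrightarrow> open (coord c ` cdom c)"
  using chart by (auto simp: is_chart_def)

lemma param_coord [simp]: "c \<in> A \<Longrightarrow> p \<in> cdom c \<Longrightarrow> param c (coord c p) = p"
  using chart[of c] by (simp add: is_chart_def homeomorphism_def)

lemma coord_param [simp]: "c \<in> A \<Longrightarrow> x \<in> coord c ` cdom c \<Longrightarrow> coord c (param c x) = x"
  by (simp add: f_inv_into_f)

lemma param_in: "c \<in> A \<Longrightarrow> x \<in> coord c ` cdom c \<Longrightarrow> param c x \<in> cdom c"
  by (simp add: inv_into_into)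

lemma continuous_param: "c \<in> A \<Longrightarrow> continuous_on (coord c ` cdom c) (param c)"
  using chart[of c] by (simp add: is_chart_def homeomorphism_def)

lemma continuous_coord: "c \<in> A \<Longrightarrow> continuous_on (cdom c) (coord c)"
  using chart[of c] by (simp add: is_chart_def homeomorphism_def)

lemma open_coord_image:
  assumes "c \<in> A" "open U"
  shows "open (coord c ` (cdom c \<inter> U))"
proof -
  have "coord c ` (cdom c \<inter> U) = (coord c ` cdom c) \<inter> param c -` U"
    using assms(1) by (auto simp: param_in)
  then show ?thesis
    using continuous_open_preimage[OF continuous_param[OF assms(1)] open_image[OF assms(1)] assms(2)] by simp
qed

lemma open_coord_vimage: "c \<in> A \<Longrightarrow> open S \<Longrightarrow> open (cdom c \<inter> coord c -` S)"
  using continuous_open_preimage[OF continuous_coord open_cdom] by blast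

lemma smooth_transition:
  "c \<in> A \<Longrightarrow> d \<in> A \<Longrightarrow> smooth_on (coord c ` (cdom c \<inter> cdom d)) (coord d \<circ> param c)"
  using atlas by (auto simp: smooth_atlas_def)

lemma smooth_atD:
  assumes "smooth_at A f p" "c \<in> A" "p \<in> cdom c"
  obtains S where "open S" "coord c p \<in> S" "S \<subseteq> coord c ` cdom c" "smooth_on S (f \<circ> param c)"
proof -
  obtain U where U: "open U" "p \<in> U" "smooth_on (coord c ` (cdom c \<inter> U)) (f \<circ> param c)"
    using assms by (auto simp: smooth_at_def)
  show ?thesis
    by (rule that[of "coord c ` (cdom c \<inter> U)"]) (use U assms open_coord_image in auto)
qed

text \<open>One chart is enough because transition maps are smooth.\<close>

lemma smooth_atI:
  assumes c: "c \<in> A" "p \<in> cdom c" and S: "open S" "coord c p \<in> S" "smooth_on S (f \<circ> param c)"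
  shows "smooth_at A f p"
  unfolding smooth_at_def
proof (intro exI conjI ballI)
  let ?U = "cdom c \<inter> coord c -` S"
  show "open ?U" using open_coord_vimage c S by blast
  show "p \<in> ?U" using c S by auto
  fix d assume d: "d \<in> A"
  let ?V = "coord d ` (cdom d \<inter> ?U)"
  have oV: "open ?V" using open_coord_image[OF d] \<open>open ?U\<close> by blast
  have "smooth_on ?V (coord c \<circ> param d)"
    by (rule smooth_on_subset[OF smooth_transition[OF d c(1)]]) auto
  moreover have im: "(coord c \<circ> param d) ` ?V \<subseteq> S" using d by auto
  ultimately have "smooth_on ?V (\<lambda>x. (f \<circ> param c) ((coord c \<circ> param d) x))"
    by (intro smooth_on_compose[OF oV S(1) im _ S(3)])
  then show "smooth_on ?V (f \<circ> param d)"
    by (rule smooth_on_cong[OF oV, rotated]) (use c d in auto)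
qed

lemma smooth_at_open:
  assumes "smooth_at A f p"
  obtains U where "open U" "p \<in> U" "\<And>q. q \<in> U \<Longrightarrow> smooth_at A f q"
  using assms unfolding smooth_at_def by blast

lemma smooth_at_cong:
  assumes "open U" "p \<in> U" "\<And>q. q \<in> U \<Longrightarrow> f q = g q" "smooth_at A f p"
  shows "smooth_at A g p"
proof -
  obtain V where V: "open V" "p \<in> V" "\<forall>c\<in>A. smooth_on (coord c ` (cdom c \<inter> V)) (f \<circ> param c)"
    using assms(4) by (auto simp: smooth_at_def)
  have "smooth_on (coord c ` (cdom c \<inter> (U \<inter> V))) (g \<circ> param c)" if "c \<in> A" for c
  proof (rule smooth_on_cong)
    show "smooth_on (coord c ` (cdom c \<inter> (U \<inter> V))) (f \<circ> param c)"
      by (rule smooth_on_subset[of "coord c ` (cdom c \<inter> V)"]) (use V that in auto)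
    show "open (coord c ` (cdom c \<inter> (U \<inter> V)))" using open_coord_image[OF that open_Int[OF assms(1) V(1)]] .
  qed (use that assms(3) in auto)
  then show ?thesis unfolding smooth_at_def using V assms(1,2) by (intro exI[of _ "U \<inter> V"]) auto
qed

lemma smooth_at_const: "smooth_at A (\<lambda>q. k) p"
  unfolding smooth_at_def by (intro exI[of _ UNIV]) (auto simp: comp_def smooth_on_const)

lemma smooth_at_coord:
  assumes "c \<in> A" "p \<in> cdom c" shows "smooth_at A (coord c) p"
proof (rule smooth_atI[OF assms open_image[OF assms(1)]])
  show "smooth_on (coord c ` cdom c) (coord c \<circ> param c)"
    by (rule smooth_on_cong[OF open_image[OF assms(1)] _ smooth_on_linear[OF bounded_linear_ident open_image[OF assms(1)]]])
      (use assms in auto)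
qed (use assms in auto)

lemma smooth_at_compose:
  fixes f :: "'a \<Rightarrow> 'v::euclidean_space" and h :: "'v \<Rightarrow> 'w::real_normed_vector"
  assumes f: "smooth_at A f p" and h: "open T" "f p \<in> T" "smooth_on T h"
  shows "smooth_at A (\<lambda>q. h (f q)) p"
proof -
  let ?c = "chart_at A p"
  obtain S where S: "open S" "coord ?c p \<in> S" "S \<subseteq> coord ?c ` cdom ?c" "smooth_on S (f \<circ> param ?c)"
    using smooth_atD[OF f chart_at_props] by blast
  let ?S = "S \<inter> (f \<circ> param ?c) -` T"
  have o: "open ?S" using continuous_open_preimage[OF smooth_on_continuous[OF S(4)] S(1) h(1)] .
  have "smooth_on ?S (\<lambda>x. h ((f \<circ> param ?c) x))"
    by (rule smooth_on_compose[OF o h(1) _ smooth_on_subset[OF S(4)] h(3)]) auto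
  then show ?thesis
    using o S h chart_at_props by (intro smooth_atI[OF chart_at_props, of ?S]) (auto simp: comp_def)
qed

lemma smooth_at_bilinear:
  fixes f :: "'a \<Rightarrow> 'v::real_normed_vector" and g :: "'a \<Rightarrow> 'u::real_normed_vector"
  assumes m: "bounded_bilinear m" and "smooth_at A f p" "smooth_at A g p"
  shows "smooth_at A (\<lambda>q. m (f q) (g q)) p"
proof -
  let ?c = "chart_at A p"
  obtain S where S: "open S" "coord ?c p \<in> S" "S \<subseteq> coord ?c ` cdom ?c" "smooth_on S (f \<circ> param ?c)"
    using smooth_atD[OF assms(2) chart_at_props] by blast
  obtain T where T: "open T" "coord ?c p \<in> T" "T \<subseteq> coord ?c ` cdom ?c" "smooth_on T (g \<circ> param ?c)"
    using smooth_atD[OF assms(3) chart_at_props] by blast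
  have o: "open (S \<inter> T)" using S T by auto
  have "smooth_on (S \<inter> T) (\<lambda>x. m ((f \<circ> param ?c) x) ((g \<circ> param ?c) x))"
    by (rule smooth_on_bilinear[OF o m smooth_on_subset[OF S(4)] smooth_on_subset[OF T(4)]]) auto
  then show ?thesis
    using o S T by (intro smooth_atI[OF chart_at_props o]) (auto simp: comp_def)
qed

lemma smooth_at_add:
  fixes f :: "'a \<Rightarrow> 'v::real_normed_vector"
  assumes "smooth_at A f p" "smooth_at A g p"
  shows "smooth_at A (\<lambda>q. f q + g q) p"
proof -
  let ?c = "chart_at A p"
  obtain S where S: "open S" "coord ?c p \<in> S" "S \<subseteq> coord ?c ` cdom ?c" "smooth_on S (f \<circ> param ?c)"
    using smooth_atD[OF assms(1) chart_at_props] by blast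
  obtain T where T: "open T" "coord ?c p \<in> T" "T \<subseteq> coord ?c ` cdom ?c" "smooth_on T (g \<circ> param ?c)"
    using smooth_atD[OF assms(2) chart_at_props] by blast
  have o: "open (S \<inter> T)" using S T by auto
  have "smooth_on (S \<inter> T) (\<lambda>x. ((f \<circ> param ?c) x) + ((g \<circ> param ?c) x))"
    by (rule smooth_on_add[OF o smooth_on_subset[OF S(4)] smooth_on_subset[OF T(4)]]) auto
  then show ?thesis
    using o S T by (intro smooth_atI[OF chart_at_props o]) (auto simp: comp_def)
qed

lemma smooth_at_scaleR:
  fixes g :: "'a \<Rightarrow> 'v::real_normed_vector"
  shows "smooth_at A f p \<Longrightarrow> smooth_at A g p \<Longrightarrow> smooth_at A (\<lambda>q. f q *\<^sub>R g q) p"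
  by (rule smooth_at_bilinear[OF bounded_bilinear_scaleR])

lemma smooth_at_inner:
  fixes g :: "'a \<Rightarrow> 'v::real_inner"
  shows "smooth_at A f p \<Longrightarrow> smooth_at A g p \<Longrightarrow> smooth_at A (\<lambda>q. f q \<bullet> g q) p"
  by (rule smooth_at_bilinear[OF bounded_bilinear_inner])

lemma smooth_at_diff:
  fixes f :: "'a \<Rightarrow> 'v::real_normed_vector"
  assumes "smooth_at A f p" "smooth_at A g p"
  shows "smooth_at A (\<lambda>q. f q - g q) p"
  using smooth_at_add[OF assms(1) smooth_at_scaleR[OF smooth_at_const[of "-1"] assms(2)]] by simp

lemma smooth_at_sum:
  fixes f :: "'i \<Rightarrow> 'a \<Rightarrow> 'v::real_normed_vector"
  assumes "\<And>i. i \<in> I \<Longrightarrow> smooth_at A (f i) p"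
  shows "smooth_at A (\<lambda>q. \<Sum>i\<in>I. f i q) p"
proof (cases "finite I")
  case True
  then show ?thesis using assms
  proof (induction I)
    case (insert i I)
    then have "smooth_at A (\<lambda>q. f i q + (\<Sum>i\<in>I. f i q)) p"
      using smooth_at_add[of "f i" p] by simp
    then show ?case using insert by simp
  qed (simp add: smooth_at_const)
qed (simp add: smooth_at_const)

lemma smooth_at_linear:
  fixes f :: "'a \<Rightarrow> 'v::euclidean_space" and h :: "'v \<Rightarrow> 'w::real_normed_vector"
  shows "linear h \<Longrightarrow> smooth_at A f p \<Longrightarrow> smooth_at A (\<lambda>q. h (f q)) p"
  using smooth_at_compose[OF _ open_UNIV _ smooth_on_linear[OF _ open_UNIV], of f p h]
  by (simp add: linear_conv_bounded_linear)

lemma smooth_at_Pair: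
  fixes f :: "'a \<Rightarrow> 'v::euclidean_space" and g :: "'a \<Rightarrow> 'w::euclidean_space"
  assumes "smooth_at A f p" "smooth_at A g p"
  shows "smooth_at A (\<lambda>q. (f q, g q)) p"
proof -
  have "linear (\<lambda>x::'v. (x, 0::'w))" "linear (\<lambda>x::'w. (0::'v, x))"
    by (auto intro!: linearI)
  from smooth_at_add[OF smooth_at_linear[OF this(1) assms(1)] smooth_at_linear[OF this(2) assms(2)]]
  show ?thesis by simp
qed

text \<open>The derivative is jointly smooth in base point and direction, as a function on
  \<open>T \<times> UNIV\<close>.\<close>

lemma smooth_at_frechet:
  fixes g :: "'a \<Rightarrow> 'v::euclidean_space" and h :: "'v \<Rightarrow> 'w::real_normed_vector"
  assumes g: "smooth_at A g p" and h: "open T" "g p \<in> T" "smooth_on T h" and w: "smooth_at A w p"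
  shows "smooth_at A (\<lambda>q. frechet_derivative h (at (g q)) (w q)) p"
proof -
  have "smooth_on (T \<times> UNIV) (\<lambda>z. frechet_derivative h (at (fst z)) (snd z))"
    by (intro smooth_on_derivative[OF _ h(1) _ _ h(3)] smooth_on_linear bounded_linear_fst bounded_linear_snd)
      (auto intro: open_Times h)
  from smooth_at_compose[OF smooth_at_Pair[OF g w] _ _ this] show ?thesis
    using h by (auto intro: open_Times)
qed

lemma smooth_fun_iff: "smooth_fun A f \<longleftrightarrow> (\<forall>p. smooth_at A f p)"
proof
  assume *: "smooth_fun A f"
  show "\<forall>p. smooth_at A f p"
    using * chart_at_props
    by (auto simp: smooth_fun_def intro!: smooth_atI[OF chart_at_props open_image])
next
  assume *: "\<forall>p. smooth_at A f p"
  show "smooth_fun A f" unfolding smooth_fun_def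
  proof (intro ballI smooth_on_local)
    fix c x assume c: "c \<in> A" "x \<in> coord c ` cdom c"
    have sm: "smooth_at A f (param c x)" using * by blast
    obtain S where S: "open S" "coord c (param c x) \<in> S" "smooth_on S (f \<circ> param c)"
      using smooth_atD[OF sm c(1) param_in[OF c]] by metis
    have "x \<in> S" using S(2) coord_param[OF c] by simp
    then show "\<exists>U. open U \<and> x \<in> U \<and> smooth_on U (f \<circ> param c)" using S(1,3) by blast
  qed
qed

lemma smooth_local_iff:
  assumes "c \<in> A"
  shows "smooth_on (coord c ` cdom c) (f \<circ> param c) \<longleftrightarrow> (\<forall>p\<in>cdom c. smooth_at A f p)"
proof
  assume *: "smooth_on (coord c ` cdom c) (f \<circ> param c)"
  show "\<forall>p\<in>cdom c. smooth_at A f p"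
    using * assms by (auto intro!: smooth_atI[OF assms _ open_image])
next
  assume *: "\<forall>p\<in>cdom c. smooth_at A f p"
  show "smooth_on (coord c ` cdom c) (f \<circ> param c)"
  proof (intro smooth_on_local)
    fix x assume c: "x \<in> coord c ` cdom c"
    have sm: "smooth_at A f (param c x)" using * param_in[OF assms c] by blast
    obtain S where S: "open S" "coord c (param c x) \<in> S" "smooth_on S (f \<circ> param c)"
      using smooth_atD[OF sm assms param_in[OF assms c]] by metis
    have "x \<in> S" using S(2) coord_param[OF assms c] by simp
    then show "\<exists>U. open U \<and> x \<in> U \<and> smooth_on U (f \<circ> param c)" using S(1,3) by blast
  qed
qed

lemma vector_fields_iff:
  "X \<in> vector_fields A \<longleftrightarrow> (\<forall>c\<in>A. \<forall>p\<in>cdom c. smooth_at A (\<lambda>q. dfun A (coord c) q (X q)) p)"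
  unfolding vector_fields_def by (auto simp: smooth_local_iff)

section \<open>Derivatives of functions along tangent vectors\<close>

lemma smooth_at_has_derivative:
  assumes "smooth_at A f p" "c \<in> A" "p \<in> cdom c"
  shows "((f \<circ> param c) has_derivative frechet_derivative (f \<circ> param c) (at (coord c p))) (at (coord c p))"
  using smooth_atD[OF assms] smooth_on_has_derivative by metis

lemma dfun_linear: "smooth_at A f p \<Longrightarrow> linear (dfun A f p)"
  using has_derivative_linear[OF smooth_at_has_derivative[OF _ chart_at_props]]
  unfolding dfun_def by (metis (no_types, lifting) ext)

lemma dfun_cong:
  assumes "open U" "p \<in> U" "\<And>q. q \<in> U \<Longrightarrow> f q = g q"
  shows "dfun A f p v = dfun A g p v"
proof -
  let ?c = "chart_at A p"
  have "frechet_derivative (f \<circ> param ?c) (at (coord ?c p)) = frechet_derivative (g \<circ> param ?c) (at (coord ?c p))"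
    by (rule frechet_derivative_cong_open[OF open_coord_image[OF chart_at_props(1) assms(1)]])
      (use assms chart_at_props in auto)
  then show ?thesis by (simp add: dfun_def)
qed

lemma dfun_compose:
  assumes "smooth_at A f p" "(h has_derivative D) (at (f p))"
  shows "dfun A (\<lambda>q. h (f q)) p v = D (dfun A f p v)"
proof -
  let ?c = "chart_at A p"
  have "(h has_derivative D) (at ((f \<circ> param ?c) (coord ?c p)))" using assms(2) chart_at_props by simp
  from has_derivative_compose[OF smooth_at_has_derivative[OF assms(1) chart_at_props] this]
  show ?thesis by (simp add: dfun_def comp_def frechet_derivative_eq)
qed

lemma dfun_chart:
  assumes "smooth_at A f p" "d \<in> A" "p \<in> cdom d"
  shows "dfun A f p v = frechet_derivative (f \<circ> param d) (at (coord d p)) (dfun A (coord d) p v)"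
proof -
  have "dfun A f p v = dfun A (\<lambda>q. (f \<circ> param d) (coord d q)) p v"
    by (rule dfun_cong[OF open_cdom[OF assms(2)] assms(3)]) (use assms in auto)
  also have "\<dots> = frechet_derivative (f \<circ> param d) (at (coord d p)) (dfun A (coord d) p v)"
    by (rule dfun_compose[OF smooth_at_coord[OF assms(2,3)] smooth_at_has_derivative[OF assms]])
  finally show ?thesis .
qed

lemma dfun_const: "dfun A (\<lambda>q. k) p v = 0"
proof -
  have "frechet_derivative ((\<lambda>q. k) \<circ> param (chart_at A p)) (at (coord (chart_at A p) p)) = (\<lambda>v. 0)"
    by (rule frechet_derivative_eq) (simp add: comp_def)
  then show ?thesis by (simp add: dfun_def)
qed

lemma dfun_bilinear:
  assumes m: "bounded_bilinear m" and "smooth_at A f p" "smooth_at A g p"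
  shows "dfun A (\<lambda>q. m (f q) (g q)) p v = m (f p) (dfun A g p v) + m (dfun A f p v) (g p)"
proof -
  let ?c = "chart_at A p"
  from bounded_bilinear.FDERIV[OF m smooth_at_has_derivative[OF assms(2) chart_at_props]
      smooth_at_has_derivative[OF assms(3) chart_at_props]]
  show ?thesis using chart_at_props by (simp add: dfun_def comp_def frechet_derivative_eq)
qed

lemma dfun_add:
  assumes "smooth_at A f p" "smooth_at A g p"
  shows "dfun A (\<lambda>q. f q + g q) p v = dfun A f p v + dfun A g p v"
proof -
  from has_derivative_add[OF smooth_at_has_derivative[OF assms(1) chart_at_props]
      smooth_at_has_derivative[OF assms(2) chart_at_props]]
  show ?thesis using chart_at_props by (simp add: dfun_def comp_def frechet_derivative_eq)
qed

lemmas dfun_scaleR = dfun_bilinear[OF bounded_bilinear_scaleR]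

lemma dfun_diff:
  fixes f :: "'a \<Rightarrow> 'v::real_normed_vector"
  assumes "smooth_at A f p" "smooth_at A g p"
  shows "dfun A (\<lambda>q. f q - g q) p v = dfun A f p v - dfun A g p v"
  using dfun_add[OF assms(1) smooth_at_scaleR[OF smooth_at_const[of "-1"] assms(2)]]
    dfun_scaleR[OF smooth_at_const[of "-1"] assms(2)] by (simp add: dfun_const)

lemma dfun_sum:
  fixes f :: "'i \<Rightarrow> 'a \<Rightarrow> 'v::real_normed_vector"
  assumes "finite I" "\<And>i. i \<in> I \<Longrightarrow> smooth_at A (f i) p"
  shows "dfun A (\<lambda>q. \<Sum>i\<in>I. f i q) p v = (\<Sum>i\<in>I. dfun A (f i) p v)"
  using assms
proof (induction I)
  case (insert i I)
  then show ?case using dfun_add[OF insert.prems[of i] smooth_at_sum[of I f p]] by simp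
qed (simp add: dfun_const)

text \<open>Tangent vectors at \<open>p\<close> are by definition their components in
  \<open>chart_at A p\<close>.\<close>

lemma dfun_chart_at: "dfun A (coord (chart_at A p)) p v = v"
proof -
  let ?c = "chart_at A p"
  have "frechet_derivative (coord ?c \<circ> param ?c) (at (coord ?c p)) = frechet_derivative (\<lambda>x. x) (at (coord ?c p))"
    by (rule frechet_derivative_cong_open[OF open_image]) (use chart_at_props in auto)
  then show ?thesis by (simp add: dfun_def frechet_derivative_eq[OF has_derivative_ident])
qed

lemma smooth_map_at_id: "smooth_map_at A (\<lambda>q. q) p"
  unfolding smooth_map_at_def using open_cdom smooth_at_coord by auto

lemma smooth_map_at_const: "smooth_map_at A (\<lambda>q. k) p"
  unfolding smooth_map_at_def using smooth_at_const open_UNIV by auto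

lemma smooth_at_comp_map:
  assumes h: "smooth_map_at A h p" and f: "smooth_at A f (h p)"
  shows "smooth_at A (\<lambda>q. f (h q)) p"
    and "dfun A (\<lambda>q. f (h q)) p v = dfun A f (h p) (dmap A h p v)"
proof -
  let ?c = "chart_at A (h p)"
  obtain U where U: "open U" "p \<in> U" "h ` U \<subseteq> cdom ?c" and s: "smooth_at A (\<lambda>q. coord ?c (h q)) p"
    using h chart_at_props unfolding smooth_map_at_def by metis
  obtain S where S: "open S" "coord ?c (h p) \<in> S" "S \<subseteq> coord ?c ` cdom ?c" "smooth_on S (f \<circ> param ?c)"
    using smooth_atD[OF f chart_at_props] by blast
  have eq: "(f \<circ> param ?c) (coord ?c (h q)) = f (h q)" if "q \<in> U" for q
    using that U chart_at_props by auto
  from smooth_at_compose[OF s S(1,2,4)] show "smooth_at A (\<lambda>q. f (h q)) p"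
    by (rule smooth_at_cong[OF U(1,2), rotated]) (use eq in auto)
  have "dfun A (\<lambda>q. f (h q)) p v = dfun A (\<lambda>q. (f \<circ> param ?c) (coord ?c (h q))) p v"
    by (rule dfun_cong[OF U(1,2)]) (use eq in auto)
  also have "\<dots> = frechet_derivative (f \<circ> param ?c) (at (coord ?c (h p))) (dfun A (\<lambda>q. coord ?c (h q)) p v)"
    by (rule dfun_compose[OF s smooth_on_has_derivative[OF S(4,2)]])
  finally show "dfun A (\<lambda>q. f (h q)) p v = dfun A f (h p) (dmap A h p v)"
    by (simp add: dmap_def dfun_def[of A f] comp_def)
qed

text \<open>Continuity of \<open>h\<close> at \<open>p\<close> is recovered from the smoothness of
  its coordinate expression; injectivity of the chart turns membership of coordinates in
  \<open>?W\<close> back into membership in \<open>V\<close>.\<close>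

lemma smooth_map_at_nbhd:
  assumes h: "smooth_map_at A h p" and V: "open V" "h p \<in> V"
  obtains U where "open U" "p \<in> U" "h ` U \<subseteq> V"
proof -
  let ?c = "chart_at A (h p)"
  obtain U where U: "open U" "p \<in> U" "h ` U \<subseteq> cdom ?c" and s: "smooth_at A (\<lambda>q. coord ?c (h q)) p"
    using h chart_at_props unfolding smooth_map_at_def by metis
  obtain d where d: "d = chart_at A p" by blast
  have dA: "d \<in> A" "p \<in> cdom d" using chart_at_props d by auto
  obtain T where T: "open T" "coord d p \<in> T" "T \<subseteq> coord d ` cdom d"
      "smooth_on T ((\<lambda>q. coord ?c (h q)) \<circ> param d)"
    using smooth_atD[OF s dA] by blast
  let ?W = "coord ?c ` (cdom ?c \<inter> V)"
  have oW: "open ?W" using open_coord_image[OF chart_at_props(1) V(1)] .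
  let ?T = "T \<inter> ((\<lambda>q. coord ?c (h q)) \<circ> param d) -` ?W"
  have oT: "open ?T" using continuous_open_preimage[OF smooth_on_continuous[OF T(4)] T(1) oW] .
  let ?O = "U \<inter> (cdom d \<inter> coord d -` ?T)"
  have 1: "open ?O" using U(1) open_coord_vimage[OF dA(1) oT] by auto
  have 2: "p \<in> ?O" using U T dA V chart_at_props by auto
  have "h q \<in> V" if "q \<in> ?O" for q
  proof -
    have "coord ?c (h q) \<in> ?W" "h q \<in> cdom ?c" using that dA U by auto
    then obtain r where "r \<in> cdom ?c" "r \<in> V" "coord ?c (h q) = coord ?c r" by auto
    then have "h q = r" using \<open>h q \<in> cdom ?c\<close> param_coord[OF chart_at_props(1)] by metis
    then show ?thesis using V \<open>r \<in> V\<close> by auto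
  qed
  then show ?thesis using that[OF 1 2] by blast
qed

section \<open>Functions of two points and their partial derivatives\<close>

lemma smooth_at2_comp_fst:
  assumes F: "smooth_at2 A F (k a) b" and k: "smooth_map_at A k a"
  shows "smooth_at2 A (\<lambda>p q. F (k p) q) a b"
proof -
  obtain c d S where cd: "c \<in> A" "d \<in> A" "k a \<in> cdom c" "b \<in> cdom d"
    and S: "open S" "(coord c (k a), coord d b) \<in> S"
    "S \<subseteq> (coord c ` cdom c) \<times> (coord d ` cdom d)"
    "smooth_on S (\<lambda>z. F (param c (fst z)) (param d (snd z)))" (is "smooth_on S ?G")
    using F unfolding smooth_at2_def by blast
  obtain U where U: "open U" "a \<in> U" "k ` U \<subseteq> cdom c" and sk: "smooth_at A (\<lambda>q. coord c (k q)) a"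
    using k cd unfolding smooth_map_at_def by blast
  obtain e where "e = chart_at A a" by blast
  then have e: "e \<in> A" "a \<in> cdom e" using chart_at_props by auto
  obtain T0 where T0: "open T0" "coord e a \<in> T0" "T0 \<subseteq> coord e ` cdom e"
      "smooth_on T0 ((\<lambda>q. coord c (k q)) \<circ> param e)"
    using smooth_atD[OF sk e] by blast
  define T where "T = T0 \<inter> coord e ` (cdom e \<inter> U)"
  have T: "open T" "coord e a \<in> T" "T \<subseteq> coord e ` cdom e"
      "smooth_on T ((\<lambda>q. coord c (k q)) \<circ> param e)"
    unfolding T_def using T0 open_coord_image[OF e(1) U(1)] U(2) e
    by (auto intro: smooth_on_subset)
  have kT: "k (param e x) \<in> cdom c" if "x \<in> T" for x
    using that U(3) e(1) unfolding T_def by auto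
  let ?m = "\<lambda>z::'e\<times>'e. (((\<lambda>q. coord c (k q)) \<circ> param e) (fst z), snd z)"
  have oT: "open (T \<times> (UNIV::'e set))" using T(1) by (simp add: open_Times)
  have "smooth_on (T \<times> UNIV) (\<lambda>z::'e\<times>'e. ((\<lambda>q. coord c (k q)) \<circ> param e) (fst z))"
    by (rule smooth_on_compose[OF oT T(1) _ smooth_on_linear[OF bounded_linear_fst oT] T(4)]) auto
  from smooth_on_Pair[OF oT this smooth_on_linear[OF bounded_linear_snd oT]]
  have sm: "smooth_on (T \<times> UNIV) ?m" .
  let ?S = "(T \<times> UNIV) \<inter> ?m -` S"
  have oS: "open ?S" using continuous_open_preimage[OF smooth_on_continuous[OF sm] oT S(1)] .
  have im: "?m ` ?S \<subseteq> S" by blast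
  have "smooth_on ?S (\<lambda>z. ?G (?m z))"
    by (rule smooth_on_compose[OF oS S(1) im smooth_on_subset[OF sm] S(4)]) blast
  then have *: "smooth_on ?S (\<lambda>z. F (k (param e (fst z))) (param d (snd z)))"
    by (rule smooth_on_cong[OF oS, rotated]) (use kT cd in auto)
  have "?S \<subseteq> (coord e ` cdom e) \<times> (coord d ` cdom d)" using T(3) S(3) by auto
  moreover have "(coord e a, coord d b) \<in> ?S" using T(2) S(2) e by auto
  ultimately show ?thesis unfolding smooth_at2_def using e cd(2,4) oS * by blast
qed

text \<open>The total derivative is linear and \<open>(u, w) = (u, 0) + (0, w)\<close>; freezing one
  argument corresponds to one summand.\<close>

lemma smooth_at2_comp:
  assumes F: "smooth_at2 A F (k r) (l r)" and k: "smooth_map_at A k r" and l: "smooth_map_at A l r"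
  shows "smooth_at A (\<lambda>q. F (k q) (l q)) r"
    and "dfun A (\<lambda>q. F (k q) (l q)) r v = dfun A (\<lambda>q. F (k q) (l r)) r v + dfun A (\<lambda>q. F (k r) (l q)) r v"
proof -
  obtain c d S where cd: "c \<in> A" "d \<in> A" "k r \<in> cdom c" "l r \<in> cdom d"
    and S: "open S" "(coord c (k r), coord d (l r)) \<in> S"
    "S \<subseteq> (coord c ` cdom c) \<times> (coord d ` cdom d)"
    "smooth_on S (\<lambda>z. F (param c (fst z)) (param d (snd z)))" (is "smooth_on S ?G")
    using F unfolding smooth_at2_def by blast
  obtain U where U: "open U" "r \<in> U" "k ` U \<subseteq> cdom c" and sk: "smooth_at A (\<lambda>q. coord c (k q)) r"
    using k cd unfolding smooth_map_at_def by blast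
  obtain V where V: "open V" "r \<in> V" "l ` V \<subseteq> cdom d" and sl: "smooth_at A (\<lambda>q. coord d (l q)) r"
    using l cd unfolding smooth_map_at_def by blast
  let ?D = "frechet_derivative ?G (at (coord c (k r), coord d (l r)))"
  have G: "(?G has_derivative ?D) (at (coord c (k r), coord d (l r)))"
    using smooth_on_has_derivative[OF S(4,2)] .
  have eq: "?G (coord c (k q), coord d (l q)) = F (k q) (l q)"
    "?G (coord c (k q), coord d (l r)) = F (k q) (l r)"
    "?G (coord c (k r), coord d (l q)) = F (k r) (l q)" if "q \<in> U \<inter> V" for q
    using that U V cd by (auto simp: image_subset_iff)
  have o: "open (U \<inter> V)" "r \<in> U \<inter> V" using U V by auto
  have s: "smooth_at A (\<lambda>q. ?G (coord c (k q), coord d (l q))) r"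
    using smooth_at_compose[OF smooth_at_Pair[OF sk sl] S(1,2,4)] .
  show "smooth_at A (\<lambda>q. F (k q) (l q)) r"
    by (rule smooth_at_cong[OF o _ s]) (use eq(1) in auto)
  have pr: "dfun A (\<lambda>q. (f q, g q)) r v = (dfun A f r v, dfun A g r v)"
    if "smooth_at A f r" "smooth_at A g r" for f g :: "'a \<Rightarrow> 'e"
    using has_derivative_Pair[OF smooth_at_has_derivative[OF that(1) chart_at_props]
        smooth_at_has_derivative[OF that(2) chart_at_props]]
    by (simp add: dfun_def comp_def frechet_derivative_eq)
  let ?u = "dfun A (\<lambda>q. coord c (k q)) r v" and ?w = "dfun A (\<lambda>q. coord d (l q)) r v"
  have "dfun A (\<lambda>q. F (k q) (l q)) r v = dfun A (\<lambda>q. ?G (coord c (k q), coord d (l q))) r v"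
    by (rule dfun_cong[OF o]) (use eq(1) in auto)
  also have "\<dots> = ?D (?u, ?w)"
    by (subst dfun_compose[OF smooth_at_Pair[OF sk sl] G]) (simp add: pr sk sl)
  finally have 1: "dfun A (\<lambda>q. F (k q) (l q)) r v = ?D (?u, ?w)" .
  have "dfun A (\<lambda>q. F (k q) (l r)) r v = dfun A (\<lambda>q. ?G (coord c (k q), coord d (l r))) r v"
    by (rule dfun_cong[OF o]) (use eq(2) in auto)
  also have "\<dots> = ?D (?u, 0)"
    by (subst dfun_compose[OF smooth_at_Pair[OF sk smooth_at_const] G]) (simp add: pr sk smooth_at_const dfun_const)
  finally have 2: "dfun A (\<lambda>q. F (k q) (l r)) r v = ?D (?u, 0)" .
  have "dfun A (\<lambda>q. F (k r) (l q)) r v = dfun A (\<lambda>q. ?G (coord c (k r), coord d (l q))) r v"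
    by (rule dfun_cong[OF o]) (use eq(3) in auto)
  also have "\<dots> = ?D (0, ?w)"
    by (subst dfun_compose[OF smooth_at_Pair[OF smooth_at_const sl] G]) (simp add: pr sl smooth_at_const dfun_const)
  finally have 3: "dfun A (\<lambda>q. F (k r) (l q)) r v = ?D (0, ?w)" .
  show "dfun A (\<lambda>q. F (k q) (l q)) r v = dfun A (\<lambda>q. F (k q) (l r)) r v + dfun A (\<lambda>q. F (k r) (l q)) r v"
    using linear_add[OF has_derivative_linear[OF G], of "(?u, 0)" "(0, ?w)"] 1 2 3 by simp
qed

lemma smooth_at2_partial:
  assumes G: "open S" "S \<subseteq> (coord c ` cdom c) \<times> (coord d ` cdom d)"
    "smooth_on S (\<lambda>z. F (param c (fst z)) (param d (snd z)))" (is "smooth_on S ?G")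
    and cd: "c \<in> A" "d \<in> A" "p \<in> cdom c" "q \<in> cdom d" "(coord c p, coord d q) \<in> S"
  shows "dfun A (F p) q v = frechet_derivative ?G (at (coord c p, coord d q)) (0, dfun A (coord d) q v)"
    and "dfun A (\<lambda>p. F p q) p v = frechet_derivative ?G (at (coord c p, coord d q)) (dfun A (coord c) p v, 0)"
proof -
  let ?D = "frechet_derivative ?G (at (coord c p, coord d q))"
  have G': "(?G has_derivative ?D) (at (coord c p, coord d q))"
    using smooth_on_has_derivative[OF G(3) cd(5)] .
  have "((\<lambda>y. (coord c p, y)) has_derivative (\<lambda>h. (0, h))) (at (coord d q))"
    by (intro has_derivative_Pair has_derivative_const has_derivative_ident)
  from has_derivative_compose[OF this G'] have 1: "((\<lambda>y. ?G (coord c p, y)) has_derivative (\<lambda>h. ?D (0, h))) (at (coord d q))" .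
  have "dfun A (F p) q v = dfun A (\<lambda>q. ?G (coord c p, coord d q)) q v"
    by (rule dfun_cong[OF open_cdom[OF cd(2)] cd(4)]) (use cd in auto)
  also have "\<dots> = ?D (0, dfun A (coord d) q v)"
    by (rule dfun_compose[OF smooth_at_coord[OF cd(2,4)] 1])
  finally show "dfun A (F p) q v = ?D (0, dfun A (coord d) q v)" .
  have "((\<lambda>y. (y, coord d q)) has_derivative (\<lambda>h. (h, 0))) (at (coord c p))"
    by (intro has_derivative_Pair has_derivative_const has_derivative_ident)
  from has_derivative_compose[OF this G'] have 1: "((\<lambda>y. ?G (y, coord d q)) has_derivative (\<lambda>h. ?D (h, 0))) (at (coord c p))" .
  have "dfun A (\<lambda>p. F p q) p v = dfun A (\<lambda>p. ?G (coord c p, coord d q)) p v"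
    by (rule dfun_cong[OF open_cdom[OF cd(1)] cd(3)]) (use cd in auto)
  also have "\<dots> = ?D (dfun A (coord c) p v, 0)"
    by (rule dfun_compose[OF smooth_at_coord[OF cd(1,3)] 1])
  finally show "dfun A (\<lambda>p. F p q) p v = ?D (dfun A (coord c) p v, 0)" .
qed

text \<open>A partial derivative at a moving point along a moving vector is smooth, provided that
  the vector is smooth in chart components. This is the source of smoothness for \<open>lder\<close>
  and \<open>mc\<close>.\<close>

lemma smooth_at_partial:
  assumes F: "smooth_at2 A F a (k a)" and k: "smooth_map_at A k a"
    and X: "\<And>d. d \<in> A \<Longrightarrow> k a \<in> cdom d \<Longrightarrow> smooth_at A (\<lambda>p. dfun A (coord d) (k p) (X p)) a"
  shows "smooth_at A (\<lambda>p. dfun A (F p) (k p) (X p)) a"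
proof -
  obtain c d S where cd: "c \<in> A" "d \<in> A" "a \<in> cdom c" "k a \<in> cdom d"
    and S: "open S" "(coord c a, coord d (k a)) \<in> S"
    "S \<subseteq> (coord c ` cdom c) \<times> (coord d ` cdom d)"
    "smooth_on S (\<lambda>z. F (param c (fst z)) (param d (snd z)))" (is "smooth_on S ?G")
    using F unfolding smooth_at2_def by blast
  obtain V where V: "open V" "a \<in> V" "k ` V \<subseteq> cdom d" and sk: "smooth_at A (\<lambda>q. coord d (k q)) a"
    using k cd unfolding smooth_map_at_def by blast
  have sp: "smooth_at A (\<lambda>p. (coord c p, coord d (k p))) a"
    by (rule smooth_at_Pair[OF smooth_at_coord[OF cd(1,3)] sk])
  have sw: "smooth_at A (\<lambda>p. (0::'e, dfun A (coord d) (k p) (X p))) a"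
    by (rule smooth_at_Pair[OF smooth_at_const X[OF cd(2,4)]])
  have s: "smooth_at A (\<lambda>p. frechet_derivative ?G (at (coord c p, coord d (k p))) (0, dfun A (coord d) (k p) (X p))) a"
    by (rule smooth_at_frechet[OF sp S(1,2,4) sw])
  obtain e where e: "e = chart_at A a" by blast
  have eA: "e \<in> A" "a \<in> cdom e" using chart_at_props e by auto
  obtain T where T: "open T" "coord e a \<in> T" "T \<subseteq> coord e ` cdom e"
      "smooth_on T ((\<lambda>p. (coord c p, coord d (k p))) \<circ> param e)"
    using smooth_atD[OF sp eA] by blast
  \<comment> \<open>The formula for the partial derivative holds only where the coordinates lie in
    \<open>S\<close>, so the neighbourhood of \<open>a\<close> is shrunk to the preimage of
    \<open>S\<close>.\<close>
  let ?T = "T \<inter> ((\<lambda>p. (coord c p, coord d (k p))) \<circ> param e) -` S"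
  have oT: "open ?T" using continuous_open_preimage[OF smooth_on_continuous[OF T(4)] T(1) S(1)] .
  let ?O = "V \<inter> cdom c \<inter> (cdom e \<inter> coord e -` ?T)"
  have oO: "open ?O" using V(1) open_cdom[OF cd(1)] open_coord_vimage[OF eA(1) oT] by auto
  have aO: "a \<in> ?O" using V T eA cd S by auto
  have "frechet_derivative ?G (at (coord c p, coord d (k p))) (0, dfun A (coord d) (k p) (X p)) =
      dfun A (F p) (k p) (X p)" if "p \<in> ?O" for p
    by (rule smooth_at2_partial(1)[OF S(1,3,4) cd(1,2), symmetric]) (use that V eA in auto)
  from smooth_at_cong[OF oO aO this s] show ?thesis by simp
qed

text \<open>Derivatives in different variables commute; in a pair of charts this is symmetry of the
  second derivative for the directions \<open>(u, 0)\<close> and \<open>(0, v)\<close>.\<close>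

lemma dfun_mixed_symmetric:
  fixes F :: "'a \<Rightarrow> 'a \<Rightarrow> 'w::euclidean_space"
  assumes F: "smooth_at2 A F a b"
  shows "dfun A (\<lambda>p. dfun A (F p) b v) a u = dfun A (\<lambda>q. dfun A (\<lambda>p. F p q) a u) b v"
proof -
  obtain c d S where cd: "c \<in> A" "d \<in> A" "a \<in> cdom c" "b \<in> cdom d"
    and S: "open S" "(coord c a, coord d b) \<in> S"
    "S \<subseteq> (coord c ` cdom c) \<times> (coord d ` cdom d)"
    "smooth_on S (\<lambda>z. F (param c (fst z)) (param d (snd z)))" (is "smooth_on S ?G")
    using F unfolding smooth_at2_def by blast
  obtain M N where MN: "open M" "open N" "(coord c a, coord d b) \<in> M \<times> N" "M \<times> N \<subseteq> S"
    using S(1,2) open_prod_elim by blast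
  let ?u = "dfun A (coord c) a u" and ?v = "dfun A (coord d) b v"
  let ?U = "cdom c \<inter> coord c -` M" and ?V = "cdom d \<inter> coord d -` N"
  have oU: "open ?U" "a \<in> ?U" and oV: "open ?V" "b \<in> ?V" using MN cd open_coord_vimage by auto
  let ?P = "\<lambda>z. frechet_derivative ?G (at z) (0, ?v)" and ?Q = "\<lambda>z. frechet_derivative ?G (at z) (?u, 0)"
  let ?z = "(coord c a, coord d b)"
  have sG: "smooth_on S ?P" "smooth_on S ?Q" by (rule smooth_on_directional[OF S(4)])+
  have P: "(?P has_derivative frechet_derivative ?P (at ?z)) (at ?z)"
    "(?Q has_derivative frechet_derivative ?Q (at ?z)) (at ?z)"
    using smooth_on_has_derivative[OF sG(1) S(2)] smooth_on_has_derivative[OF sG(2) S(2)] by auto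
  have "((\<lambda>y. (y, coord d b)) has_derivative (\<lambda>h. (h, 0))) (at (coord c a))"
    by (intro has_derivative_Pair has_derivative_const has_derivative_ident)
  from has_derivative_compose[OF this P(1)]
  have 1: "((\<lambda>y. ?P (y, coord d b)) has_derivative (\<lambda>h. frechet_derivative ?P (at ?z) (h, 0))) (at (coord c a))" .
  have "((\<lambda>y. (coord c a, y)) has_derivative (\<lambda>h. (0, h))) (at (coord d b))"
    by (intro has_derivative_Pair has_derivative_const has_derivative_ident)
  from has_derivative_compose[OF this P(2)]
  have 2: "((\<lambda>y. ?Q (coord c a, y)) has_derivative (\<lambda>h. frechet_derivative ?Q (at ?z) (0, h))) (at (coord d b))" .
  have "dfun A (\<lambda>p. dfun A (F p) b v) a u = dfun A (\<lambda>p. ?P (coord c p, coord d b)) a u"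
    by (rule dfun_cong[OF oU], rule smooth_at2_partial(1)[OF S(1,3,4) cd(1,2)]) (use MN cd in auto)
  also have "\<dots> = frechet_derivative ?P (at ?z) (?u, 0)"
    by (rule dfun_compose[OF smooth_at_coord[OF cd(1,3)] 1])
  also have "\<dots> = frechet_derivative ?Q (at ?z) (0, ?v)"
    by (rule symmetric_second_derivative[OF S(1,4,2)])
  also have "\<dots> = dfun A (\<lambda>q. ?Q (coord c a, coord d q)) b v"
    by (rule dfun_compose[OF smooth_at_coord[OF cd(2,4)] 2, symmetric])
  also have "\<dots> = dfun A (\<lambda>q. dfun A (\<lambda>p. F p q) a u) b v"
    by (rule dfun_cong[OF oV], rule smooth_at2_partial(2)[OF S(1,3,4) cd(1,2), symmetric]) (use MN cd in auto)
  finally show ?thesis .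
qed

end


section \<open>Left translations of a Lie group\<close>

lemma linear_sum_Basis:
  fixes D :: "'e::euclidean_space \<Rightarrow> 'w::real_vector"
  shows "linear D \<Longrightarrow> (\<Sum>b\<in>Basis. (v \<bullet> b) *\<^sub>R D b) = D v"
  by (metis linear_expand)

locale lie_grp =
  fixes G :: "'a::{t2_space, second_countable_topology} monoid" (structure)
    and A :: "('a, 'e::euclidean_space) chart set"
  assumes lie: "lie_group G A"

sublocale lie_grp \<subseteq> smooth_manifold A
  using lie by unfold_locales (simp add: lie_group_def)

sublocale lie_grp \<subseteq> group G
  using lie by (simp add: lie_group_def)

context lie_grp
begin

lemma carrier_UNIV [simp]: "carrier G = UNIV"
  using lie by (simp add: lie_group_def)

lemma inv_cancel [simp]: "inv p \<otimes> (p \<otimes> q) = q" "p \<otimes> (inv p \<otimes> q) = q"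
  by (simp_all add: m_assoc[symmetric])

abbreviation x1 :: "'a \<Rightarrow> 'e" where "x1 \<equiv> coord (chart_at A \<one>)"

text \<open>Differentiation along the left-invariant field with value \<open>u\<close> at the
  identity. Differentiating in the translation variable keeps all tangent vectors at
  \<open>\<one>\<close>, so that the arbitrary choice of charts at other points never
  enters.\<close>

definition lder :: "'e \<Rightarrow> ('a \<Rightarrow> 'w::real_normed_vector) \<Rightarrow> 'a \<Rightarrow> 'w" where
  "lder u f p = dfun A (\<lambda>q. f (p \<otimes> q)) \<one> u"

abbreviation lf :: "'e \<Rightarrow> 'a \<Rightarrow> 'e" where "lf \<equiv> left_field G A"

abbreviation lb :: "'e \<Rightarrow> 'e \<Rightarrow> 'e" where "lb \<equiv> lie_bracket G A"

lemma continuous_mult: "continuous_on UNIV (\<lambda>z. fst z \<otimes> snd z)"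
  using lie by (simp add: lie_group_def smooth_map_def case_prod_beta)

lemma continuous_inv: "continuous_on UNIV (\<lambda>p. inv p)"
  using lie by (simp add: lie_group_def smooth_map_def)

text \<open>Translates smoothness of the multiplication from the product atlas to pairs of charts of
  \<open>A\<close>; all later smoothness of products comes from here.\<close>

lemma smooth_at2_mult:
  assumes f: "smooth_at A f (a \<otimes> b)"
  shows "smooth_at2 A (\<lambda>p q. f (p \<otimes> q)) a b"
proof -
  obtain c d k where cdk: "c = chart_at A a" "d = chart_at A b" "k = chart_at A (a \<otimes> b)" by blast
  have c: "c \<in> A" "a \<in> cdom c" and d: "d \<in> A" "b \<in> cdom d" and k: "k \<in> A" "a \<otimes> b \<in> cdom k"
    using chart_at_props cdk by auto
  let ?P = "(cdom c \<times> cdom d, map_prod (coord c) (coord d))"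
  let ?mu = "\<lambda>z. fst z \<otimes> snd z"
  have P: "?P \<in> prod_atlas A A" using c d unfolding prod_atlas_def by blast
  \<comment> \<open>\<open>param\<close> of the product chart is one inverse on a product set, so
    its splitting into two factors has to be derived from injectivity.\<close>
  have pP: "param ?P z = (param c (fst z), param d (snd z))"
    if z: "z \<in> coord c ` cdom c \<times> coord d ` cdom d" for z
  proof -
    obtain x y where xy: "x \<in> cdom c" "y \<in> cdom d" "z = (coord c x, coord d y)" using z by auto
    have "inj_on (map_prod (coord c) (coord d)) (cdom c \<times> cdom d)"
    proof (rule inj_onI)
      fix s t assume *: "s \<in> cdom c \<times> cdom d" "t \<in> cdom c \<times> cdom d"
        "map_prod (coord c) (coord d) s = map_prod (coord c) (coord d) t"
      then have "param c (coord c (fst s)) = param c (coord c (fst t))"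
        "param d (coord d (snd s)) = param d (coord d (snd t))"
        by (simp_all add: map_prod_def split_beta)
      then show "s = t" using *(1,2) param_coord[OF c(1)] param_coord[OF d(1)] by (metis mem_Times_iff prod_eqI)
    qed
    from inv_into_f_f[OF this, of "(x, y)"] xy show ?thesis
      using param_coord[OF c(1) xy(1)] param_coord[OF d(1) xy(2)] by simp
  qed
  define S0 where "S0 = map_prod (coord c) (coord d) ` ((cdom c \<times> cdom d) \<inter> ?mu -` cdom k)"
  have "smooth_on S0 (coord k \<circ> ?mu \<circ> param ?P)"
  proof -
    have "\<forall>P\<in>prod_atlas A A. \<forall>d\<in>A. smooth_on (coord P ` (cdom P \<inter> ?mu -` cdom d)) (coord d \<circ> ?mu \<circ> param P)"
      using lie by (simp add: lie_group_def smooth_map_def case_prod_beta')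
    from bspec[OF bspec[OF this P] k(1)] show ?thesis unfolding S0_def by (simp only: fst_conv snd_conv)
  qed
  define I where "I = coord c ` cdom c \<times> coord d ` cdom d"
  let ?\<phi> = "\<lambda>z. (param c (fst z), param d (snd z))"
  have oI: "open I" unfolding I_def using open_image c d by (intro open_Times) auto
  have "continuous_on I ?\<phi>" unfolding I_def
    by (intro continuous_on_Pair continuous_on_compose2[OF continuous_param[OF c(1)]]
        continuous_on_compose2[OF continuous_param[OF d(1)]] continuous_on_fst continuous_on_snd continuous_on_id) auto
  then have cm: "continuous_on I (\<lambda>z. ?mu (?\<phi> z))"
    by (rule continuous_on_compose2[OF continuous_mult]) auto
  have S0: "S0 = I \<inter> (\<lambda>z. ?mu (?\<phi> z)) -` cdom k"
  proof
    show "S0 \<subseteq> I \<inter> (\<lambda>z. ?mu (?\<phi> z)) -` cdom k" unfolding S0_def I_def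
      using param_coord[OF c(1)] param_coord[OF d(1)] by auto
    show "I \<inter> (\<lambda>z. ?mu (?\<phi> z)) -` cdom k \<subseteq> S0"
    proof
      fix z assume z: "z \<in> I \<inter> (\<lambda>z. ?mu (?\<phi> z)) -` cdom k"
      then obtain x y where xy: "x \<in> cdom c" "y \<in> cdom d" "z = (coord c x, coord d y)" by (auto simp: I_def)
      then have "x \<otimes> y \<in> cdom k" using z param_coord[OF c(1)] param_coord[OF d(1)] by auto
      then show "z \<in> S0" unfolding S0_def using xy by (intro image_eqI[of _ _ "(x, y)"]) auto
    qed
  qed
  have oS0: "open S0" unfolding S0 using continuous_open_preimage[OF cm oI open_cdom[OF k(1)]] .
  have s0: "smooth_on S0 (\<lambda>z. coord k (?mu (?\<phi> z)))"
    by (rule smooth_on_cong[OF oS0 _ \<open>smooth_on S0 (coord k \<circ> ?mu \<circ> param ?P)\<close>])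
      (use pP S0 I_def in auto)
  obtain T where T: "open T" "coord k (a \<otimes> b) \<in> T" "T \<subseteq> coord k ` cdom k" "smooth_on T (f \<circ> param k)"
    using smooth_atD[OF f k] by blast
  let ?S = "S0 \<inter> (\<lambda>z. coord k (?mu (?\<phi> z))) -` T"
  have oS: "open ?S" using continuous_open_preimage[OF smooth_on_continuous[OF s0] oS0 T(1)] .
  have "smooth_on ?S (\<lambda>z. (f \<circ> param k) (coord k (?mu (?\<phi> z))))"
    by (rule smooth_on_compose[OF oS T(1) _ smooth_on_subset[OF s0] T(4)]) auto
  then have *: "smooth_on ?S (\<lambda>z. f (param c (fst z) \<otimes> param d (snd z)))"
    by (rule smooth_on_cong[OF oS, rotated]) (use S0 k in auto)
  have "?S \<subseteq> (coord c ` cdom c) \<times> (coord d ` cdom d)" using S0 I_def by blast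
  moreover have "(coord c a, coord d b) \<in> ?S" unfolding S0 I_def using c d k T by auto
  ultimately show ?thesis unfolding smooth_at2_def using c d oS * by blast
qed

lemma smooth_map_at_inv: "smooth_map_at A (\<lambda>p. inv p) p"
  unfolding smooth_map_at_def
proof (intro ballI impI conjI)
  fix d assume d: "d \<in> A" "inv p \<in> cdom d"
  have o: "open ((\<lambda>p. inv p) -` cdom d)"
    using open_vimage[OF open_cdom[OF d(1)] continuous_inv] .
  show "\<exists>U. open U \<and> p \<in> U \<and> (\<lambda>p. inv p) ` U \<subseteq> cdom d"
    using o d by (intro exI[of _ "(\<lambda>p. inv p) -` cdom d"]) auto
  obtain c where "c = chart_at A p" by blast
  then have c: "c \<in> A" "p \<in> cdom c" using chart_at_props by auto
  have "smooth_on (coord c ` (cdom c \<inter> (\<lambda>p. inv p) -` cdom d)) (coord d \<circ> (\<lambda>p. inv p) \<circ> param c)"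
    using lie c(1) d(1) by (simp add: lie_group_def smooth_map_def)
  then show "smooth_at A (\<lambda>q. coord d (inv q)) p"
    by (intro smooth_atI[OF c open_coord_image[OF c(1) o]]) (use c d in \<open>auto simp: comp_def\<close>)
qed

lemma smooth_map_at_mult:
  assumes k: "smooth_map_at A k r" and l: "smooth_map_at A l r"
  shows "smooth_map_at A (\<lambda>q. k q \<otimes> l q) r"
  unfolding smooth_map_at_def
proof (intro ballI impI conjI)
  fix c assume c: "c \<in> A" "k r \<otimes> l r \<in> cdom c"
  show "smooth_at A (\<lambda>q. coord c (k q \<otimes> l q)) r"
    by (rule smooth_at2_comp(1)[OF smooth_at2_mult[OF smooth_at_coord[OF c]] k l])
  have "open ((\<lambda>z. fst z \<otimes> snd z) -` cdom c)" "(k r, l r) \<in> (\<lambda>z. fst z \<otimes> snd z) -` cdom c"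
    using open_vimage[OF open_cdom[OF c(1)] continuous_mult] c(2) by auto
  then obtain M N where MN: "open M" "open N" "(k r, l r) \<in> M \<times> N"
    "M \<times> N \<subseteq> (\<lambda>z. fst z \<otimes> snd z) -` cdom c"
    by (rule open_prod_elim)
  have "k r \<in> M" "l r \<in> N" using MN(3) by auto
  from smooth_map_at_nbhd[OF k MN(1) this(1)] smooth_map_at_nbhd[OF l MN(2) this(2)]
  obtain U V where U: "open U" "r \<in> U" "k ` U \<subseteq> M" and V: "open V" "r \<in> V" "l ` V \<subseteq> N" by metis
  have "(k q \<otimes> l q) \<in> cdom c" if "q \<in> U \<inter> V" for q
  proof -
    have "(k q, l q) \<in> M \<times> N" using that U V by auto
    then show ?thesis using MN(4) by auto
  qed
  then show "\<exists>U. open U \<and> r \<in> U \<and> (\<lambda>q. k q \<otimes> l q) ` U \<subseteq> cdom c"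
    using U V by (intro exI[of _ "U \<inter> V"]) auto
qed

lemma smooth_map_at_left: "smooth_map_at A (\<lambda>q. p \<otimes> q) q0"
  by (rule smooth_map_at_mult[OF smooth_map_at_const smooth_map_at_id])

lemma smooth_at_left:
  assumes "smooth_at A f (p \<otimes> r)" shows "smooth_at A (\<lambda>q. f (p \<otimes> q)) r"
  by (rule smooth_at_comp_map(1)[OF smooth_map_at_left assms])

lemma smooth_at_left_one:
  assumes "smooth_at A f p" shows "smooth_at A (\<lambda>q. f (p \<otimes> q)) \<one>"
  by (rule smooth_at_left) (simp add: assms)

lemma smooth_at_x1: "smooth_at A x1 \<one>"
  by (rule smooth_at_coord[OF chart_at_props])

lemma dfun_left_field: "smooth_at A f p \<Longrightarrow> dfun A f p (lf u p) = lder u f p"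
  using smooth_at_comp_map(2)[OF smooth_map_at_left, of f p \<one> u]
  by (simp add: lder_def left_field_def)

text \<open>\<open>lder u f\<close> is the partial derivative of \<open>f (p \<otimes> q)\<close> in
  the second variable, at the fixed point \<open>\<one>\<close> and along the fixed vector
  \<open>u\<close>.\<close>

lemma smooth_at_lder:
  assumes "smooth_at A f p" shows "smooth_at A (lder u f) p"
proof -
  have "smooth_at2 A (\<lambda>p q. f (p \<otimes> q)) p \<one>" by (rule smooth_at2_mult) (simp add: assms)
  from smooth_at_partial[where k="\<lambda>q. \<one>" and X="\<lambda>q. u", OF this smooth_map_at_const smooth_at_const]
  show ?thesis by (simp add: lder_def[abs_def])
qed

lemma lder_left: "lder u f (a \<otimes> p) = lder u (\<lambda>q. f (a \<otimes> q)) p"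
  by (simp add: lder_def m_assoc)

lemma lder_linear: "smooth_at A f p \<Longrightarrow> linear (\<lambda>u. lder u f p)"
  unfolding lder_def by (rule dfun_linear[OF smooth_at_left_one])

lemma lder_cong:
  assumes "open U" "p \<in> U" "\<And>q. q \<in> U \<Longrightarrow> f q = g q"
  shows "lder u f p = lder u g p"
proof -
  have "p \<otimes> \<one> \<in> U" using assms(2) by simp
  from smooth_map_at_nbhd[OF smooth_map_at_left assms(1) this]
  obtain V where V: "open V" "\<one> \<in> V" "(\<lambda>q. p \<otimes> q) ` V \<subseteq> U" by blast
  show ?thesis unfolding lder_def by (rule dfun_cong[OF V(1,2)]) (use V(3) assms(3) in auto)
qed

lemma lder_const: "lder u (\<lambda>q. k) p = 0"
  by (simp add: lder_def dfun_const)

lemma lder_add: "smooth_at A f p \<Longrightarrow> smooth_at A g p \<Longrightarrow>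
    lder u (\<lambda>q. f q + g q) p = lder u f p + lder u g p"
  unfolding lder_def by (rule dfun_add[OF smooth_at_left_one smooth_at_left_one])

lemma lder_diff:
  fixes f :: "'a \<Rightarrow> 'v::real_normed_vector"
  shows "smooth_at A f p \<Longrightarrow> smooth_at A g p \<Longrightarrow>
    lder u (\<lambda>q. f q - g q) p = lder u f p - lder u g p"
  unfolding lder_def by (rule dfun_diff[OF smooth_at_left_one smooth_at_left_one])

lemma lder_bilinear: "bounded_bilinear m \<Longrightarrow> smooth_at A f p \<Longrightarrow> smooth_at A g p \<Longrightarrow>
    lder u (\<lambda>q. m (f q) (g q)) p = m (f p) (lder u g p) + m (lder u f p) (g p)"
  unfolding lder_def using dfun_bilinear[OF _ smooth_at_left_one smooth_at_left_one] by fastforce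

lemma lder_sum:
  fixes f :: "'i \<Rightarrow> 'a \<Rightarrow> 'v::real_normed_vector"
  shows "finite I \<Longrightarrow> (\<And>i. i \<in> I \<Longrightarrow> smooth_at A (f i) p) \<Longrightarrow>
    lder u (\<lambda>q. \<Sum>i\<in>I. f i q) p = (\<Sum>i\<in>I. lder u (f i) p)"
  unfolding lder_def by (rule dfun_sum) (auto intro: smooth_at_left_one)

lemma lder_compose:
  assumes "smooth_at A f p" "(h has_derivative D) (at (f p))"
  shows "lder u (\<lambda>q. h (f q)) p = D (lder u f p)"
  unfolding lder_def using dfun_compose[OF smooth_at_left_one[OF assms(1)], of h D] assms(2) by simp

lemma lder_one: "lder u f \<one> = dfun A f \<one> u"
  by (simp add: lder_def)

lemma lder_x1: "lder u x1 \<one> = u"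
  by (simp add: lder_one dfun_chart_at)

lemma lie_bracket_eq: "lb u v = lder u (lder v x1) \<one> - lder v (lder u x1) \<one>"
proof -
  have "vf_apply A (lf u) (vf_apply A (lf v) x1) \<one> = lder u (lder v x1) \<one>" for u v
  proof -
    have "dfun A (vf_apply A (lf v) x1) \<one> (lf u \<one>) = dfun A (lder v x1) \<one> (lf u \<one>)"
      by (rule dfun_cong[OF open_cdom[OF chart_at_props(1)] chart_at_props(2)])
        (simp add: vf_apply_def dfun_left_field smooth_at_coord[OF chart_at_props(1)])
    then show ?thesis
      by (simp add: vf_apply_def dfun_left_field smooth_at_lder smooth_at_x1)
  qed
  then show ?thesis by (simp add: lie_bracket_def vf_bracket_def Let_def)
qed

text \<open>In coordinates the second derivatives of \<open>f\<close> cancel because they are symmetric.\<close>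

lemma lder_commutator_one:
  fixes f :: "'a \<Rightarrow> 'w::euclidean_space"
  assumes f: "smooth_at A f \<one>"
  shows "lder u (lder v f) \<one> - lder v (lder u f) \<one> = lder (lb u v) f \<one>"
proof -
  let ?c = "chart_at A \<one>" and ?x = "x1 \<one>"
  obtain S where S: "open S" "?x \<in> S" "S \<subseteq> x1 ` cdom ?c" "smooth_on S (f \<circ> param ?c)"
    using smooth_atD[OF f chart_at_props] by blast
  let ?F = "f \<circ> param ?c"
  let ?D = "\<lambda>b x. frechet_derivative ?F (at x) b"
  let ?U = "cdom ?c \<inter> x1 -` S"
  have U: "open ?U" "\<one> \<in> ?U" using open_coord_vimage[OF chart_at_props(1) S(1)] S chart_at_props by auto
  have l: "linear (\<lambda>b. ?D b x)" if "x \<in> S" for x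
    using smooth_on_has_derivative[OF S(4) that] has_derivative_linear by (metis (no_types, lifting) ext)
  have fS: "smooth_at A f q" if "q \<in> ?U" for q
  proof (rule smooth_atI[OF chart_at_props(1) _ S(1) _ S(4)])
  qed (use that in auto)
  have eq: "lder v f q = (\<Sum>b\<in>Basis. (lder v x1 q \<bullet> b) *\<^sub>R ?D b (x1 q))" if q: "q \<in> ?U" for v q
  proof -
    have "lder v f q = ?D (dfun A x1 q (lf v q)) (x1 q)"
      using dfun_chart[OF fS[OF q] chart_at_props(1), of \<one> "lf v q"] q by (simp add: dfun_left_field fS)
    then show ?thesis
      using q by (simp add: linear_sum_Basis[OF l] dfun_left_field smooth_at_coord[OF chart_at_props(1)])
  qed
  have sD: "smooth_at A (\<lambda>q. ?D b (x1 q)) \<one>" for b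
    by (rule smooth_at_compose[OF smooth_at_x1 S(1,2) smooth_on_directional[OF S(4)]])
  have sV: "smooth_at A (\<lambda>q. lder v x1 q \<bullet> b) \<one>" for v b
    by (rule smooth_at_inner[OF smooth_at_lder[OF smooth_at_x1] smooth_at_const])
  have D2: "lder u (\<lambda>q. ?D b (x1 q)) \<one> = frechet_derivative (?D b) (at ?x) u" for u b
    using lder_compose[OF smooth_at_x1 smooth_on_has_derivative[OF smooth_on_directional[OF S(4)] S(2)]]
    by (simp add: lder_x1)
  have main: "lder u (lder v f) \<one> = frechet_derivative (?D u) (at ?x) v + ?D (lder u (lder v x1) \<one>) ?x" for u v
  proof -
    have "lder u (lder v f) \<one> = lder u (\<lambda>q. \<Sum>b\<in>Basis. (lder v x1 q \<bullet> b) *\<^sub>R ?D b (x1 q)) \<one>"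
      by (rule lder_cong[OF U]) (rule eq)
    also have "\<dots> = (\<Sum>b\<in>Basis. lder u (\<lambda>q. (lder v x1 q \<bullet> b) *\<^sub>R ?D b (x1 q)) \<one>)"
      by (rule lder_sum[OF finite_Basis]) (rule smooth_at_scaleR[OF sV sD])
    also have "\<dots> = (\<Sum>b\<in>Basis. (v \<bullet> b) *\<^sub>R frechet_derivative (?D u) (at ?x) b
        + (lder u (lder v x1) \<one> \<bullet> b) *\<^sub>R ?D b ?x)"
    proof (rule sum.cong[OF refl])
      fix b :: 'e assume "b \<in> Basis"
      have "lder u (\<lambda>q. lder v x1 q \<bullet> b) \<one> = lder u (lder v x1) \<one> \<bullet> b"
        using lder_bilinear[OF bounded_bilinear_inner smooth_at_lder[OF smooth_at_x1] smooth_at_const, of u v b]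
        by (simp add: lder_const)
      moreover have "frechet_derivative (?D b) (at ?x) u = frechet_derivative (?D u) (at ?x) b"
        by (rule symmetric_second_derivative[OF S(1,4,2)])
      ultimately show "lder u (\<lambda>q. (lder v x1 q \<bullet> b) *\<^sub>R ?D b (x1 q)) \<one> =
          (v \<bullet> b) *\<^sub>R frechet_derivative (?D u) (at ?x) b + (lder u (lder v x1) \<one> \<bullet> b) *\<^sub>R ?D b ?x"
        using lder_bilinear[OF bounded_bilinear_scaleR sV sD, of u v b b] by (simp add: D2 lder_x1)
    qed
    also have "\<dots> = frechet_derivative (?D u) (at ?x) v + ?D (lder u (lder v x1) \<one>) ?x"
      using linear_sum_Basis[OF l[OF S(2)]]
        linear_sum_Basis[OF has_derivative_linear[OF smooth_on_has_derivative[OF smooth_on_directional[OF S(4)] S(2)]]]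
      by (simp add: sum.distrib)
    finally show ?thesis .
  qed
  have "frechet_derivative (?D u) (at ?x) v = frechet_derivative (?D v) (at ?x) u"
    by (rule symmetric_second_derivative[OF S(1,4,2)])
  then have "lder u (lder v f) \<one> - lder v (lder u f) \<one> = ?D (lb u v) ?x"
    unfolding main lie_bracket_eq using linear_diff[OF l[OF S(2)]] by simp
  also have "\<dots> = lder (lb u v) f \<one>" by (simp add: lder_one dfun_def)
  finally show ?thesis .
qed

text \<open>By \<open>lder_left\<close> these operators commute with left translations, which
  reduces the claim to the identity element.\<close>

lemma lder_commutator:
  fixes f :: "'a \<Rightarrow> 'w::euclidean_space"
  assumes f: "smooth_at A f p"
  shows "lder u (lder v f) p - lder v (lder u f) p = lder (lb u v) f p"
proof -
  have "lder v f (p \<otimes> q) = lder v (\<lambda>q. f (p \<otimes> q)) q" for v q by (rule lder_left)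
  then have "lder u (lder v f) (p \<otimes> \<one>) = lder u (lder v (\<lambda>q. f (p \<otimes> q))) \<one>" for u v
    unfolding lder_left[of u "lder v f"] by presburger
  then show ?thesis
    using lder_commutator_one[OF smooth_at_left_one[OF f], of u v] lder_left[of "lb u v" f p \<one>] by simp
qed

lemma lb_add_left: "lb (u + v) w = lb u w + lb v w"
  and lb_scale_left: "lb (r *\<^sub>R u) w = r *\<^sub>R lb u w"
  and lb_antisym: "lb u v = - lb v u"
proof -
  have 1: "lder (u + v) f \<one> = lder u f \<one> + lder v f \<one>" "lder (r *\<^sub>R u) f \<one> = r *\<^sub>R lder u f \<one>"
    if "smooth_at A f \<one>" for f :: "'a \<Rightarrow> 'e"
    using linear_add[OF lder_linear[OF that]] linear_scale[OF lder_linear[OF that]] by auto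
  let ?U = "cdom (chart_at A \<one>)"
  have U: "open ?U" "\<one> \<in> ?U" "\<And>q. q \<in> ?U \<Longrightarrow> smooth_at A x1 q"
    using open_cdom chart_at_props smooth_at_coord by auto
  have s: "smooth_at A (lder u x1) \<one>" for u by (rule smooth_at_lder[OF smooth_at_x1])
  have "lder w (lder (u + v) x1) \<one> = lder w (\<lambda>q. lder u x1 q + lder v x1 q) \<one>"
    by (rule lder_cong[OF U(1,2)]) (rule linear_add[OF lder_linear[OF U(3)]])
  also have "\<dots> = lder w (lder u x1) \<one> + lder w (lder v x1) \<one>"
    by (rule lder_add[OF s s])
  finally have 2: "lder w (lder (u + v) x1) \<one> = lder w (lder u x1) \<one> + lder w (lder v x1) \<one>" .
  have "lder w (lder (r *\<^sub>R u) x1) \<one> = lder w (\<lambda>q. r *\<^sub>R lder u x1 q) \<one>"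
    by (rule lder_cong[OF U(1,2)]) (rule linear_scale[OF lder_linear[OF U(3)]])
  also have "\<dots> = r *\<^sub>R lder w (lder u x1) \<one>"
    using lder_bilinear[OF bounded_bilinear_scaleR smooth_at_const s, of w r u] by (simp add: lder_const)
  finally have 3: "lder w (lder (r *\<^sub>R u) x1) \<one> = r *\<^sub>R lder w (lder u x1) \<one>" .
  show "lb (u + v) w = lb u w + lb v w" using 1(1)[OF s] 2 by (simp add: lie_bracket_eq)
  show "lb (r *\<^sub>R u) w = r *\<^sub>R lb u w" using 1(2)[OF s] 3 by (simp add: lie_bracket_eq scaleR_diff_right)
  show "lb u v = - lb v u" by (simp add: lie_bracket_eq)
qed

text \<open>Jacobi holds for commutators of operators: each double bracket expands into four third
  derivatives of \<open>x1\<close>, and the twelve terms of the cyclic sum cancel in pairs.\<close>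

lemma lb_jacobi: "lb u (lb v w) + lb v (lb w u) + lb w (lb u v) = 0"
proof -
  let ?U = "cdom (chart_at A \<one>)"
  have U: "open ?U" "\<one> \<in> ?U" "\<And>q. q \<in> ?U \<Longrightarrow> smooth_at A x1 q"
    using open_cdom chart_at_props smooth_at_coord by auto
  have s1: "smooth_at A (lder u x1) \<one>" for u by (rule smooth_at_lder[OF smooth_at_x1])
  have s2: "smooth_at A (lder v (lder u x1)) \<one>" for u v by (rule smooth_at_lder[OF s1])
  have *: "lb u (lb v w) = lder u (lder v (lder w x1)) \<one> - lder u (lder w (lder v x1)) \<one>
     - (lder v (lder w (lder u x1)) \<one> - lder w (lder v (lder u x1)) \<one>)" for u v w
  proof -
    have "lder u (lder (lb v w) x1) \<one> = lder u (\<lambda>q. lder v (lder w x1) q - lder w (lder v x1) q) \<one>"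
      by (rule lder_cong[OF U(1,2)]) (rule lder_commutator[OF U(3), symmetric])
    also have "\<dots> = lder u (lder v (lder w x1)) \<one> - lder u (lder w (lder v x1)) \<one>"
      by (rule lder_diff[OF s2 s2])
    finally have 1: "lder u (lder (lb v w) x1) \<one> = lder u (lder v (lder w x1)) \<one> - lder u (lder w (lder v x1)) \<one>" .
    have 2: "lder (lb v w) (lder u x1) \<one> = lder v (lder w (lder u x1)) \<one> - lder w (lder v (lder u x1)) \<one>"
      by (rule lder_commutator[OF s1, symmetric])
    show ?thesis using 1 2 by (simp add: lie_bracket_eq[of u])
  qed
  show ?thesis by (simp add: *)
qed

text \<open>The left Maurer-Cartan form: the differential at \<open>p\<close> of left translation by
  the inverse of \<open>p\<close>, carrying the tangent space at \<open>p\<close> to the Lie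
  algebra.\<close>

definition mc :: "'a \<Rightarrow> 'e \<Rightarrow> 'e" where
  "mc p v = dfun A (\<lambda>q. x1 (inv p \<otimes> q)) p v"

lemma smooth_at_mc_fun: "smooth_at A (\<lambda>q. x1 (inv p \<otimes> q)) p"
  by (rule smooth_at_left) (simp add: smooth_at_x1)

lemma mc_linear: "linear (mc p)"
  unfolding mc_def[abs_def] by (rule dfun_linear[OF smooth_at_mc_fun])

lemma mc_lf [simp]: "mc p (lf u p) = u"
  unfolding mc_def dfun_left_field[OF smooth_at_mc_fun] by (simp add: lder_def dfun_chart_at)

lemma lf_linear: "linear (\<lambda>u. lf u p)"
proof -
  have "smooth_at A (coord (chart_at A (p \<otimes> \<one>)) \<circ> (\<lambda>q. p \<otimes> q)) \<one>"
    unfolding comp_def by (rule smooth_at_left[OF smooth_at_coord[OF chart_at_props]])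
  from dfun_linear[OF this] show ?thesis by (simp add: left_field_def dmap_def)
qed

text \<open>\<open>mc p\<close> is so far only a left inverse of \<open>u \<mapsto> lf u p\<close>;
  both spaces have the same finite dimension, so it is a two-sided inverse.\<close>

lemma lf_mc [simp]: "lf (mc p v) p = v"
proof -
  have "inj (\<lambda>u. lf u p)" by (rule inj_on_inverseI[of _ "mc p"]) simp
  then have "surj (\<lambda>u. lf u p)" using linear_injective_imp_surjective[OF lf_linear] by blast
  then obtain u where "v = lf u p" by blast
  then show ?thesis by simp
qed

lemma smooth_at_mc:
  assumes "\<And>d. d \<in> A \<Longrightarrow> p \<in> cdom d \<Longrightarrow> smooth_at A (\<lambda>q. dfun A (coord d) q (X q)) p"
  shows "smooth_at A (\<lambda>q. mc q (X q)) p"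
proof -
  have "smooth_at2 A (\<lambda>p q. x1 (p \<otimes> q)) (inv p) p"
    by (rule smooth_at2_mult) (simp add: smooth_at_x1)
  from smooth_at2_comp_fst[OF this smooth_map_at_inv]
  have "smooth_at2 A (\<lambda>p q. x1 (inv p \<otimes> q)) p p" .
  from smooth_at_partial[where k="\<lambda>q. q", OF this smooth_map_at_id assms]
  show ?thesis by (simp add: mc_def)
qed

lemma lder_expand: "smooth_at A f p \<Longrightarrow> lder w f p = (\<Sum>b\<in>Basis. (w \<bullet> b) *\<^sub>R lder b f p)"
  using linear_sum_Basis[OF lder_linear] by metis

lemma smooth_at_lder_field:
  fixes f :: "'a \<Rightarrow> 'w::real_normed_vector"
  assumes f: "smooth_at A f p" and y: "smooth_at A y p"
  shows "smooth_at A (\<lambda>q. lder (y q) f q) p"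
proof -
  obtain U where U: "open U" "p \<in> U" "\<And>q. q \<in> U \<Longrightarrow> smooth_at A f q" using smooth_at_open[OF f] by metis
  have "smooth_at A (\<lambda>q. \<Sum>b\<in>Basis. (y q \<bullet> b) *\<^sub>R lder b f q) p"
    by (intro smooth_at_sum smooth_at_scaleR smooth_at_inner y smooth_at_const smooth_at_lder f)
  then show ?thesis by (rule smooth_at_cong[OF U(1,2), rotated]) (rule lder_expand[OF U(3), symmetric])
qed

lemma lder_lder_field:
  fixes f :: "'a \<Rightarrow> 'w::real_normed_vector"
  assumes f: "smooth_at A f p" and y: "smooth_at A y p"
  shows "lder u (\<lambda>q. lder (y q) f q) p = lder (lder u y p) f p + lder u (lder (y p) f) p"
proof -
  obtain U where U: "open U" "p \<in> U" "\<And>q. q \<in> U \<Longrightarrow> smooth_at A f q" using smooth_at_open[OF f] by metis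
  have sc: "smooth_at A (\<lambda>q. w q \<bullet> b) p" if "smooth_at A w p" for w and b :: 'e
    by (rule smooth_at_inner[OF that smooth_at_const])
  have *: "lder u (\<lambda>q. lder (w q) f q) p =
      (\<Sum>b\<in>Basis. (w p \<bullet> b) *\<^sub>R lder u (lder b f) p) + lder (lder u w p) f p" if w: "smooth_at A w p" for w
  proof -
    have "lder u (\<lambda>q. lder (w q) f q) p = lder u (\<lambda>q. \<Sum>b\<in>Basis. (w q \<bullet> b) *\<^sub>R lder b f q) p"
      by (rule lder_cong[OF U(1,2)]) (rule lder_expand[OF U(3)])
    also have "\<dots> = (\<Sum>b\<in>Basis. lder u (\<lambda>q. (w q \<bullet> b) *\<^sub>R lder b f q) p)"
      by (rule lder_sum[OF finite_Basis]) (rule smooth_at_scaleR[OF sc[OF w] smooth_at_lder[OF f]])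
    also have "\<dots> = (\<Sum>b\<in>Basis. (w p \<bullet> b) *\<^sub>R lder u (lder b f) p + (lder u w p \<bullet> b) *\<^sub>R lder b f p)"
    proof (rule sum.cong[OF refl])
      fix b :: 'e
      have "lder u (\<lambda>q. w q \<bullet> b) p = lder u w p \<bullet> b"
        using lder_bilinear[OF bounded_bilinear_inner w smooth_at_const, of u b] by (simp add: lder_const)
      then show "lder u (\<lambda>q. (w q \<bullet> b) *\<^sub>R lder b f q) p =
          (w p \<bullet> b) *\<^sub>R lder u (lder b f) p + (lder u w p \<bullet> b) *\<^sub>R lder b f p"
        using lder_bilinear[OF bounded_bilinear_scaleR sc[OF w] smooth_at_lder[OF f], of u b b] by simp
    qed
    finally show ?thesis by (simp add: sum.distrib lder_expand[OF f, of "lder u w p"])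
  qed
  \<comment> \<open>\<open>*\<close> is used for \<open>y\<close> and for the constant field
    \<open>y p\<close>. The second use has no derivative of the coefficient and identifies the sum
    over \<open>Basis\<close>.\<close>
  show ?thesis using *[OF y] *[of "\<lambda>q. y p"] lder_linear[OF f, THEN linear_0]
    by (simp add: smooth_at_const lder_const)
qed

text \<open>The tangent bundle is trivialised by \<open>mc\<close>: a field is smooth exactly when
  its Lie algebra valued function is. From here on charts are rarely needed.\<close>

lemma vector_fields_mc: "X \<in> vector_fields A \<longleftrightarrow> (\<forall>p. smooth_at A (\<lambda>q. mc q (X q)) p)"
proof
  assume X: "X \<in> vector_fields A"
  show "\<forall>p. smooth_at A (\<lambda>q. mc q (X q)) p"
    using X by (auto simp: vector_fields_iff intro!: smooth_at_mc)
next
  assume *: "\<forall>p. smooth_at A (\<lambda>q. mc q (X q)) p"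
  have "smooth_at A (\<lambda>q. dfun A (coord c) q (X q)) p" if c: "c \<in> A" "p \<in> cdom c" for c p
  proof (rule smooth_at_cong[OF open_cdom[OF c(1)] c(2)])
    show "smooth_at A (\<lambda>q. lder (mc q (X q)) (coord c) q) p"
      by (rule smooth_at_lder_field[OF smooth_at_coord[OF c]]) (use * in blast)
    fix q assume "q \<in> cdom c"
    then show "lder (mc q (X q)) (coord c) q = dfun A (coord c) q (X q)"
      using dfun_left_field[OF smooth_at_coord[OF c(1)], of q "mc q (X q)"] by simp
  qed
  then show "X \<in> vector_fields A" by (auto simp: vector_fields_iff)
qed

lemma vf_apply_lder: "smooth_at A f p \<Longrightarrow> vf_apply A X f p = lder (mc p (X p)) f p"
  using dfun_left_field[of f p "mc p (X p)"] by (simp add: vf_apply_def)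

lemma field_commutator:
  fixes f :: "'a \<Rightarrow> 'w::euclidean_space"
  assumes f: "smooth_at A f p" and x: "smooth_at A x p" and y: "smooth_at A y p"
  shows "lder (x p) (\<lambda>q. lder (y q) f q) p - lder (y p) (\<lambda>q. lder (x q) f q) p =
    lder (lder (x p) y p - lder (y p) x p + lb (x p) (y p)) f p"
  unfolding lder_lder_field[OF f y] lder_lder_field[OF f x]
  using lder_commutator[OF f, of "x p" "y p"]
  by (simp add: linear_add[OF lder_linear[OF f]] linear_diff[OF lder_linear[OF f]])

lemma vf_apply_commutator:
  fixes f :: "'a \<Rightarrow> 'w::euclidean_space"
  assumes f: "smooth_at A f p" and X: "X \<in> vector_fields A" and Y: "Y \<in> vector_fields A"
  shows "vf_apply A X (vf_apply A Y f) p - vf_apply A Y (vf_apply A X f) p =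
    lder (lder (mc p (X p)) (\<lambda>q. mc q (Y q)) p - lder (mc p (Y p)) (\<lambda>q. mc q (X q)) p
      + lb (mc p (X p)) (mc p (Y p))) f p"
proof -
  obtain U where U: "open U" "p \<in> U" "\<And>q. q \<in> U \<Longrightarrow> smooth_at A f q" using smooth_at_open[OF f] by metis
  have s: "smooth_at A (\<lambda>q. mc q (X q)) p" "smooth_at A (\<lambda>q. mc q (Y q)) p"
    using X Y by (auto simp: vector_fields_mc)
  have "vf_apply A X (vf_apply A Y f) p = lder (mc p (X p)) (\<lambda>q. lder (mc q (Y q)) f q) p"
    if "smooth_at A (\<lambda>q. mc q (Y q)) p" for X Y
  proof -
    have "vf_apply A X (vf_apply A Y f) p = vf_apply A X (\<lambda>q. lder (mc q (Y q)) f q) p"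
      unfolding vf_apply_def[of A X]
      by (rule dfun_cong[OF U(1,2)]) (rule vf_apply_lder[OF U(3)])
    then show ?thesis using vf_apply_lder[OF smooth_at_lder_field[OF f that]] by simp
  qed
  then show ?thesis using field_commutator[OF f s] s by simp
qed

text \<open>In the trivialisation two derivative terms of the coefficient functions join the
  algebraic bracket; the latter alone remains for left-invariant fields.\<close>

lemma vf_bracket_mc:
  assumes X: "X \<in> vector_fields A" and Y: "Y \<in> vector_fields A"
  shows "vf_bracket A X Y p = lf (lder (mc p (X p)) (\<lambda>q. mc q (Y q)) p - lder (mc p (Y p)) (\<lambda>q. mc q (X q)) p
      + lb (mc p (X p)) (mc p (Y p))) p" (is "_ = lf ?w p")
proof -
  let ?x = "coord (chart_at A p)"
  have s: "smooth_at A ?x p" by (rule smooth_at_coord[OF chart_at_props])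
  have "vf_bracket A X Y p = lder ?w ?x p"
    using vf_apply_commutator[OF s X Y] by (simp add: vf_bracket_def)
  also have "\<dots> = lf ?w p" using dfun_left_field[OF s, of ?w] by (simp add: dfun_chart_at)
  finally show ?thesis .
qed

end


section \<open>Inner products and curvature of a Lie algebra\<close>

text \<open>\<open>tr\<close> is defined by the standard basis, whereas metrics and flags bring
  bases of their own.\<close>

lemma tr_basis:
  fixes T :: "'e::euclidean_space \<Rightarrow> 'e"
  assumes T: "linear T" and F: "finite F" "independent F" "span F = UNIV"
  shows "tr T = (\<Sum>f\<in>F. representation F (T f) f)"
proof -
  let ?r = "representation F"
  have exp: "(\<Sum>f\<in>F. ?r x f *\<^sub>R f) = x" for x
    using sum_representation_eq[OF F(2), of x F] F by simp
  have "T b \<bullet> b = (\<Sum>f\<in>F. ?r b f * (T f \<bullet> b))" for b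
  proof -
    have "T b = (\<Sum>f\<in>F. ?r b f *\<^sub>R T f)"
      using arg_cong[OF exp[of b], of T] by (simp add: linear_sum[OF T] linear_scale[OF T])
    then show ?thesis by (simp add: inner_sum_left)
  qed
  then have "tr T = (\<Sum>b\<in>Basis. \<Sum>f\<in>F. ?r b f * (T f \<bullet> b))" by (simp add: tr_def)
  also have "\<dots> = (\<Sum>f\<in>F. \<Sum>b\<in>Basis. ?r b f * (T f \<bullet> b))" by (rule sum.swap)
  also have "\<dots> = (\<Sum>f\<in>F. ?r (T f) f)"
  proof (rule sum.cong[OF refl])
    fix f assume "f \<in> F"
    have "?r (\<Sum>b\<in>Basis. (T f \<bullet> b) *\<^sub>R b) f = (\<Sum>b\<in>Basis. (T f \<bullet> b) * ?r b f)"
      using representation_sum[OF F(2), of Basis "\<lambda>b. (T f \<bullet> b) *\<^sub>R b"] F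
      by (simp add: representation_scale[OF F(2)])
    then have "?r (T f) f = (\<Sum>b\<in>Basis. (T f \<bullet> b) * ?r b f)" by (simp add: euclidean_representation)
    then show "(\<Sum>b\<in>Basis. ?r b f * (T f \<bullet> b)) = ?r (T f) f" by (simp add: mult.commute)
  qed
  finally show ?thesis .
qed

section \<open>Orthonormal systems of an arbitrary inner product\<close>

definition ortho :: "('e::real_vector \<Rightarrow> 'e \<Rightarrow> real) \<Rightarrow> 'e set \<Rightarrow> bool" where
  "ortho h B \<longleftrightarrow> (\<forall>u\<in>B. \<forall>v\<in>B. h u v = (if u = v then 1 else 0))"

text \<open>An indexed family rather than a set: later the vectors are rescaled by a parameter
  tending to 0 while the index set stays the same.\<close>

definition frame :: "('e::real_vector \<Rightarrow> 'e \<Rightarrow> real) \<Rightarrow> 'i set \<Rightarrow> ('i \<Rightarrow> 'e) \<Rightarrow> bool" where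
  "frame h I e \<longleftrightarrow> finite I \<and> (\<forall>i\<in>I. \<forall>j\<in>I. h (e i) (e j) = (if i = j then 1 else 0)) \<and> span (e ` I) = UNIV"

locale inner_form =
  fixes h :: "'e::euclidean_space \<Rightarrow> 'e \<Rightarrow> real"
  assumes bil: "bilinear h" and sym: "h u v = h v u" and pos: "u \<noteq> 0 \<Longrightarrow> h u u > 0"
begin

lemma linear_left: "linear (\<lambda>u. h u v)" and linear_right: "linear (\<lambda>v. h u v)"
  using bil by (auto simp: bilinear_def)

lemmas h_simps = linear_add[OF linear_left] linear_add[OF linear_right]
  linear_diff[OF linear_left] linear_diff[OF linear_right]
  linear_scale[OF linear_left] linear_scale[OF linear_right]
  linear_neg[OF linear_left] linear_neg[OF linear_right]
  linear_0[OF linear_left] linear_0[OF linear_right]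
  linear_sum[OF linear_left] linear_sum[OF linear_right]

lemma h_nonneg: "h u u \<ge> 0"
  using pos[of u] by (cases "u = 0") (auto simp: h_simps)

lemma h_eq_0: "h u u = 0 \<longleftrightarrow> u = 0"
  using pos[of u] by (cases "u = 0") (auto simp: h_simps)

lemma h_ext: "(\<And>z. h u z = h v z) \<Longrightarrow> u = v"
  using h_eq_0[of "u - v"] by (simp add: h_simps)

lemma ortho_independent:
  assumes "ortho h B" shows "independent B"
proof (rule ccontr)
  assume "\<not> independent B"
  then obtain t r where t: "finite t" "t \<subseteq> B" "(\<Sum>v\<in>t. r v *\<^sub>R v) = 0" "\<exists>v\<in>t. r v \<noteq> 0"
    unfolding dependent_explicit by auto
  then obtain v where v: "v \<in> t" "r v \<noteq> 0" by blast
  have "h (\<Sum>w\<in>t. r w *\<^sub>R w) v = (\<Sum>w\<in>t. if w = v then r w else 0)"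
    using assms t(2) v(1) by (auto simp: h_simps ortho_def subset_eq intro!: sum.cong)
  then show False using t v by (simp add: h_simps)
qed

lemma ortho_finite: "ortho h B \<Longrightarrow> finite B" and ortho_card: "ortho h B \<Longrightarrow> card B \<le> DIM('e)"
  using ortho_independent independent_bound by blast+

text \<open>Gram-Schmidt, one vector at a time; the induction measure decreases because an
  orthonormal set has at most \<open>DIM('e)\<close> elements.\<close>

lemma ortho_extend:
  assumes "ortho h B" "subspace V" "B \<subseteq> V"
  shows "\<exists>C. B \<subseteq> C \<and> C \<subseteq> V \<and> ortho h C \<and> span C = V"
  using assms(1,3)
proof (induction "DIM('e) - card B" arbitrary: B rule: less_induct)
  case less
  have fB: "finite B" using ortho_finite less by blast
  have sB: "span B \<subseteq> V" using less.prems(2) assms(2) by (simp add: span_minimal)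
  show ?case
  proof (cases "span B = V")
    case True then show ?thesis using less by blast
  next
    case False
    then obtain v where v: "v \<in> V" "v \<notin> span B" using sB by blast
    define w where "w = v - (\<Sum>b\<in>B. h v b *\<^sub>R b)"
    have s: "(\<Sum>b\<in>B. h v b *\<^sub>R b) \<in> span B" by (intro span_sum span_scale span_base)
    have w: "w \<in> V" "w \<notin> span B"
      using v s sB assms(2) span_diff[of w B] span_add[OF s, of w] unfolding w_def by (auto intro: subspace_diff)
    have w0: "w \<noteq> 0" using w span_0 by metis
    have hw: "h w b = 0" if "b \<in> B" for b
    proof -
      have "(\<Sum>c\<in>B. h v c * h c b) = (\<Sum>c\<in>B. if c = b then h v c else 0)"
        using less.prems(1) that by (intro sum.cong) (auto simp: ortho_def)
      then show ?thesis using that fB by (simp add: w_def h_simps)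
    qed
    define e where "e = (1 / sqrt (h w w)) *\<^sub>R w"
    have hp: "h w w > 0" using pos w0 by blast
    have ee: "h e e = 1" using hp by (simp add: e_def h_simps)
    have e: "e \<in> V" "e \<notin> span B" using w assms(2) hp span_scale[of e B "sqrt (h w w)"]
      by (auto simp: e_def subspace_scale)
    have eB: "e \<notin> B" using e span_base by blast
    have o: "ortho h (insert e B)"
      using less.prems(1) ee hw sym eB by (auto simp: ortho_def e_def h_simps)
    then have "card (insert e B) \<le> DIM('e)" by (rule ortho_card)
    then have "DIM('e) - card (insert e B) < DIM('e) - card B" using fB eB by simp
    from less.hyps[OF this o] e less.prems show ?thesis by auto
  qed
qed

lemma ortho_expand:
  assumes "ortho h B" "x \<in> span B"
  shows "x = (\<Sum>b\<in>B. h x b *\<^sub>R b)"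
proof -
  define y where "y = x - (\<Sum>b\<in>B. h x b *\<^sub>R b)"
  have fB: "finite B" using ortho_finite assms by blast
  have y: "y \<in> span B" unfolding y_def by (intro span_diff span_sum span_scale assms(2)) (rule span_base)
  have hb: "h y b = 0" if "b \<in> B" for b
  proof -
    have "(\<Sum>c\<in>B. h x c * h c b) = (\<Sum>c\<in>B. if c = b then h x c else 0)"
      using assms(1) that by (intro sum.cong) (auto simp: ortho_def)
    then show ?thesis using that fB by (simp add: y_def h_simps)
  qed
  have "span B \<subseteq> {z. h y z = 0}"
    by (rule span_minimal) (auto simp: subspace_def h_simps hb)
  then have "h y y = 0" using y by blast
  then show ?thesis by (simp add: h_eq_0 y_def)
qed

lemma orthonormal_basis_ortho: "orthonormal_basis h B \<longleftrightarrow> ortho h B \<and> span B = UNIV"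
  by (auto simp: orthonormal_basis_def ortho_def)

lemma orthonormal_basis_exists: "\<exists>B. orthonormal_basis h B"
  using ortho_extend[of "{}" UNIV] by (auto simp: orthonormal_basis_ortho ortho_def)

lemma frame_id: "orthonormal_basis h B \<Longrightarrow> frame h B (\<lambda>x. x)"
  using ortho_finite by (auto simp: frame_def orthonormal_basis_ortho ortho_def)

lemma frame_inj: "frame h I e \<Longrightarrow> inj_on e I"
proof (rule inj_onI)
  fix u v assume "frame h I e" and *: "u \<in> I" "v \<in> I" "e u = e v"
  then have "h (e u) (e u) = (if u = u then 1 else 0)" "h (e u) (e v) = (if u = v then 1 else 0)"
    unfolding frame_def by blast+
  then show "u = v" using * by (metis zero_neq_one)
qed

lemma frame_ortho: "frame h I e \<Longrightarrow> ortho h (e ` I)"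
  using frame_inj[of I e] by (auto simp: frame_def ortho_def inj_on_eq_iff)

lemma frame_expand:
  assumes "frame h I e" shows "x = (\<Sum>i\<in>I. h x (e i) *\<^sub>R e i)"
  using ortho_expand[OF frame_ortho[OF assms], of x] frame_inj[OF assms] assms
  by (simp add: frame_def sum.reindex)

lemma frame_tr:
  assumes fr: "frame h I e" and T: "linear T" shows "tr T = (\<Sum>i\<in>I. h (T (e i)) (e i))"
proof -
  let ?B = "e ` I"
  have o: "ortho h ?B" and sp: "span ?B = UNIV" and fin: "finite ?B" and ind: "independent ?B"
    using frame_ortho[OF fr] fr ortho_independent by (auto simp: frame_def)
  have "representation ?B x b = h x b" if "b \<in> ?B" for x b
  proof -
    have "x = (\<Sum>c\<in>?B. representation ?B x c *\<^sub>R c)"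
      using sum_representation_eq[OF ind, of x ?B] fin sp by simp
    from arg_cong[OF this, of "\<lambda>y. h y b"]
    have "h x b = (\<Sum>c\<in>?B. representation ?B x c * h c b)"
      by (simp only: h_simps real_scaleR_def)
    also have "\<dots> = (\<Sum>c\<in>?B. if c = b then representation ?B x c else 0)"
      using o that by (intro sum.cong) (auto simp: ortho_def)
    finally show ?thesis using that fin by simp
  qed
  then have "tr T = (\<Sum>b\<in>?B. h (T b) b)" using tr_basis[OF T fin ind sp] by simp
  then show ?thesis using frame_inj[OF fr] by (simp add: sum.reindex)
qed

lemma riesz:
  assumes "linear \<phi>" shows "\<exists>w. \<forall>z. h w z = \<phi> z"
proof -
  obtain B where "orthonormal_basis h B" using orthonormal_basis_exists by blast
  then have fr: "frame h B (\<lambda>x. x)" by (rule frame_id)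
  have "h (\<Sum>b\<in>B. \<phi> b *\<^sub>R b) z = \<phi> z" for z
  proof -
    have "\<phi> (\<Sum>b\<in>B. h z b *\<^sub>R b) = (\<Sum>b\<in>B. h z b * \<phi> b)"
      by (simp add: linear_sum[OF assms] linear_scale[OF assms])
    then show ?thesis using frame_expand[OF fr, of z] by (simp add: h_simps sym mult.commute)
  qed
  then show ?thesis by blast
qed

end

section \<open>Lie algebras and the algebraic form of connection and curvature\<close>

locale lie_algebra =
  fixes br :: "'e::euclidean_space \<Rightarrow> 'e \<Rightarrow> 'e"
  assumes br_add_left: "br (u + v) w = br u w + br v w"
    and br_scale_left: "br (r *\<^sub>R u) w = r *\<^sub>R br u w"
    and br_antisym: "br u v = - br v u"
    and jacobi: "br u (br v w) + br v (br w u) + br w (br u v) = 0"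
begin

lemma br_linear_left: "linear (\<lambda>u. br u w)"
  by (auto intro!: linearI br_add_left br_scale_left)

lemma br_linear: "linear (br u)"
proof (rule linearI)
  fix v w r
  show "br u (v + w) = br u v + br u w" "br u (r *\<^sub>R v) = r *\<^sub>R br u v"
    using br_antisym[of u] br_add_left[of v w u] br_scale_left[of r v u] by (metis minus_add_distrib, metis scaleR_minus_right)
qed

lemmas br_simps = linear_add[OF br_linear_left] linear_add[OF br_linear]
  linear_diff[OF br_linear_left] linear_diff[OF br_linear]
  linear_scale[OF br_linear_left] linear_scale[OF br_linear]
  linear_neg[OF br_linear_left] linear_neg[OF br_linear]
  linear_0[OF br_linear_left] linear_0[OF br_linear]
  linear_sum[OF br_linear_left] linear_sum[OF br_linear]

lemma ad_bracket: "br (br u v) w = br u (br v w) - br v (br u w)"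
  using jacobi[of u v w] br_antisym[of w u] br_antisym[of w "br u v"]
  by (simp add: br_simps)

end

text \<open>Components with respect to an orthonormal frame; \<open>c i j k\<close> stands for \<open>\<langle>[e\<^sub>i, e\<^sub>j], e\<^sub>k\<rangle>\<close>.\<close>

definition Gam :: "('i \<Rightarrow> 'i \<Rightarrow> 'i \<Rightarrow> real) \<Rightarrow> 'i \<Rightarrow> 'i \<Rightarrow> 'i \<Rightarrow> real" where
  "Gam c i j k = (c i j k - c j k i + c k i j) / 2"

text \<open>\<open>Gam\<close> is the Koszul formula, so that \<open>Gam c i j k\<close> is the
  component of the covariant derivative of \<open>e\<^sub>j\<close> along \<open>e\<^sub>i\<close>
  in direction \<open>e\<^sub>k\<close>. The three products are then the three terms of the
  curvature tensor.\<close>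

definition Rm :: "'i set \<Rightarrow> ('i \<Rightarrow> 'i \<Rightarrow> 'i \<Rightarrow> real) \<Rightarrow> 'i \<Rightarrow> 'i \<Rightarrow> 'i \<Rightarrow> 'i \<Rightarrow> real" where
  "Rm I c i j k l =
     (\<Sum>m\<in>I. Gam c j k m * Gam c i m l - Gam c i k m * Gam c j m l - c i j m * Gam c m k l)"

definition Rc :: "'i set \<Rightarrow> ('i \<Rightarrow> 'i \<Rightarrow> 'i \<Rightarrow> real) \<Rightarrow> 'i \<Rightarrow> 'i \<Rightarrow> real" where
  "Rc I c j k = (\<Sum>i\<in>I. Rm I c i j k i)"

definition Sc :: "'i set \<Rightarrow> ('i \<Rightarrow> 'i \<Rightarrow> 'i \<Rightarrow> real) \<Rightarrow> real" where
  "Sc I c = (\<Sum>j\<in>I. Rc I c j j)"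

locale metric_lie_algebra = lie_algebra br + inner_form h
  for br :: "'e::euclidean_space \<Rightarrow> 'e \<Rightarrow> 'e" and h :: "'e \<Rightarrow> 'e \<Rightarrow> real"
begin

text \<open>The Koszul formula for left-invariant fields, whose inner products are constant so that
  the derivative terms vanish. \<open>SOME\<close> is justified by \<open>riesz\<close>.\<close>

definition nab :: "'e \<Rightarrow> 'e \<Rightarrow> 'e" where
  "nab u v = (SOME w. \<forall>z. h w z = (h (br u v) z - h (br v z) u + h (br z u) v) / 2)"

lemma h_nab: "h (nab u v) z = (h (br u v) z - h (br v z) u + h (br z u) v) / 2"
proof -
  have "linear (\<lambda>z. (h (br u v) z - h (br v z) u + h (br z u) v) / 2)"
    by (rule linearI) (simp_all add: h_simps br_simps field_simps)
  from someI_ex[OF riesz[OF this]] show ?thesis by (simp add: nab_def)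
qed

lemma nab_linear: "linear (nab u)" and nab_linear_left: "linear (\<lambda>u. nab u v)"
  by (auto intro!: linearI h_ext simp: h_nab h_simps br_simps field_simps)

lemmas nab_simps = linear_add[OF nab_linear_left] linear_add[OF nab_linear]
  linear_diff[OF nab_linear_left] linear_diff[OF nab_linear]
  linear_scale[OF nab_linear_left] linear_scale[OF nab_linear]
  linear_sum[OF nab_linear_left] linear_sum[OF nab_linear]
  linear_0[OF nab_linear_left] linear_0[OF nab_linear]

lemma nab_torsion: "nab u v - nab v u = br u v"
proof (rule h_ext)
  fix z
  have "br v u = - br u v" "br z u = - br u z" "br z v = - br v z" by (rule br_antisym)+
  then show "h (nab u v - nab v u) z = h (br u v) z" by (simp add: h_simps h_nab field_simps)
qed

lemma nab_metric: "h (nab u v) w + h v (nab u w) = 0"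
proof -
  have "br w v = - br v w" "br w u = - br u w" "br v u = - br u v" by (rule br_antisym)+
  then show ?thesis using h_nab[of u w v] by (simp add: h_simps h_nab sym[of v "nab u w"] field_simps)
qed

definition curv :: "'e \<Rightarrow> 'e \<Rightarrow> 'e \<Rightarrow> 'e" where
  "curv u v w = nab u (nab v w) - nab v (nab u w) - nab (br u v) w"

definition ricf :: "'e \<Rightarrow> 'e \<Rightarrow> real" where
  "ricf u v = tr (\<lambda>x. curv x u v)"

definition Rop :: "'e \<Rightarrow> 'e" where
  "Rop u = (SOME w. \<forall>v. h w v = ricf u v)"

lemma curv_skew: "curv u v w = - curv v u w"
  using br_antisym[of v u] by (simp add: curv_def linear_neg[OF nab_linear_left])

lemma curv_skew2: "h (curv u v w) z = - h (curv u v z) w"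
  using nab_metric[of u "nab v w" z] nab_metric[of v w "nab u z"]
    nab_metric[of v "nab u w" z] nab_metric[of u w "nab v z"] nab_metric[of "br u v" w z]
  by (simp add: curv_def h_simps sym[of w])

text \<open>Vanishing torsion turns the cyclic sum of second covariant derivatives into the Jacobi
  sum.\<close>

lemma bianchi: "curv x y z + curv y z x + curv z x y = 0"
proof -
  have t: "nab x (nab y z) - nab x (nab z y) = nab x (br y z)" for x y z
    using nab_torsion[of y z] by (simp add: nab_simps[symmetric])
  have s: "nab x (br y z) - nab (br y z) x = br x (br y z)" for x y z by (rule nab_torsion)
  have "curv x y z + curv y z x + curv z x y =
     (nab x (nab y z) - nab x (nab z y)) + (nab y (nab z x) - nab y (nab x z)) + (nab z (nab x y) - nab z (nab y x))
     - nab (br x y) z - nab (br y z) x - nab (br z x) y"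
    by (simp add: curv_def)
  also have "\<dots> = br x (br y z) + br y (br z x) + br z (br x y)"
    unfolding t s[symmetric] by simp
  finally show ?thesis using jacobi by simp
qed

text \<open>The classical octahedron argument: four Bianchi identities for the cyclic shifts of the
  arguments, combined through the two skew symmetries, are a linear system with this
  consequence.\<close>

lemma curv_pair_symmetric: "h (curv x y z) w = h (curv z w x) y"
proof -
  have b: "h (curv x y z) w + h (curv y z x) w + h (curv z x y) w = 0" for x y z w
    using arg_cong[OF bianchi[of x y z], of "\<lambda>v. h v w"] by (simp add: h_simps)
  have s1: "h (curv u v w) z = - h (curv v u w) z" for u v w z
    using curv_skew[of u v w] by (simp add: h_simps)
  show ?thesis
    using b[of x y z w] b[of y z w x] b[of z w x y] b[of w x y z]
      curv_skew2[of x y z w] curv_skew2[of y z x w] curv_skew2[of z x y w]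
      curv_skew2[of z w y x] curv_skew2[of w y z x] curv_skew2[of w x z y] curv_skew2[of x z w y]
      curv_skew2[of x y w z] curv_skew2[of y w x z] curv_skew2[of y z w x]
      s1[of z x y w] s1[of x z w y] s1[of w y z x] s1[of y w x z] s1[of y z x w] s1[of w x y z] s1[of w x z y]
      s1[of z w x y] s1[of y z w x] s1[of w y x z]
      curv_skew2[of z w x y] curv_skew2[of w y x z] curv_skew2[of w x y z] curv_skew2[of x z y w]
    by linarith
qed

lemma curv_linear1: "linear (\<lambda>x. curv x u v)" and curv_linear2: "linear (\<lambda>x. curv u x v)"
  and curv_linear3: "linear (\<lambda>x. curv u v x)"
  by (auto intro!: linearI simp: curv_def nab_simps br_simps algebra_simps)

lemma ricf_frame: "frame h I e \<Longrightarrow> ricf u v = (\<Sum>i\<in>I. h (curv (e i) u v) (e i))"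
  unfolding ricf_def by (rule frame_tr[OF _ curv_linear1])

text \<open>Pair symmetry followed by the two skew symmetries exchanges \<open>u\<close> and
  \<open>v\<close> in each summand of the trace.\<close>

lemma ricf_sym: "ricf u v = ricf v u"
proof -
  obtain B where "orthonormal_basis h B" using orthonormal_basis_exists by blast
  then have fr: "frame h B (\<lambda>x. x)" by (rule frame_id)
  have "h (curv b u v) b = h (curv b v u) b" for b
  proof -
    have "h (curv b u v) b = h (curv v b b) u" by (rule curv_pair_symmetric)
    also have "\<dots> = - h (curv v b u) b" by (rule curv_skew2)
    also have "\<dots> = h (curv b v u) b" using curv_skew[of v b u] by (simp add: h_simps)
    finally show ?thesis .
  qed
  then show ?thesis by (simp add: ricf_frame[OF fr])
qed

lemma ricf_linear: "linear (ricf u)"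
proof -
  obtain B where "orthonormal_basis h B" using orthonormal_basis_exists by blast
  then have fr: "frame h B (\<lambda>x. x)" by (rule frame_id)
  show ?thesis
    by (rule linearI) (simp_all add: ricf_frame[OF fr] linear_add[OF curv_linear3] linear_scale[OF curv_linear3]
        h_simps sum.distrib sum_distrib_left)
qed

lemma h_Rop: "h (Rop u) v = ricf u v"
  using someI_ex[OF riesz[OF ricf_linear]] by (simp add: Rop_def)

lemma Rop_linear: "linear Rop"
  by (rule linearI; rule h_ext) (simp_all add: h_simps h_Rop ricf_sym[of "_ + _"] ricf_sym[of "_ *\<^sub>R _"]
      linear_add[OF ricf_linear] linear_scale[OF ricf_linear] ricf_sym)

text \<open>\<open>Rop\<close> is self-adjoint with matrix entries \<open>ricf (e i) (e j)\<close>,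
  so the trace of its square is the squared norm of this matrix.\<close>

lemma tr_Rop_sq: "frame h I e \<Longrightarrow> tr (Rop \<circ> Rop) = (\<Sum>i\<in>I. \<Sum>j\<in>I. (ricf (e i) (e j))\<^sup>2)"
proof -
  assume fr: "frame h I e"
  have "h (Rop (Rop (e i))) (e i) = (\<Sum>j\<in>I. (ricf (e i) (e j))\<^sup>2)" for i
  proof -
    have "h (Rop (Rop (e i))) (e i) = ricf (e i) (Rop (e i))" using ricf_sym h_Rop by metis
    also have "\<dots> = ricf (e i) (\<Sum>j\<in>I. h (Rop (e i)) (e j) *\<^sub>R e j)" using frame_expand[OF fr, of "Rop (e i)"] by simp
    also have "\<dots> = (\<Sum>j\<in>I. (ricf (e i) (e j))\<^sup>2)"
      by (simp add: linear_sum[OF ricf_linear] linear_scale[OF ricf_linear] h_Rop power2_eq_square)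
    finally show ?thesis .
  qed
  then show ?thesis using frame_tr[OF fr linear_compose[OF Rop_linear Rop_linear]] by simp
qed

lemma tr_Rop: "frame h I e \<Longrightarrow> tr Rop = (\<Sum>i\<in>I. ricf (e i) (e i))"
  by (simp add: frame_tr[OF _ Rop_linear] h_Rop)

abbreviation cst :: "('i \<Rightarrow> 'e) \<Rightarrow> 'i \<Rightarrow> 'i \<Rightarrow> 'i \<Rightarrow> real" where
  "cst e i j k \<equiv> h (br (e i) (e j)) (e k)"

lemma nab_frame:
  assumes "frame h I e" shows "nab (e i) (e j) = (\<Sum>m\<in>I. Gam (cst e) i j m *\<^sub>R e m)"
  using frame_expand[OF assms, of "nab (e i) (e j)"] by (simp add: h_nab Gam_def)

lemma curv_frame:
  assumes fr: "frame h I e"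
  shows "h (curv (e i) (e j) (e k)) (e l) = Rm I (cst e) i j k l"
proof -
  have 1: "nab x (nab (e a) (e b)) = (\<Sum>m\<in>I. Gam (cst e) a b m *\<^sub>R nab x (e m))" for x a b
    unfolding nab_frame[OF fr, of a b] by (simp add: nab_simps)
  have 2: "nab (br (e i) (e j)) (e k) = (\<Sum>m\<in>I. cst e i j m *\<^sub>R nab (e m) (e k))"
    by (subst frame_expand[OF fr, of "br (e i) (e j)"]) (simp add: nab_simps)
  have 3: "h (nab (e a) (e b)) (e c) = Gam (cst e) a b c" for a b c
    by (simp add: h_nab Gam_def)
  show ?thesis unfolding curv_def 1 2 Rm_def
    by (simp add: h_simps 3 sum_subtractf)
qed

lemma ricf_Rc: "frame h I e \<Longrightarrow> ricf (e j) (e k) = Rc I (cst e) j k"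
  by (simp add: ricf_frame curv_frame Rc_def)

lemma tr_Rop_Sc: "frame h I e \<Longrightarrow> tr Rop = Sc I (cst e)"
  by (simp add: tr_Rop ricf_Rc Sc_def)

end

text \<open>All permutations of the arguments reduce the products of structure constants to the two
  sums on the right-hand side.\<close>

lemma Sc_formula:
  fixes c :: "'i \<Rightarrow> 'i \<Rightarrow> 'i \<Rightarrow> real"
  assumes anti: "\<And>i j k. c i j k = - c j i k"
  shows "Sc I c = - (\<Sum>i\<in>I. \<Sum>j\<in>I. \<Sum>k\<in>I. (c i j k)\<^sup>2) / 4
    - (\<Sum>i\<in>I. \<Sum>j\<in>I. \<Sum>k\<in>I. c i j k * c i k j) / 2
    - (\<Sum>i\<in>I. (\<Sum>j\<in>I. c i j j)\<^sup>2)" (is "_ = - ?P / 4 - ?Q / 2 - ?H")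
proof -
  let ?S = "\<lambda>f. \<Sum>i\<in>I. \<Sum>j\<in>I. \<Sum>k\<in>I. (f i j k :: real)"
  have p12: "?S f = ?S (\<lambda>i j k. f j i k)" for f
    by (rule sum.swap)
  have p23: "?S f = ?S (\<lambda>i j k. f i k j)" for f
    by (intro sum.cong refl sum.swap)
  have p123: "?S f = ?S (\<lambda>i j k. f j k i)" for f
    by (subst p12, subst p23) simp
  have p132: "?S f = ?S (\<lambda>i j k. f k i j)" for f
    by (subst p23, subst p12) simp
  have p13: "?S f = ?S (\<lambda>i j k. f k j i)" for f
    by (subst p12, subst p123) simp
  define P where "P = ?P"
  define Q where "Q = ?Q"
  have s1: "?S (\<lambda>i j k. c i j k * c i j k) = P" by (simp add: P_def power2_eq_square)
  have s2: "?S (\<lambda>i j k. c i j k * c i k j) = Q" by (simp add: Q_def)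
  \<comment> \<open>The traced coefficients of the connection collapse to structure constants by
    antisymmetry.\<close>
  have H0: "Gam c i m i = c i m i" for i m
    using anti[of m i i] anti[of i i m] by (simp add: Gam_def)
  have H1: "Gam c j j m = - c j m j" for j m
    using anti[of m j j] anti[of j j m] by (simp add: Gam_def)
  \<comment> \<open>This term is minus the squared length of the mean curvature vector, whose
    components are the traces of \<open>ad e\<^sub>m\<close>. It survives because unimodularity is
    not assumed.\<close>
  have t1: "(\<Sum>j\<in>I. \<Sum>i\<in>I. \<Sum>m\<in>I. Gam c j j m * Gam c i m i) = - ?H"
  proof -
    have "(\<Sum>j\<in>I. \<Sum>i\<in>I. \<Sum>m\<in>I. Gam c j j m * Gam c i m i) = (\<Sum>m\<in>I. \<Sum>j\<in>I. \<Sum>i\<in>I. Gam c j j m * Gam c i m i)"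
      by (rule p123)
    also have "\<dots> = (\<Sum>m\<in>I. (\<Sum>j\<in>I. Gam c j j m) * (\<Sum>i\<in>I. Gam c i m i))"
      by (simp add: sum_product)
    also have "\<dots> = (\<Sum>m\<in>I. - ((\<Sum>j\<in>I. c m j j)\<^sup>2))"
    proof (rule sum.cong[OF refl])
      fix m
      have H2: "Gam c j j m = c m j j" for j using H1[of j m] anti[of j m j] by simp
      have H3: "Gam c i m i = - c m i i" for i using H0[of i m] anti[of i m i] by simp
      have "(\<Sum>j\<in>I. Gam c j j m) = (\<Sum>j\<in>I. c m j j)" "(\<Sum>i\<in>I. Gam c i m i) = - (\<Sum>j\<in>I. c m j j)"
        using H2 H3 by (simp_all add: sum_negf)
      then show "(\<Sum>j\<in>I. Gam c j j m) * (\<Sum>i\<in>I. Gam c i m i) = - ((\<Sum>j\<in>I. c m j j)\<^sup>2)"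
        by (simp add: power2_eq_square)
    qed
    finally show ?thesis by (simp add: sum_negf)
  qed
  let ?f = "\<lambda>i j k. c i j k * c i j k" and ?g = "\<lambda>i j k. c i j k * c j k i"
  have "?S ?g = ?S (\<lambda>i j k. - (c i j k * c i k j))"
  proof -
    have "c k i j * c i j k = - (c i j k * c i k j)" for i j k using anti[of k i j] by simp
    then show ?thesis by (subst p132) simp
  qed
  then have g: "?S ?g = - Q" by (simp add: sum_negf s2)
  have n: "c m j i = - c j m i" "c j i m = - c i j m" "c i m j = - c m i j" for i j m by (rule anti)+
  have aa: "?S (\<lambda>j i m. c i j m * c i j m) = P" using p12[of ?f] s1 by simp
  have bb: "?S (\<lambda>j i m. c j m i * c j m i) = P" using p23[of ?f] s1 by simp
  have dd: "?S (\<lambda>j i m. c m i j * c m i j) = P" using p13[of ?f] s1 by simp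
  have ab: "?S (\<lambda>j i m. c i j m * c j m i) = - Q" using p12[of ?g] g by simp
  have bd: "?S (\<lambda>j i m. c j m i * c m i j) = - Q" using p23[of ?g] g by simp
  have ad: "?S (\<lambda>j i m. c m i j * c i j m) = - Q" using p13[of ?g] g by simp
  have "Gam c i j m * Gam c j m i =
      (c i j m * c i j m - c m i j * c m i j - c j m i * c j m i + 2 * (c j m i * c m i j)) / 4" for i j m
    by (simp add: Gam_def field_simps)
  then have "?S (\<lambda>j i m. Gam c i j m * Gam c j m i) = (?S (\<lambda>j i m. c i j m * c i j m)
      - ?S (\<lambda>j i m. c m i j * c m i j) - ?S (\<lambda>j i m. c j m i * c j m i) + 2 * ?S (\<lambda>j i m. c j m i * c m i j)) / 4"
    by (simp only: sum_subtractf sum.distrib sum_distrib_left[symmetric] sum_divide_distrib[symmetric])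
  then have t2: "?S (\<lambda>j i m. Gam c i j m * Gam c j m i) = - (P + 2 * Q) / 4"
    unfolding aa bb dd bd by simp
  have "c i j m * Gam c m j i = (c i j m * c i j m - c i j m * c j m i - c m i j * c i j m) / 2" for i j m
    unfolding Gam_def n[of m j i] n(2)[of j i m] n(3)[of i m j] by (simp add: field_simps)
  then have "?S (\<lambda>j i m. c i j m * Gam c m j i) = (?S (\<lambda>j i m. c i j m * c i j m)
      - ?S (\<lambda>j i m. c i j m * c j m i) - ?S (\<lambda>j i m. c m i j * c i j m)) / 2"
    by (simp only: sum_subtractf sum_divide_distrib[symmetric])
  then have t3: "?S (\<lambda>j i m. c i j m * Gam c m j i) = (P + 2 * Q) / 2"
    unfolding aa ab ad by simp
  have "Sc I c = ?S (\<lambda>j i m. Gam c j j m * Gam c i m i) - ?S (\<lambda>j i m. Gam c i j m * Gam c j m i)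
     - ?S (\<lambda>j i m. c i j m * Gam c m j i)"
    by (simp add: Sc_def Rc_def Rm_def sum_subtractf)
  then show ?thesis unfolding t1 t2 t3 P_def Q_def by (simp add: field_simps)
qed


section \<open>The Levi-Civita connection of a left-invariant metric\<close>

text \<open>Makes the trace invariant under conjugation by \<open>mc p\<close>, which moves Ricci
  and scalar curvature from \<open>p\<close> to the identity.\<close>

lemma tr_comp_commute:
  fixes S T :: "'e::euclidean_space \<Rightarrow> 'e"
  assumes "linear S" "linear T"
  shows "tr (\<lambda>x. S (T x)) = tr (\<lambda>x. T (S x))"
proof -
  have *: "S (T b) \<bullet> b = (\<Sum>c\<in>Basis. (T b \<bullet> c) * (S c \<bullet> b))" if "linear S" for S T :: "'e \<Rightarrow> 'e" and b
    by (subst linear_expand[OF that, of "T b"]) (simp add: inner_sum_left)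
  have "tr (\<lambda>x. S (T x)) = (\<Sum>b\<in>Basis. \<Sum>c\<in>Basis. (T b \<bullet> c) * (S c \<bullet> b))"
    by (simp add: tr_def *[OF assms(1)])
  also have "\<dots> = (\<Sum>c\<in>Basis. \<Sum>b\<in>Basis. (T b \<bullet> c) * (S c \<bullet> b))" by (rule sum.swap)
  also have "\<dots> = tr (\<lambda>x. T (S x))"
    by (simp add: tr_def *[OF assms(2)] mult.commute)
  finally show ?thesis .
qed

context lie_grp
begin

lemma lie_algebra_lb: "lie_algebra lb"
  by unfold_locales (rule lb_add_left lb_scale_left lb_antisym lb_jacobi)+

lemma mc_one [simp]: "mc \<one> v = v"
  by (simp add: mc_def dfun_chart_at)

lemma lf_one [simp]: "lf u \<one> = u"
  using lf_mc[of \<one> u] by simp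

lemma riemannian_inner_form: "riemannian_metric A g \<Longrightarrow> inner_form (g p)"
  by unfold_locales (auto simp: riemannian_metric_def)

lemma smooth_at_bilinear_fin:
  fixes m :: "'v::euclidean_space \<Rightarrow> 'v \<Rightarrow> 'w::euclidean_space"
  assumes "bilinear m" "smooth_at A f p" "smooth_at A g p"
  shows "smooth_at A (\<lambda>q. m (f q) (g q)) p"
  using smooth_at_bilinear assms bilinear_conv_bounded_bilinear by blast

lemma lder_bilinear_fin:
  fixes m :: "'v::euclidean_space \<Rightarrow> 'v \<Rightarrow> 'w::euclidean_space"
  assumes "bilinear m" "smooth_at A f p" "smooth_at A g p"
  shows "lder u (\<lambda>q. m (f q) (g q)) p = m (f p) (lder u g p) + m (lder u f p) (g p)"
  using lder_bilinear assms bilinear_conv_bounded_bilinear by blast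

text \<open>Every inner product on the Lie algebra extends to a left-invariant metric; this turns
  the algebraic collapse into actual metrics.\<close>

lemma left_invariant_extension:
  assumes "inner_form h"
  defines "g \<equiv> \<lambda>p u v. h (mc p u) (mc p v)"
  shows "riemannian_metric A g" "left_invariant G A g"
proof -
  interpret inner_form h by fact
  have "bilinear (g p)" for p
    unfolding bilinear_def g_def using linear_compose[OF mc_linear linear_left]
      linear_compose[OF mc_linear linear_right] by (simp add: comp_def)
  moreover have "g p u v = g p v u" for p u v unfolding g_def by (rule sym)
  moreover have "g p u u > 0" if "u \<noteq> 0" for p u
  proof -
    have "mc p u \<noteq> 0" using lf_mc[of p u] that linear_0[OF lf_linear] by metis
    then show ?thesis unfolding g_def by (rule pos)
  qed
  moreover have "smooth_on (coord c ` cdom c) ((\<lambda>p. g p (coord_vec A c p u) (coord_vec A c p v)) \<circ> param c)"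
    if c: "c \<in> A" for c u v
    unfolding smooth_local_iff[OF c]
  proof
    fix p assume p: "p \<in> cdom c"
    have s: "smooth_at A (\<lambda>q. mc q (coord_vec A c q u)) p" for u
    proof (rule smooth_at_mc)
      fix d assume d: "d \<in> A" "p \<in> cdom d"
      \<comment> \<open>\<open>coord_vec\<close> and \<open>dfun\<close> both pass through
        \<open>chart_at A q\<close>, which varies with \<open>q\<close> without any regularity. By
        the chain rule it cancels and the transition map from \<open>c\<close> to \<open>d\<close>
        remains.\<close>
      have *: "dfun A (coord d) q (coord_vec A c q u) = frechet_derivative (coord d \<circ> param c) (at (coord c q)) u"
        if q: "q \<in> cdom c \<inter> cdom d" for q
      proof -
        let ?e = "chart_at A q"
        have e: "?e \<in> A" "q \<in> cdom ?e" by (rule chart_at_props)+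
        let ?V = "coord c ` (cdom c \<inter> (cdom d \<inter> cdom ?e))"
        have V: "open ?V" "coord c q \<in> ?V"
          using open_coord_image[OF c open_Int[OF open_cdom[OF d(1)] open_cdom[OF e(1)]]] q e by auto
        have 1: "((coord ?e \<circ> param c) has_derivative frechet_derivative (coord ?e \<circ> param c) (at (coord c q))) (at (coord c q))"
          by (rule smooth_at_has_derivative[OF smooth_at_coord[OF e] c]) (use q in auto)
        have 2: "((coord d \<circ> param ?e) has_derivative frechet_derivative (coord d \<circ> param ?e) (at (coord ?e q))) (at ((coord ?e \<circ> param c) (coord c q)))"
          using smooth_at_has_derivative[OF smooth_at_coord[OF d(1)] e] q c by auto
        have "frechet_derivative (\<lambda>x. (coord d \<circ> param ?e) ((coord ?e \<circ> param c) x)) (at (coord c q)) u =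
            frechet_derivative (coord d \<circ> param ?e) (at (coord ?e q)) (frechet_derivative (coord ?e \<circ> param c) (at (coord c q)) u)"
          using frechet_derivative_eq[OF has_derivative_compose[OF 1 2]] by simp
        moreover have "frechet_derivative (\<lambda>x. (coord d \<circ> param ?e) ((coord ?e \<circ> param c) x)) (at (coord c q)) =
            frechet_derivative (coord d \<circ> param c) (at (coord c q))"
          by (rule frechet_derivative_cong_open[OF V]) (use c e in auto)
        ultimately show ?thesis by (simp add: dfun_def coord_vec_def)
      qed
      have o: "open (cdom c \<inter> cdom d)" by (intro open_Int open_cdom c d(1))
      have "smooth_on (coord c ` (cdom c \<inter> cdom d)) (coord d \<circ> param c)"
        by (rule smooth_transition[OF c d(1)])
      from smooth_at_frechet[OF smooth_at_coord[OF c p] open_coord_image[OF c open_cdom[OF d(1)]] _ this smooth_at_const[of u]]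
      have "smooth_at A (\<lambda>q. frechet_derivative (coord d \<circ> param c) (at (coord c q)) u) p"
        using p d by auto
      then show "smooth_at A (\<lambda>q. dfun A (coord d) q (coord_vec A c q u)) p"
        by (rule smooth_at_cong[OF o, rotated 2]) (use p d * in auto)
    qed
    show "smooth_at A (\<lambda>p. g p (coord_vec A c p u) (coord_vec A c p v)) p"
      unfolding g_def by (rule smooth_at_bilinear_fin[OF bil s s])
  qed
  ultimately show "riemannian_metric A g" by (simp add: riemannian_metric_def)
  \<comment> \<open>The Maurer-Cartan form is left-invariant because \<open>inv (a \<otimes> p)
    \<otimes> (a \<otimes> q) = inv p \<otimes> q\<close>.\<close>
  have "mc (a \<otimes> p) (dmap A (\<lambda>q. a \<otimes> q) p u) = mc p u" for a p u
  proof -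
    have "mc (a \<otimes> p) (dmap A (\<lambda>q. a \<otimes> q) p u) = dfun A (\<lambda>q. x1 (inv (a \<otimes> p) \<otimes> (a \<otimes> q))) p u"
      unfolding mc_def by (rule smooth_at_comp_map(2)[OF smooth_map_at_left smooth_at_mc_fun, symmetric])
    moreover have "inv (a \<otimes> p) \<otimes> (a \<otimes> q) = inv p \<otimes> q" for q
      by (simp add: inv_mult_group m_assoc)
    ultimately show ?thesis by (simp add: mc_def)
  qed
  then show "left_invariant G A g" by (simp add: left_invariant_def g_def)
qed

end

locale left_metric = lie_grp G A for G (structure) and A +
  fixes g
  assumes riemannian: "riemannian_metric A g" and linv: "left_invariant G A g"

sublocale left_metric \<subseteq> metric_lie_algebra lb "g \<one>"
  using lie_algebra_lb riemannian_inner_form[OF riemannian] by (simp add: metric_lie_algebra_def)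

context left_metric
begin

lemma g_lf: "g p (lf u p) (lf v p) = g \<one> u v"
  using linv[unfolded left_invariant_def, rule_format, of p \<one> u v] by (simp add: left_field_def)

lemma g_mc: "g p u v = g \<one> (mc p u) (mc p v)"
  using g_lf[of p "mc p u" "mc p v"] by simp

lemma nab_bilinear: "bilinear nab"
  by (simp add: bilinear_def nab_linear nab_linear_left)

text \<open>In the trivialisation the connection is the derivative of the coefficient function plus
  the algebraic product \<open>nab\<close>.\<close>

definition lc :: "('a \<Rightarrow> 'b) \<Rightarrow> ('a \<Rightarrow> 'b) \<Rightarrow> 'a \<Rightarrow> 'b" where
  "lc X Y p = lf (lder (mc p (X p)) (\<lambda>q. mc q (Y q)) p + nab (mc p (X p)) (mc p (Y p))) p"

lemma mc_lc: "mc p (lc X Y p) = lder (mc p (X p)) (\<lambda>q. mc q (Y q)) p + nab (mc p (X p)) (mc p (Y p))"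
  by (simp add: lc_def)

lemma mc_inj: "mc p u = mc p v \<Longrightarrow> u = v"
  by (metis lf_mc)

lemmas mc_simps = linear_add[OF mc_linear] linear_scale[OF mc_linear] linear_diff[OF mc_linear]

lemma lc_vector_field:
  assumes "X \<in> vector_fields A" "Y \<in> vector_fields A" shows "lc X Y \<in> vector_fields A"
  using assms unfolding vector_fields_mc mc_lc
  by (auto intro!: smooth_at_add smooth_at_lder_field smooth_at_bilinear_fin[OF nab_bilinear])

lemma bracket_vector_field:
  assumes "X \<in> vector_fields A" "Y \<in> vector_fields A" shows "vf_bracket A X Y \<in> vector_fields A"
proof -
  have "bilinear lb" by (simp add: bilinear_def br_linear br_linear_left)
  note bl = this
  show ?thesis unfolding vector_fields_mc vf_bracket_mc[OF assms] mc_lf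
  proof
    fix p
    have s: "smooth_at A (\<lambda>q. mc q (X q)) p" "smooth_at A (\<lambda>q. mc q (Y q)) p"
      using assms by (auto simp: vector_fields_mc)
    show "smooth_at A (\<lambda>q. lder (mc q (X q)) (\<lambda>q. mc q (Y q)) q - lder (mc q (Y q)) (\<lambda>q. mc q (X q)) q
        + lb (mc q (X q)) (mc q (Y q))) p"
      by (rule smooth_at_add[OF smooth_at_diff[OF smooth_at_lder_field[OF s(2,1)] smooth_at_lder_field[OF s(1,2)]]
            smooth_at_bilinear_fin[OF bl s]])
  qed
qed

lemma levi_civita_lc: "levi_civita A g lc"
  unfolding levi_civita_def
proof (intro ballI allI impI conjI)
  fix X Y Z and f :: "'a \<Rightarrow> real" and p
  assume X: "X \<in> vector_fields A" and Y: "Y \<in> vector_fields A" and Z: "Z \<in> vector_fields A"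
    and f: "smooth_fun A f"
  have s: "smooth_at A (\<lambda>q. mc q (X q)) p" "smooth_at A (\<lambda>q. mc q (Y q)) p" "smooth_at A (\<lambda>q. mc q (Z q)) p"
    "smooth_at A f p"
    using X Y Z f by (auto simp: vector_fields_mc smooth_fun_iff)
  show "lc X Y \<in> vector_fields A" using X Y by (rule lc_vector_field)
  show "lc (\<lambda>q. X q + Y q) Z p = lc X Z p + lc Y Z p"
    by (rule mc_inj[of p]) (simp add: mc_simps mc_lc linear_add[OF lder_linear[OF s(3)]] nab_simps)
  show "lc (\<lambda>q. f q *\<^sub>R X q) Y p = f p *\<^sub>R lc X Y p"
    by (rule mc_inj[of p]) (simp add: mc_simps mc_lc linear_scale[OF lder_linear[OF s(2)]] nab_simps scaleR_add_right)
  show "lc X (\<lambda>q. Y q + Z q) p = lc X Y p + lc X Z p"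
    by (rule mc_inj[of p]) (simp add: mc_simps mc_lc lder_add[OF s(2,3)] nab_simps)
  show "lc X (\<lambda>q. f q *\<^sub>R Y q) p = vf_apply A X f p *\<^sub>R Y p + f p *\<^sub>R lc X Y p"
    by (rule mc_inj[of p]) (simp add: mc_simps mc_lc lder_bilinear[OF bounded_bilinear_scaleR s(4,2)] nab_simps
        vf_apply_lder[OF s(4)] scaleR_add_right)
  show "lc X Y p - lc Y X p = vf_bracket A X Y p"
  proof (rule mc_inj[of p])
    have eq: "nab (mc p (X p)) (mc p (Y p)) = lb (mc p (X p)) (mc p (Y p)) + nab (mc p (Y p)) (mc p (X p))"
      using nab_torsion[of "mc p (X p)" "mc p (Y p)"] by (simp only: diff_eq_eq)
    show "mc p (lc X Y p - lc Y X p) = mc p (vf_bracket A X Y p)"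
      unfolding mc_simps mc_lc vf_bracket_mc[OF X Y] mc_lf eq by simp
  qed
  have "vf_apply A X (\<lambda>q. g q (Y q) (Z q)) p = vf_apply A X (\<lambda>q. g \<one> (mc q (Y q)) (mc q (Z q))) p"
    by (simp add: g_mc[of _ "Y _"])
  also have "\<dots> = g \<one> (mc p (Y p)) (lder (mc p (X p)) (\<lambda>q. mc q (Z q)) p) + g \<one> (lder (mc p (X p)) (\<lambda>q. mc q (Y q)) p) (mc p (Z p))"
    using vf_apply_lder[OF smooth_at_bilinear_fin[OF bil s(2,3)]] lder_bilinear_fin[OF bil s(2,3)] by simp
  also have "\<dots> = g p (lc X Y p) (Z p) + g p (Y p) (lc X Z p)"
    using nab_metric[of "mc p (X p)" "mc p (Y p)" "mc p (Z p)"]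
    by (simp add: g_mc[of p] mc_lc h_simps)
  finally show "vf_apply A X (\<lambda>q. g q (Y q) (Z q)) p = g p (lc X Y p) (Z p) + g p (Y p) (lc X Z p)" .
qed

lemma lf_vector_field: "lf u \<in> vector_fields A"
  by (simp add: vector_fields_mc smooth_at_const)

text \<open>The difference of two Levi-Civita connections is symmetric in its first two arguments and
  skew in the last two, hence zero.\<close>

lemma levi_civita_unique:
  assumes D: "levi_civita A g D" and X: "X \<in> vector_fields A" and Y: "Y \<in> vector_fields A"
  shows "D X Y = lc X Y"
proof
  fix p
  have f: "smooth_fun A (\<lambda>q. 0::real)" by (simp add: smooth_fun_iff smooth_at_const)
  interpret P: inner_form "g p" by (rule riemannian_inner_form[OF riemannian])
  define t where "t X Y Z = g p (D X Y p - lc X Y p) (Z p)" for X Y Z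
  have t12: "t X Y Z = t Y X Z" if "X \<in> vector_fields A" "Y \<in> vector_fields A" "Z \<in> vector_fields A" for X Y Z
  proof -
    have "D X Y p - D Y X p = vf_bracket A X Y p" "lc X Y p - lc Y X p = vf_bracket A X Y p"
      using D levi_civita_lc that f unfolding levi_civita_def by blast+
    then have "D X Y p - lc X Y p = D Y X p - lc Y X p" by (simp add: algebra_simps)
    then show ?thesis by (simp add: t_def)
  qed
  have t23: "t X Y Z = - t X Z Y" if "X \<in> vector_fields A" "Y \<in> vector_fields A" "Z \<in> vector_fields A" for X Y Z
  proof -
    have "vf_apply A X (\<lambda>q. g q (Y q) (Z q)) p = g p (D X Y p) (Z p) + g p (Y p) (D X Z p)"
      "vf_apply A X (\<lambda>q. g q (Y q) (Z q)) p = g p (lc X Y p) (Z p) + g p (Y p) (lc X Z p)"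
      using D levi_civita_lc that f unfolding levi_civita_def by blast+
    then show ?thesis by (simp add: t_def P.h_simps P.sym[of "Y p"])
  qed
  \<comment> \<open>The difference is tested against itself: the left-invariant field through its
    value at \<open>p\<close> is an admissible third field.\<close>
  define Z where "Z = lf (mc p (D X Y p - lc X Y p))"
  have Z: "Z \<in> vector_fields A" "Z p = D X Y p - lc X Y p" by (simp_all add: Z_def lf_vector_field)
  \<comment> \<open>Six alternating exchanges of neighbouring arguments return to the start; each of
    the three skew ones contributes a sign.\<close>
  have "t X Y Z = - t X Y Z"
    using t12[OF X Y Z(1)] t23[OF Y X Z(1)] t12[OF Y Z(1) X] t23[OF Z(1) Y X] t12[OF Z(1) X Y] t23[OF X Z(1) Y]
    by simp
  then have "g p (D X Y p - lc X Y p) (D X Y p - lc X Y p) = 0" unfolding t_def Z(2) by simp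
  then show "D X Y p = lc X Y p" by (simp add: P.h_eq_0)
qed

text \<open>All terms that differentiate the coefficient functions cancel by
  \<open>field_commutator\<close>, which is tensoriality in concrete form.\<close>

lemma lc_curvature:
  assumes X: "X \<in> vector_fields A" and Y: "Y \<in> vector_fields A" and Z: "Z \<in> vector_fields A"
  shows "lc X (lc Y Z) p - lc Y (lc X Z) p - lc (vf_bracket A X Y) Z p =
    lf (curv (mc p (X p)) (mc p (Y p)) (mc p (Z p))) p"
proof (rule mc_inj[of p])
  let ?x = "\<lambda>q. mc q (X q)" and ?y = "\<lambda>q. mc q (Y q)" and ?z = "\<lambda>q. mc q (Z q)"
  have s: "smooth_at A ?x p" "smooth_at A ?y p" "smooth_at A ?z p"
    using X Y Z by (auto simp: vector_fields_mc)
  have *: "mc p (lc V (lc W Z) p) = lder (mc p (V p)) (\<lambda>q. lder (mc q (W q)) ?z q) p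
      + nab (mc p (W p)) (lder (mc p (V p)) ?z p) + nab (lder (mc p (V p)) (\<lambda>q. mc q (W q)) p) (?z p)
      + nab (mc p (V p)) (lder (mc p (W p)) ?z p) + nab (mc p (V p)) (nab (mc p (W p)) (?z p))"
    if "smooth_at A (\<lambda>q. mc q (W q)) p" for V W
    unfolding mc_lc lder_add[OF smooth_at_lder_field[OF s(3) that] smooth_at_bilinear_fin[OF nab_bilinear that s(3)]]
      lder_bilinear_fin[OF nab_bilinear that s(3)] by (simp add: nab_simps add.assoc)
  have "mc p (lc (vf_bracket A X Y) Z p) =
      lder (lder (?x p) ?y p - lder (?y p) ?x p + lb (?x p) (?y p)) ?z p +
      nab (lder (?x p) ?y p - lder (?y p) ?x p + lb (?x p) (?y p)) (?z p)"
    by (simp add: mc_lc vf_bracket_mc[OF X Y])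
  then show "mc p (lc X (lc Y Z) p - lc Y (lc X Z) p - lc (vf_bracket A X Y) Z p) =
    mc p (lf (curv (?x p) (?y p) (?z p)) p)"
    using field_commutator[OF s(3,1,2)]
    by (simp add: mc_simps *[OF s(2)] *[OF s(1)] curv_def nab_simps algebra_simps)
qed

text \<open>The value of \<open>THE\<close> is unique for two reasons: any Levi-Civita connection
  agrees with \<open>lc\<close> on vector fields, and by \<open>lc_curvature\<close> the result sees
  the fields at \<open>p\<close> only. Left-invariant fields witness existence.\<close>

lemma riem_eq: "riem A g p u v w = lf (curv (mc p u) (mc p v) (mc p w)) p"
  unfolding riem_def
proof (rule the_equality)
  show "\<exists>D. levi_civita A g D \<and> (\<exists>X\<in>vector_fields A. \<exists>Y\<in>vector_fields A. \<exists>Z\<in>vector_fields A.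
      X p = u \<and> Y p = v \<and> Z p = w \<and>
      lf (curv (mc p u) (mc p v) (mc p w)) p = D X (D Y Z) p - D Y (D X Z) p - D (vf_bracket A X Y) Z p)"
    using lc_curvature[OF lf_vector_field lf_vector_field lf_vector_field, of "mc p u" "mc p v" "mc p w" p]
    by (intro exI[of _ lc] conjI levi_civita_lc bexI[of _ "lf (mc p u)"] bexI[of _ "lf (mc p v)"]
        bexI[of _ "lf (mc p w)"] lf_vector_field) simp_all
next
  fix r
  assume "\<exists>D. levi_civita A g D \<and> (\<exists>X\<in>vector_fields A. \<exists>Y\<in>vector_fields A. \<exists>Z\<in>vector_fields A.
      X p = u \<and> Y p = v \<and> Z p = w \<and> r = D X (D Y Z) p - D Y (D X Z) p - D (vf_bracket A X Y) Z p)"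
  then obtain D X Y Z where D: "levi_civita A g D" and V: "X \<in> vector_fields A" "Y \<in> vector_fields A" "Z \<in> vector_fields A"
    and p: "X p = u" "Y p = v" "Z p = w" and r: "r = D X (D Y Z) p - D Y (D X Z) p - D (vf_bracket A X Y) Z p"
    by blast
  have "r = lc X (lc Y Z) p - lc Y (lc X Z) p - lc (vf_bracket A X Y) Z p"
    unfolding r using levi_civita_unique[OF D] V lc_vector_field bracket_vector_field by simp
  then show "r = lf (curv (mc p u) (mc p v) (mc p w)) p" using lc_curvature[OF V] p by simp
qed

lemma ricci_form_eq: "ricci_form A g p u v = ricf (mc p u) (mc p v)"
proof -
  have "tr (\<lambda>x. lf (curv (mc p x) (mc p u) (mc p v)) p) = tr (\<lambda>x. curv (mc p (lf x p)) (mc p u) (mc p v))"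
    using tr_comp_commute[OF lf_linear linear_compose[OF mc_linear curv_linear1]] by (simp add: comp_def)
  then show ?thesis by (simp add: ricci_form_def riem_eq ricf_def)
qed

lemma Ric_eq: "Ric A g p u = lf (Rop (mc p u)) p"
  unfolding Ric_def
proof (rule the_equality)
  show "\<forall>v. g p (lf (Rop (mc p u)) p) v = ricci_form A g p u v"
    by (simp add: g_mc[of p] ricci_form_eq h_Rop)
next
  fix w assume *: "\<forall>v. g p w v = ricci_form A g p u v"
  have "mc p w = Rop (mc p u)"
  proof (rule h_ext)
    fix z show "g \<one> (mc p w) z = g \<one> (Rop (mc p u)) z"
      using *[rule_format, of "lf z p"] by (simp add: g_mc[of p] ricci_form_eq h_Rop)
  qed
  then show "w = lf (Rop (mc p u)) p" by (metis lf_mc)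
qed

lemma scal_eq: "scal A g p = tr Rop"
proof -
  have "tr (\<lambda>x. lf (Rop (mc p x)) p) = tr (\<lambda>x. Rop (mc p (lf x p)))"
    using tr_comp_commute[OF lf_linear linear_compose[OF mc_linear Rop_linear]] by (simp add: comp_def)
  then show ?thesis by (simp add: scal_def Ric_eq[abs_def])
qed

lemma F_pinch_eq: "F_pinch G A g = (tr Rop)\<^sup>2 / tr (Rop \<circ> Rop)"
  by (simp add: F_pinch_def scal_eq Ric_eq comp_def)

lemma flat_iff: "flat A g \<longleftrightarrow> (\<forall>u v w. curv u v w = 0)"
proof
  assume *: "flat A g"
  show "\<forall>u v w. curv u v w = 0" using * unfolding flat_def riem_eq by (metis lf_one mc_one)
next
  assume "\<forall>u v w. curv u v w = 0"
  then show "flat A g" using linear_0[OF lf_linear] by (simp add: flat_def riem_eq)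
qed

text \<open>\<open>mc p\<close> is an isometry onto the Lie algebra, so it carries the orthonormal
  basis chosen at \<open>p\<close> to one at the identity.\<close>

lemma riem_norm_eq:
  "\<exists>B. orthonormal_basis (g \<one>) B \<and>
     riem_norm A g p = sqrt (\<Sum>u\<in>B. \<Sum>v\<in>B. \<Sum>w\<in>B. g \<one> (curv u v w) (curv u v w))"
proof -
  interpret P: inner_form "g p" by (rule riemannian_inner_form[OF riemannian])
  define B where "B = (SOME B. orthonormal_basis (g p) B)"
  have B: "orthonormal_basis (g p) B" using someI_ex[OF P.orthonormal_basis_exists] by (simp add: B_def)
  have inj: "inj_on (mc p) B" using mc_inj by (auto intro: inj_onI)
  have "span (mc p ` B) = mc p ` span B" by (rule linear_span_image[OF mc_linear])
  also have "\<dots> = UNIV" using B surjI[of "mc p" "\<lambda>u. lf u p", OF mc_lf] by (simp add: orthonormal_basis_def)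
  finally have "orthonormal_basis (g \<one>) (mc p ` B)"
    using B inj unfolding orthonormal_basis_def by (simp add: g_mc[of p, symmetric] inj_on_eq_iff)
  moreover have "riem_norm A g p = sqrt (\<Sum>u\<in>mc p ` B. \<Sum>v\<in>mc p ` B. \<Sum>w\<in>mc p ` B. g \<one> (curv u v w) (curv u v w))"
    by (simp add: riem_norm_def Let_def B_def[symmetric] riem_eq g_lf sum.reindex[OF inj])
  ultimately show ?thesis by blast
qed

end


section \<open>The Lie algebra of a solvable group\<close>

context lie_grp
begin

text \<open>A substitute for the Lie algebra of a subgroup that may fail to be closed. Continuity of
  the curve is required separately: differentiability of \<open>x1 (\<gamma> t)\<close> alone would
  not keep the curve in the chart.\<close>

definition velocities :: "'a set \<Rightarrow> 'e set" where
  "velocities H = {u. \<exists>\<gamma>::real \<Rightarrow> 'a. \<gamma> 0 = \<one> \<and> (\<forall>t. \<gamma> t \<in> H) \<and> isCont \<gamma> 0 \<and>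
     ((\<lambda>t. x1 (\<gamma> t)) has_vector_derivative u) (at 0)}"

lemma smooth_at2_swap:
  assumes "smooth_at2 A F a b" shows "smooth_at2 A (\<lambda>p q. F q p) b a"
proof -
  obtain c d S where cd: "c \<in> A" "d \<in> A" "a \<in> cdom c" "b \<in> cdom d"
    and S: "open S" "(coord c a, coord d b) \<in> S"
    "S \<subseteq> (coord c ` cdom c) \<times> (coord d ` cdom d)"
    "smooth_on S (\<lambda>z. F (param c (fst z)) (param d (snd z)))" (is "smooth_on S ?G")
    using assms unfolding smooth_at2_def by blast
  let ?s = "\<lambda>z::'e\<times>'e. (snd z, fst z)"
  have bl: "bounded_linear ?s" by (intro bounded_linear_Pair bounded_linear_fst bounded_linear_snd)
  have o: "open (?s -` S)"
    using open_vimage[OF S(1) linear_continuous_on[OF bl]] .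
  have "smooth_on (?s -` S) (\<lambda>z. ?G (?s z))"
    by (rule smooth_on_compose[OF o S(1) _ smooth_on_linear[OF bl o] S(4)]) auto
  then have "smooth_on (?s -` S) (\<lambda>z. F (param c (snd z)) (param d (fst z)))" by simp
  moreover have "?s -` S \<subseteq> (coord d ` cdom d) \<times> (coord c ` cdom c)" using S(3) by auto
  moreover have "(coord d b, coord c a) \<in> ?s -` S" using S(2) by simp
  ultimately show ?thesis unfolding smooth_at2_def using cd o by blast
qed

lemma curve_derivative:
  assumes \<gamma>: "\<gamma> 0 = \<one>" "isCont \<gamma> 0" "((\<lambda>t. x1 (\<gamma> t)) has_vector_derivative u) (at 0)"
    and f: "smooth_at A f \<one>"
  shows "((\<lambda>t. f (\<gamma> t)) has_vector_derivative dfun A f \<one> u) (at (0::real))"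
proof -
  let ?c = "chart_at A \<one>" and ?F = "frechet_derivative (f \<circ> param (chart_at A \<one>)) (at (x1 \<one>))"
  have F: "((f \<circ> param ?c) has_derivative ?F) (at (x1 (\<gamma> 0)))"
    unfolding \<gamma>(1) by (rule smooth_at_has_derivative[OF f chart_at_props])
  have "((\<lambda>t. x1 (\<gamma> t)) has_derivative (\<lambda>t. t *\<^sub>R u)) (at 0)"
    using \<gamma>(3) by (simp add: has_vector_derivative_def)
  from has_derivative_compose[OF this F]
  have d: "((\<lambda>t. (f \<circ> param ?c) (x1 (\<gamma> t))) has_derivative (\<lambda>t. t *\<^sub>R ?F u)) (at 0)"
    by (simp add: linear_scale[OF has_derivative_linear[OF F]])
  have "(\<gamma> \<longlongrightarrow> \<one>) (at 0)" using \<gamma> by (simp add: isCont_def)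
  then have ev: "eventually (\<lambda>t. \<gamma> t \<in> cdom ?c) (at 0)"
    using open_cdom chart_at_props by (auto simp: tendsto_def)
  have "((\<lambda>t. f (\<gamma> t)) has_derivative (\<lambda>t. t *\<^sub>R ?F u)) (at 0)"
    by (rule has_derivative_transform_eventually[OF d])
      (use ev chart_at_props \<gamma> in \<open>auto elim!: eventually_mono\<close>)
  then show ?thesis by (simp add: has_vector_derivative_def dfun_def)
qed

lemma isCont_smooth_map_curve:
  assumes "smooth_map_at A k (\<gamma> 0)" "isCont \<gamma> (0::real)"
  shows "isCont (\<lambda>t. k (\<gamma> t)) 0"
  unfolding isCont_def
proof (rule topological_tendstoI)
  fix V assume V: "open V" "k (\<gamma> 0) \<in> V"
  obtain U where U: "open U" "\<gamma> 0 \<in> U" "k ` U \<subseteq> V" using smooth_map_at_nbhd[OF assms(1) V] by blast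
  have "eventually (\<lambda>t. \<gamma> t \<in> U) (at 0)"
    using assms(2) U(1,2) by (auto simp: isCont_def tendsto_def)
  then show "eventually (\<lambda>t. k (\<gamma> t) \<in> V) (at 0)" by (rule eventually_mono) (use U(3) in auto)
qed

text \<open>The right-invariant field with value \<open>v\<close> at the identity.\<close>

definition rf :: "'e \<Rightarrow> 'a \<Rightarrow> 'e" where
  "rf v p = dmap A (\<lambda>q. q \<otimes> p) \<one> v"

lemma smooth_map_at_right: "smooth_map_at A (\<lambda>q. q \<otimes> p) q0"
  by (rule smooth_map_at_mult[OF smooth_map_at_id smooth_map_at_const])

lemma dfun_rf: "smooth_at A f p \<Longrightarrow> dfun A f p (rf v p) = dfun A (\<lambda>q. f (q \<otimes> p)) \<one> v"
  using smooth_at_comp_map(2)[OF smooth_map_at_right, of f \<one> p v] by (simp add: rf_def)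

lemma smooth_at_right_dfun:
  assumes "smooth_at A f p" shows "smooth_at A (\<lambda>p. dfun A (\<lambda>q. f (q \<otimes> p)) \<one> v) p"
proof -
  have "smooth_at2 A (\<lambda>q p. f (q \<otimes> p)) \<one> p" by (rule smooth_at2_mult) (simp add: assms)
  from smooth_at_partial[where k="\<lambda>q. \<one>" and X="\<lambda>q. v", OF smooth_at2_swap[OF this] smooth_map_at_const smooth_at_const]
  show ?thesis .
qed

text \<open>\<open>mc p (rf v p)\<close> is the adjoint action of the inverse of \<open>p\<close> on \<open>v\<close>.\<close>

lemma smooth_at_mc_rf: "smooth_at A (\<lambda>p. mc p (rf v p)) p"
proof (rule smooth_at_mc)
  fix d assume d: "d \<in> A" "p \<in> cdom d"
  show "smooth_at A (\<lambda>q. dfun A (coord d) q (rf v q)) p"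
    by (rule smooth_at_cong[OF open_cdom[OF d(1)] d(2) _ smooth_at_right_dfun[OF smooth_at_coord[OF d]]])
      (simp add: dfun_rf smooth_at_coord[OF d(1)])
qed

lemma mc_rf_one: "mc \<one> (rf v \<one>) = v"
  using dfun_rf[OF smooth_at_x1, of v] by (simp add: dfun_chart_at)

text \<open>Derivatives by left and right translations act on different factors of a product and
  therefore commute. Differentiating \<open>lder (mc p (rf v p)) x1 p\<close> at the identity
  compares the two orders, and the discrepancy is the bracket.\<close>

lemma lder_mc_rf: "dfun A (\<lambda>p. mc p (rf v p)) \<one> u = - lb u v"
proof -
  let ?U = "cdom (chart_at A \<one>)"
  have U: "open ?U" "\<one> \<in> ?U" "\<And>q. q \<in> ?U \<Longrightarrow> smooth_at A x1 q"
    using open_cdom chart_at_props smooth_at_coord by auto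
  have *: "lder (mc p (rf v p)) x1 p = dfun A (\<lambda>q. x1 (q \<otimes> p)) \<one> v" if "p \<in> ?U" for p
    using dfun_left_field[OF U(3)[OF that], of "mc p (rf v p)"] dfun_rf[OF U(3)[OF that]] by simp
  have "lder u (\<lambda>p. mc p (rf v p)) \<one> + lder u (lder v x1) \<one> = lder u (\<lambda>p. lder (mc p (rf v p)) x1 p) \<one>"
    using lder_lder_field[OF smooth_at_x1 smooth_at_mc_rf, of u v] lder_x1 mc_rf_one by simp
  also have "\<dots> = dfun A (\<lambda>p. dfun A (\<lambda>q. x1 (q \<otimes> p)) \<one> v) \<one> u"
    unfolding lder_one by (rule dfun_cong[OF U(1,2)]) (rule *)
  also have "\<dots> = dfun A (\<lambda>q. dfun A (\<lambda>p. x1 (q \<otimes> p)) \<one> u) \<one> v"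
  proof (rule dfun_mixed_symmetric)
    have "smooth_at2 A (\<lambda>q p. x1 (q \<otimes> p)) \<one> \<one>" by (rule smooth_at2_mult) (simp add: smooth_at_x1)
    from smooth_at2_swap[OF this] show "smooth_at2 A (\<lambda>p q. x1 (q \<otimes> p)) \<one> \<one>" .
  qed
  also have "\<dots> = lder v (lder u x1) \<one>" by (simp add: lder_one lder_def[abs_def])
  finally show ?thesis by (simp add: lie_bracket_eq lder_one algebra_simps)
qed

text \<open>The commutator is the product of the conjugate of \<open>q\<close> and the inverse of
  \<open>q\<close>; by the product rule the derivatives add up, and inversion has derivative
  \<open>- v\<close>.\<close>

lemma dfun_commutator:
  "dfun A (\<lambda>q. x1 (inv p \<otimes> q \<otimes> p \<otimes> inv q)) \<one> v = mc p (rf v p) - v"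
proof -
  have F: "smooth_at2 A (\<lambda>a b. x1 (a \<otimes> b)) a b" if "a \<otimes> b = \<one>" for a b
    by (rule smooth_at2_mult) (simp add: that smooth_at_x1)
  have i: "dfun A (\<lambda>q. x1 (inv q)) \<one> v = - v"
    using smooth_at2_comp(2)[OF F smooth_map_at_id smooth_map_at_inv, of \<one> v]
    by (simp add: dfun_const dfun_chart_at add_eq_0_iff)
  have k: "smooth_map_at A (\<lambda>q. inv p \<otimes> q \<otimes> p) \<one>"
    by (intro smooth_map_at_mult smooth_map_at_const smooth_map_at_id)
  have "mc p (rf v p) = dfun A (\<lambda>q. x1 (inv p \<otimes> q \<otimes> p)) \<one> v"
    unfolding mc_def using dfun_rf[OF smooth_at_mc_fun, of p v] by (simp add: m_assoc)
  then show ?thesis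
    using smooth_at2_comp(2)[OF F k smooth_map_at_inv, of v] by (simp add: i)
qed

text \<open>For \<open>u = \<gamma>'(0)\<close>, \<open>v = \<delta>'(0)\<close> and fixed \<open>s\<close>, the commutator of \<open>\<gamma>(s)\<close> inverse and \<open>\<delta>(t)\<close> is a curve in
  \<open>t\<close> with velocity \<open>mc (\<gamma> s) (rf v (\<gamma> s)) - v\<close>, whose derivative in \<open>s\<close> at 0 is \<open>- [u, v]\<close>.\<close>

lemma velocities_commutator:
  assumes H: "subgroup H G" and u: "u \<in> velocities H" and v: "v \<in> velocities H"
  shows "lb u v \<in> span (velocities (derived G H))"
proof -
  obtain \<gamma> where \<gamma>: "\<gamma> 0 = \<one>" "\<And>t. \<gamma> t \<in> H" "isCont \<gamma> 0" "((\<lambda>t. x1 (\<gamma> t)) has_vector_derivative u) (at (0::real))"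
    using u unfolding velocities_def by blast
  obtain \<delta> where \<delta>: "\<delta> 0 = \<one>" "\<And>t. \<delta> t \<in> H" "isCont \<delta> 0" "((\<lambda>t. x1 (\<delta> t)) has_vector_derivative v) (at (0::real))"
    using v unfolding velocities_def by blast
  let ?y = "\<lambda>p. mc p (rf v p)"
  have in_span: "?y (\<gamma> s) - v \<in> velocities (derived G H)" for s
  proof -
    define p where "p = \<gamma> s"
    let ?k = "\<lambda>q. inv p \<otimes> q \<otimes> p \<otimes> inv q"
    have k: "smooth_map_at A ?k \<one>"
      by (intro smooth_map_at_mult smooth_map_at_const smooth_map_at_id smooth_map_at_inv)
    have k1: "?k \<one> = \<one>" by simp
    have x1k: "smooth_at A (\<lambda>q. x1 (?k q)) \<one>"
      by (rule smooth_at_comp_map(1)[OF k]) (simp add: smooth_at_x1)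
    have "?k (\<delta> t) \<in> derived G H" for t
    proof -
      have "inv p \<in> H" unfolding p_def using H \<gamma>(2) by (simp add: subgroup.m_inv_closed)
      then have "inv p \<otimes> \<delta> t \<otimes> inv (inv p) \<otimes> inv (\<delta> t) \<in> derived_set G H" using \<delta>(2) by blast
      then show ?thesis unfolding derived_def by (auto intro: generate.incl)
    qed
    moreover have "isCont (\<lambda>t. ?k (\<delta> t)) 0"
      by (rule isCont_smooth_map_curve[OF _ \<delta>(3)]) (simp only: \<delta>(1) k)
    moreover have "((\<lambda>t. x1 (?k (\<delta> t))) has_vector_derivative ?y p - v) (at 0)"
      using curve_derivative[OF \<delta>(1,3,4) x1k] by (simp only: dfun_commutator)
    ultimately show ?thesis unfolding velocities_def p_def[symmetric]
      using \<delta>(1) k1 by (intro CollectI exI[of _ "\<lambda>t. ?k (\<delta> t)"]) simp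
  qed
  have "((\<lambda>t. ?y (\<gamma> t)) has_vector_derivative - lb u v) (at 0)"
    using curve_derivative[OF \<gamma>(1,3,4) smooth_at_mc_rf] by (simp only: lder_mc_rf)
  then have 0: "((\<lambda>s. norm (?y (\<gamma> s) - v + s *\<^sub>R lb u v) / \<bar>s\<bar>) \<longlongrightarrow> 0) (at 0)"
    using \<gamma>(1) mc_rf_one by (simp add: has_vector_derivative_def has_derivative_iff_norm)
  have "norm ((?y (\<gamma> s) - v) /\<^sub>R s - - lb u v) = norm (?y (\<gamma> s) - v + s *\<^sub>R lb u v) / \<bar>s\<bar>"
    if "s \<noteq> 0" for s
  proof -
    have "(?y (\<gamma> s) - v) /\<^sub>R s - - lb u v = (?y (\<gamma> s) - v + s *\<^sub>R lb u v) /\<^sub>R s"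
      using that by (simp add: scaleR_add_right)
    then show ?thesis by (simp add: divide_inverse mult.commute)
  qed
  then have "eventually (\<lambda>s. norm ((?y (\<gamma> s) - v) /\<^sub>R s - - lb u v) = norm (?y (\<gamma> s) - v + s *\<^sub>R lb u v) / \<bar>s\<bar>) (at 0)"
    by (auto simp: eventually_at intro: exI[of _ 1])
  from tendsto_cong[OF this] 0
  have "((\<lambda>s. norm ((?y (\<gamma> s) - v) /\<^sub>R s - - lb u v)) \<longlongrightarrow> 0) (at 0)" by blast
  from LIM_zero_cancel[OF tendsto_norm_zero_cancel[OF this]]
  have "((\<lambda>s. (?y (\<gamma> s) - v) /\<^sub>R s) \<longlongrightarrow> - lb u v) (at 0)" .
  note lim = this
  have ev: "eventually (\<lambda>s. (?y (\<gamma> s) - v) /\<^sub>R s \<in> span (velocities (derived G H))) (at 0)"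
    by (intro always_eventually allI span_scale span_base in_span)
  \<comment> \<open>The difference quotients lie in a subspace of finite dimension, which is closed
    and so contains their limit.\<close>
  have "- lb u v \<in> span (velocities (derived G H))"
    by (rule Lim_in_closed_set[OF closed_subspace[OF subspace_span] ev _ lim]) simp
  then show ?thesis using span_neg by force
qed

text \<open>A straight line in the chart realises any vector. Far from 0 it may leave the chart and
  \<open>param\<close> is arbitrary there, but no membership has to be checked for
  \<open>UNIV\<close>.\<close>

lemma velocities_UNIV: "velocities UNIV = UNIV"
proof -
  have "u \<in> velocities UNIV" for u
  proof -
    let ?c = "chart_at A \<one>"
    let ?l = "\<lambda>t. x1 \<one> + t *\<^sub>R u"
    let ?\<gamma> = "\<lambda>t::real. param ?c (?l t)"
    have oi: "open (x1 ` cdom ?c)" using open_image chart_at_props by blast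
    have l: "continuous_on UNIV ?l" by (intro continuous_intros)
    have V: "open (?l -` (x1 ` cdom ?c))" "0 \<in> ?l -` (x1 ` cdom ?c)"
      using open_vimage[OF oi l] chart_at_props by auto
    have "continuous_on (?l -` (x1 ` cdom ?c)) ?\<gamma>"
      by (rule continuous_on_compose2[OF continuous_param[OF chart_at_props(1)] continuous_on_subset[OF l]]) auto
    then have c: "isCont ?\<gamma> 0" using V continuous_on_eq_continuous_at by blast
    have "(?l has_vector_derivative u) (at 0)"
      by (auto intro!: derivative_eq_intros)
    then have "((\<lambda>t. x1 (?\<gamma> t)) has_vector_derivative u) (at 0)"
      by (rule has_vector_derivative_transform_within_open[OF _ V]) (use chart_at_props in auto)
    then show ?thesis unfolding velocities_def using c chart_at_props by (intro CollectI exI[of _ ?\<gamma>]) auto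
  qed
  then show ?thesis by blast
qed

lemma velocities_one: "velocities {\<one>} \<subseteq> {0}"
proof
  fix u assume "u \<in> velocities {\<one>}"
  then obtain \<gamma> :: "real \<Rightarrow> 'a" where "\<And>t. \<gamma> t = \<one>" "((\<lambda>t. x1 (\<gamma> t)) has_vector_derivative u) (at 0)"
    unfolding velocities_def by blast
  then have "((\<lambda>t::real. x1 \<one>) has_vector_derivative u) (at 0)" by simp
  then show "u \<in> {0}" using vector_derivative_unique_at[OF _ has_vector_derivative_const] by blast
qed

lemma velocities_mono: "H \<subseteq> K \<Longrightarrow> velocities H \<subseteq> velocities K"
  unfolding velocities_def by blast

text \<open>The spans of the velocities of the derived series of the group form a decreasing chain.
  It need not be the derived series of the Lie algebra; it only has to contain the brackets of the
  preceding member and to end in 0.\<close>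

lemma solvable_lie_algebra:
  assumes "solvable G"
  obtains D :: "nat \<Rightarrow> 'e set" and n where "D 0 = UNIV" "D n = {0}" "\<And>i. subspace (D i)" "\<And>i. D (Suc i) \<subseteq> D i"
    "\<And>i u v. u \<in> D i \<Longrightarrow> v \<in> D i \<Longrightarrow> lb u v \<in> D (Suc i)"
proof -
  obtain n where n: "(derived G ^^ n) (carrier G) = {\<one>}"
    using assms solvable_iff_trivial_derived_seq by blast
  define H where "H i = (derived G ^^ i) (carrier G)" for i
  define D where "D i = span (velocities (H i))" for i
  have sg: "subgroup (H i) G" for i
    unfolding H_def by (rule exp_of_derived_is_subgroup[OF subgroup_self])
  have Suc: "H (Suc i) = derived G (H i)" for i by (simp add: H_def)
  have "H (Suc i) \<subseteq> H i" for i
    unfolding Suc by (rule derived_incl[OF subset_refl sg])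
  then have mono: "D (Suc i) \<subseteq> D i" for i
    unfolding D_def by (intro span_mono velocities_mono)
  interpret L: lie_algebra lb by (rule lie_algebra_lb)
  have br: "lb u v \<in> D (Suc i)" if "u \<in> D i" "v \<in> D i" for i u v
  proof -
    have 1: "lb u v \<in> D (Suc i)" if "u \<in> velocities (H i)" "v \<in> velocities (H i)" for u v
      unfolding D_def Suc by (rule velocities_commutator[OF sg that])
    have sub: "subspace (D (Suc i))" by (simp add: D_def)
    have 2: "lb u v \<in> D (Suc i)" if u: "u \<in> velocities (H i)" and v: "v \<in> span (velocities (H i))" for u v
    proof -
      have "span (velocities (H i)) \<subseteq> {v. lb u v \<in> D (Suc i)}"
        using 1[OF u] sub by (intro span_minimal) (auto simp: subspace_def L.br_simps)
      then show ?thesis using v by blast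
    qed
    have "span (velocities (H i)) \<subseteq> {u. \<forall>v\<in>span (velocities (H i)). lb u v \<in> D (Suc i)}"
      using 2 sub by (intro span_minimal) (auto simp: subspace_def L.br_simps)
    then show ?thesis using that unfolding D_def by blast
  qed
  have "D 0 = UNIV" by (simp add: D_def H_def velocities_UNIV)
  moreover have "D n = {0}"
  proof -
    have "velocities (H n) \<subseteq> {0}" unfolding H_def n by (rule velocities_one)
    then have "span (velocities (H n)) \<subseteq> {0}" by (rule span_minimal) (simp add: subspace_def)
    then show ?thesis unfolding D_def using span_0 by blast
  qed
  ultimately show ?thesis using that mono br by (simp add: D_def)
qed

end


section \<open>Lie's theorem\<close>

text \<open>The complexification of a real vector space \<open>'v\<close> is \<open>'v \<times> 'v\<close>, the pair \<open>(x, y)\<close> standing for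
  \<open>x + i y\<close>.\<close>

definition csc :: "complex \<Rightarrow> 'v::real_vector \<times> 'v \<Rightarrow> 'v \<times> 'v" where
  "csc c z = (Re c *\<^sub>R fst z - Im c *\<^sub>R snd z, Im c *\<^sub>R fst z + Re c *\<^sub>R snd z)"

lemma csc_simps:
  "csc c (z + w) = csc c z + csc c w" "csc (c + d) z = csc c z + csc d z" "csc c (csc d z) = csc (c * d) z"
  "csc 0 z = 0" "csc 1 z = z" "csc c 0 = 0" "csc c (z - w) = csc c z - csc c w" "csc (c - d) z = csc c z - csc d z"
  "csc (- c) z = - csc c z" "csc (complex_of_real r) z = r *\<^sub>R z"
  by (auto simp: csc_def prod_eq_iff algebra_simps)

lemma csc_eq_0: "csc c z = 0 \<longleftrightarrow> c = 0 \<or> z = 0"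
proof
  assume *: "csc c z = 0"
  show "c = 0 \<or> z = 0"
  proof (cases "c = 0")
    case False
    have "csc (inverse c) (csc c z) = 0" using * by (simp add: csc_simps)
    then show ?thesis using False by (simp add: csc_simps)
  qed simp
qed (auto simp: csc_simps)

definition cmap :: "('v \<Rightarrow> 'w) \<Rightarrow> 'v \<times> 'v \<Rightarrow> 'w \<times> 'w" where
  "cmap T z = (T (fst z), T (snd z))"

lemma cmap_simps:
  assumes "linear T"
  shows "cmap T (z + w) = cmap T z + cmap T w" "cmap T (z - w) = cmap T z - cmap T w"
    "cmap T (csc c z) = csc c (cmap T z)" "cmap T 0 = 0"
  using assms by (auto simp: cmap_def csc_def prod_eq_iff linear_add linear_diff linear_scale linear_0)

lemma cmap_eigen:
  "cmap T (x, y) = csc c (x, y) \<longleftrightarrow> T x = Re c *\<^sub>R x - Im c *\<^sub>R y \<and> T y = Im c *\<^sub>R x + Re c *\<^sub>R y"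
  by (auto simp: cmap_def csc_def)

text \<open>Horner evaluation of the polynomial \<open>p\<close> at the operator \<open>L\<close>,
  applied to \<open>z\<close>, with the complex scalars acting through \<open>csc\<close>.\<close>

definition pev :: "('v::real_vector \<times> 'v \<Rightarrow> 'v \<times> 'v) \<Rightarrow> complex poly \<Rightarrow> 'v \<times> 'v \<Rightarrow> 'v \<times> 'v" where
  "pev L p z = fold_coeffs (\<lambda>a acc. csc a z + L acc) p 0"

locale clinear =
  fixes L :: "'v::real_vector \<times> 'v \<Rightarrow> 'v \<times> 'v"
  assumes add: "L (z + w) = L z + L w" and scale: "L (csc c z) = csc c (L z)"
begin

lemma zero [simp]: "L 0 = 0"
  using scale[of 0 0] by (simp add: csc_simps)

lemma pev_0 [simp]: "pev L 0 z = 0"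
  by (simp add: pev_def)

lemma pev_pCons [simp]: "pev L (pCons a p) z = csc a z + L (pev L p z)"
  by (cases "p = 0 \<and> a = 0") (auto simp: pev_def csc_simps)

lemma pev_add: "pev L (p + q) z = pev L p z + pev L q z"
proof (induction p arbitrary: q)
  case (pCons a p)
  obtain b q' where "q = pCons b q'" by (rule pCons_cases)
  then show ?case by (simp add: pCons.IH csc_simps add algebra_simps)
qed simp

lemma pev_smult: "pev L (smult c p) z = csc c (pev L p z)"
  by (induction p) (auto simp: csc_simps scale)

lemma pev_diff: "pev L (p - q) z = pev L p z - pev L q z"
  using pev_add[of "p - q" q z] by simp

lemma pev_factor: "pev L ([:-c, 1:] * q) z = L (pev L q z) - csc c (pev L q z)"
  by (simp add: pev_add pev_diff pev_smult csc_simps)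

lemma pev_closed:
  assumes "subspace E" "\<And>z c. z \<in> E \<Longrightarrow> csc c z \<in> E" "\<And>z. z \<in> E \<Longrightarrow> L z \<in> E" "z \<in> E"
  shows "pev L p z \<in> E"
  by (induction p) (auto intro: subspace_add assms subspace_0)

end

lemma clinear_cmap: "linear T \<Longrightarrow> clinear (cmap T)"
  by unfold_locales (auto simp: cmap_simps)

text \<open>The powers of the operator applied to \<open>z\<close> are linearly dependent already
  over the reals, since the complexification has real dimension \<open>?N\<close>.\<close>

lemma minimal_annihilator:
  fixes T :: "'v::euclidean_space \<Rightarrow> 'v"
  assumes T: "linear T" and z: "z \<noteq> 0"
  obtains p where "p \<noteq> 0" "pev (cmap T) p z = 0" "degree p > 0"
    "\<And>q. pev (cmap T) q z = 0 \<Longrightarrow> degree q < degree p \<Longrightarrow> q = 0"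
proof -
  interpret clinear "cmap T" by (rule clinear_cmap[OF T])
  let ?N = "DIM('v \<times> 'v)"
  let ?Z = "\<lambda>i. (cmap T ^^ i) z"
  have pm: "pev (cmap T) (monom c i) z = csc c (?Z i)" for c i
    by (induction i) (auto simp: monom_Suc scale csc_simps monom_0)
  have ps: "pev (cmap T) (\<Sum>i\<in>I. f i) z = (\<Sum>i\<in>I. pev (cmap T) (f i) z)" for f and I :: "nat set"
    by (induction I rule: infinite_finite_induct) (auto simp: pev_add)
  have "\<exists>p. p \<noteq> 0 \<and> pev (cmap T) p z = 0"
  \<comment> \<open>Coinciding powers are a case of their own: \<open>dependent\<close> concerns the
    set of powers, which then has fewer elements.\<close>
  proof (cases "inj_on ?Z {..?N}")
    case False
    then obtain i j where ij: "i \<noteq> j" "?Z i = ?Z j" by (auto simp: inj_on_def)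
    have "monom 1 i + monom (-1) j \<noteq> (0 :: complex poly)"
    proof
      assume "monom 1 i + monom (-1) j = (0 :: complex poly)"
      from arg_cong[OF this, of "\<lambda>p. coeff p i"] ij show False by simp
    qed
    then show ?thesis using ij by (intro exI[of _ "monom 1 i + monom (-1) j"]) (auto simp: pev_add pm csc_simps)
  next
    case True
    then have "card (?Z ` {..?N}) = Suc ?N" by (simp add: card_image)
    then have "dependent (?Z ` {..?N})" using independent_bound[of "?Z ` {..?N}"] by auto
    then obtain r where r: "(\<Sum>v\<in>?Z ` {..?N}. r v *\<^sub>R v) = 0" "\<exists>v\<in>?Z ` {..?N}. r v \<noteq> 0"
      using dependent_finite[of "?Z ` {..?N}"] by auto
    let ?p = "\<Sum>i\<le>?N. monom (complex_of_real (r (?Z i))) i"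
    have c: "coeff ?p k = (if k \<le> ?N then complex_of_real (r (?Z k)) else 0)" for k
      by (simp add: coeff_sum)
    obtain k where "k \<le> ?N" "r (?Z k) \<noteq> 0" using r(2) by auto
    then have "coeff ?p k \<noteq> 0" unfolding c by simp
    then have "?p \<noteq> 0" by (metis coeff_0)
    moreover have "pev (cmap T) ?p z = 0"
      using r(1) unfolding sum.reindex[OF True] by (simp only: ps pm csc_simps comp_def)
    ultimately show ?thesis by blast
  qed
  then obtain p where p: "p \<noteq> 0 \<and> pev (cmap T) p z = 0"
    "\<And>q. q \<noteq> 0 \<and> pev (cmap T) q z = 0 \<Longrightarrow> degree p \<le> degree q"
    using ex_has_least_nat[of "\<lambda>p. p \<noteq> 0 \<and> pev (cmap T) p z = 0" _ degree] by blast
  have "degree p > 0"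
  proof (rule ccontr)
    assume "\<not> degree p > 0"
    then obtain a where "p = [:a:]" using degree_eq_zeroE by blast
    then show False using p(1) z by (auto simp: csc_eq_0)
  qed
  then show ?thesis using that p by (meson not_less)
qed

text \<open>Split off a root \<open>c\<close> of the minimal annihilator. The quotient has smaller
  degree, so it does not kill \<open>z\<close>, and its value at \<open>z\<close> is an eigenvector
  inside \<open>E\<close>.\<close>

lemma eigenvector_exists:
  fixes T :: "'v::euclidean_space \<Rightarrow> 'v"
  assumes T: "linear T" and E: "subspace E" "\<And>z c. z \<in> E \<Longrightarrow> csc c z \<in> E" "\<And>z. z \<in> E \<Longrightarrow> cmap T z \<in> E"
    and z: "z \<in> E" "z \<noteq> 0"
  obtains w c where "w \<in> E" "w \<noteq> 0" "cmap T w = csc c w"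
proof -
  interpret clinear "cmap T" by (rule clinear_cmap[OF T])
  obtain p where p: "p \<noteq> 0" "pev (cmap T) p z = 0" "degree p > 0"
    "\<And>q. pev (cmap T) q z = 0 \<Longrightarrow> degree q < degree p \<Longrightarrow> q = 0"
    using minimal_annihilator[OF T z(2)] by blast
  obtain c where "poly p c = 0"
    using fundamental_theorem_of_algebra[of p] p(3) by (auto simp: constant_degree)
  then obtain q where q: "p = [:-c, 1:] * q" by (auto simp: poly_eq_0_iff_dvd)
  have "q \<noteq> 0" using p(1) q by auto
  then have "degree q < degree p" unfolding q by (subst degree_mult_eq) auto
  then have "pev (cmap T) q z \<noteq> 0" using p(4) \<open>q \<noteq> 0\<close> by blast
  moreover have "cmap T (pev (cmap T) q z) = csc c (pev (cmap T) q z)"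
    using p(2) unfolding q pev_factor by simp
  moreover have "pev (cmap T) q z \<in> E" by (rule pev_closed[OF E z(1)])
  ultimately show ?thesis using that by blast
qed

text \<open>The operators are linear on the whole space but form a representation on
  \<open>W\<close> only. Quotient modules can thus be realised on complements within the same
  type.\<close>

definition lie_module ::
  "('g::real_vector \<Rightarrow> 'g \<Rightarrow> 'g) \<Rightarrow> ('g \<Rightarrow> 'v::real_vector \<Rightarrow> 'v) \<Rightarrow> 'v set \<Rightarrow> bool" where
  "lie_module br \<rho> W \<longleftrightarrow> subspace W \<and> (\<forall>x. linear (\<rho> x)) \<and> (\<forall>w. linear (\<lambda>x. \<rho> x w)) \<and>
     (\<forall>x. \<forall>w\<in>W. \<rho> x w \<in> W) \<and>
     (\<forall>x y. \<forall>w\<in>W. \<rho> (br x y) w = \<rho> x (\<rho> y w) - \<rho> y (\<rho> x w))"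

text \<open>One generator is added per step, and bracketing with it preserves the previous space.
  This is the form of solvability that the induction in Lie's theorem consumes.\<close>

inductive solvable_chain :: "('g::real_vector \<Rightarrow> 'g \<Rightarrow> 'g) \<Rightarrow> 'g set \<Rightarrow> bool" for br where
  zero: "solvable_chain br {0}"
| insert: "solvable_chain br K \<Longrightarrow> (\<And>y. y \<in> K \<Longrightarrow> br y x \<in> K) \<Longrightarrow> solvable_chain br (span (insert x K))"

lemma solvable_chain_subspace: "solvable_chain br K \<Longrightarrow> subspace K"
proof (induction rule: solvable_chain.induct)
  case zero
  then show ?case by (simp add: subspace_def)
next
  case (insert K x)
  show ?case by (rule subspace_span)
qed

text \<open>On the Krylov space of \<open>z\<close> under \<open>T\<close>, the operator \<open>\<rho> y\<close> minus its eigenvalue acts modulo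
  lower degrees as the derivative of polynomials, times the eigenvalue of \<open>br y x\<close>.\<close>

lemma weight_derivation:
  fixes \<rho> :: "'g::real_vector \<Rightarrow> 'v::euclidean_space \<Rightarrow> 'v"
  assumes lin: "\<And>y. linear (\<rho> y)"
    and com: "\<And>y w. y \<in> K \<Longrightarrow> w \<in> E \<Longrightarrow> cmap (\<rho> y) (cmap (\<rho> x) w) = cmap (\<rho> x) (cmap (\<rho> y) w) + cmap (\<rho> (br y x)) w"
    and K: "\<And>y. y \<in> K \<Longrightarrow> br y x \<in> K"
    and E: "subspace E" "\<And>z c. z \<in> E \<Longrightarrow> csc c z \<in> E" "\<And>z. z \<in> E \<Longrightarrow> cmap (\<rho> x) z \<in> E"
    and z: "z \<in> E" "\<And>y. y \<in> K \<Longrightarrow> cmap (\<rho> y) z = csc (l y) z"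
  shows "y \<in> K \<Longrightarrow> \<exists>r. (\<forall>i. degree p \<le> i + 1 \<longrightarrow> coeff r i = 0) \<and>
     cmap (\<rho> y) (pev (cmap (\<rho> x)) p z) = csc (l y) (pev (cmap (\<rho> x)) p z)
       + pev (cmap (\<rho> x)) (smult (l (br y x)) (pderiv p) + r) z"
proof (induction p arbitrary: y)
  case 0
  then show ?case using cmap_simps(4)[OF lin] by (intro exI[of _ 0]) (simp add: pev_def csc_simps)
next
  case (pCons a p)
  interpret clinear "cmap (\<rho> x)" by (rule clinear_cmap[OF lin])
  let ?P = "\<lambda>p. pev (cmap (\<rho> x)) p z" and ?b = "br y x"
  obtain r where r: "\<forall>i. degree p \<le> i + 1 \<longrightarrow> coeff r i = 0"
    "cmap (\<rho> y) (?P p) = csc (l y) (?P p) + ?P (smult (l ?b) (pderiv p) + r)"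
    using pCons.IH[OF pCons.prems] by blast
  obtain r2 where r2: "\<forall>i. degree p \<le> i + 1 \<longrightarrow> coeff r2 i = 0"
    "cmap (\<rho> ?b) (?P p) = csc (l ?b) (?P p) + ?P (smult (l (br ?b x)) (pderiv p) + r2)"
    using pCons.IH[OF K[OF pCons.prems]] by blast
  \<comment> \<open>The first part is the old remainder moved up by one power; the rest comes from
    commuting \<open>\<rho> y\<close> past \<open>\<rho> x\<close> and using the induction
    hypothesis for \<open>br y x\<close>. All of it stays at least two degrees below the new
    polynomial.\<close>
  let ?r = "pCons 0 r + (smult (l (br ?b x)) (pderiv p) + r2)"
  have "cmap (\<rho> y) (?P (pCons a p)) = csc a (csc (l y) z) + cmap (\<rho> y) (cmap (\<rho> x) (?P p))"
    using z pCons.prems by (simp add: cmap_simps[OF lin])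
  also have "cmap (\<rho> y) (cmap (\<rho> x) (?P p)) = cmap (\<rho> x) (cmap (\<rho> y) (?P p)) + cmap (\<rho> ?b) (?P p)"
    by (rule com[OF pCons.prems pev_closed[OF E z(1)]])
  also have "csc a (csc (l y) z) + \<dots> = csc (l y) (?P (pCons a p))
      + ?P (smult (l ?b) (pderiv (pCons a p)) + ?r)"
    unfolding r(2) r2(2)
    by (simp add: pderiv_pCons pev_add pev_smult add scale csc_simps algebra_simps)
  finally have "cmap (\<rho> y) (?P (pCons a p)) = csc (l y) (?P (pCons a p))
      + ?P (smult (l ?b) (pderiv (pCons a p)) + ?r)" .
  moreover have "\<forall>i. degree (pCons a p) \<le> i + 1 \<longrightarrow> coeff ?r i = 0"
  proof (intro allI impI)
    fix i assume i: "degree (pCons a p) \<le> i + 1"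
    show "coeff ?r i = 0"
    proof (cases "p = 0")
      case True
      then show ?thesis using r(1) r2(1) by (simp add: coeff_pCons split: nat.split)
    next
      case False
      then have "degree p \<le> i" using i by simp
      moreover then have "coeff p (Suc i) = 0" by (intro coeff_eq_0) simp
      ultimately show ?thesis using r(1) r2(1) by (simp add: coeff_pCons coeff_pderiv split: nat.split)
    qed
  qed
  ultimately show ?case by blast
qed

text \<open>The joint weight space of \<open>K\<close> is invariant under the next generator because
  its weights vanish on brackets with that generator; a further eigenvector inside it is then common
  to all.\<close>

lemma lie_theorem:
  fixes \<rho> :: "'g::real_vector \<Rightarrow> 'v::euclidean_space \<Rightarrow> 'v"
  assumes "solvable_chain br K" and mod: "lie_module br \<rho> W" and w0: "w0 \<in> W" "w0 \<noteq> 0"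
  shows "\<exists>l z. z \<in> W \<times> W \<and> z \<noteq> 0 \<and> (\<forall>y\<in>K. cmap (\<rho> y) z = csc (l y) z)"
  using assms(1)
proof (induction rule: solvable_chain.induct)
  case zero
  have "\<rho> 0 w0 = 0" using mod linear_0[of "\<lambda>x. \<rho> x w0"] by (simp add: lie_module_def)
  moreover have "\<rho> 0 0 = 0" using mod linear_0[of "\<rho> 0"] by (simp add: lie_module_def)
  ultimately show ?case using w0 mod
    by (intro exI[of _ "\<lambda>_. 0"] exI[of _ "(w0, 0)"]) (auto simp: cmap_def csc_simps zero_prod_def lie_module_def subspace_0)
next
  case (insert K x)
  have lin: "linear (\<rho> y)" and lin2: "linear (\<lambda>y. \<rho> y w)" for y w using mod by (auto simp: lie_module_def)
  have W: "subspace W" using mod by (simp add: lie_module_def)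
  obtain l z0 where z0: "z0 \<in> W \<times> W" "z0 \<noteq> 0" "\<And>y. y \<in> K \<Longrightarrow> cmap (\<rho> y) z0 = csc (l y) z0"
    using insert.IH by blast
  define E where "E = {z \<in> W \<times> W. \<forall>y\<in>K. cmap (\<rho> y) z = csc (l y) z}"
  have WW: "subspace (W \<times> W)" "\<And>z c. z \<in> W \<times> W \<Longrightarrow> csc c z \<in> W \<times> W" "\<And>z y. z \<in> W \<times> W \<Longrightarrow> cmap (\<rho> y) z \<in> W \<times> W"
    using W mod by (auto simp: subspace_Times csc_def cmap_def subspace_diff subspace_add subspace_scale lie_module_def)
  have com: "cmap (\<rho> y) (cmap (\<rho> x) w) = cmap (\<rho> x) (cmap (\<rho> y) w) + cmap (\<rho> (br y x)) w"
    if "w \<in> W \<times> W" for y w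
    using mod that by (auto simp: cmap_def lie_module_def)
  have l0: "l (br y x) = 0" if y: "y \<in> K" and z: "z \<in> E" "z \<noteq> 0" for y z
  proof -
    interpret clinear "cmap (\<rho> x)" by (rule clinear_cmap[OF lin])
    obtain p where p: "p \<noteq> 0" "pev (cmap (\<rho> x)) p z = 0" "degree p > 0"
      "\<And>q. pev (cmap (\<rho> x)) q z = 0 \<Longrightarrow> degree q < degree p \<Longrightarrow> q = 0"
      using minimal_annihilator[OF lin z(2)] by blast
    obtain r where r: "\<forall>i. degree p \<le> i + 1 \<longrightarrow> coeff r i = 0"
      "cmap (\<rho> y) (pev (cmap (\<rho> x)) p z) = csc (l y) (pev (cmap (\<rho> x)) p z)
       + pev (cmap (\<rho> x)) (smult (l (br y x)) (pderiv p) + r) z"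
      using weight_derivation[where \<rho>=\<rho> and br=br and x=x and K=K and E="W \<times> W" and z=z and l=l and y=y and p=p,
          OF lin com insert.hyps(2) WW] z y unfolding E_def by blast
    \<comment> \<open>\<open>\<rho> y\<close> minus its eigenvalue sends \<open>p(T) z = 0\<close>
      to \<open>?q(T) z\<close>, where \<open>T\<close> is \<open>cmap (\<rho> x)\<close>. So
      \<open>?q\<close> annihilates \<open>z\<close> with smaller degree and must vanish.\<close>
    let ?q = "smult (l (br y x)) (pderiv p) + r"
    have "pev (cmap (\<rho> x)) ?q z = 0"
      using r(2) unfolding p(2) by (simp add: cmap_simps[OF lin] csc_simps)
    moreover have "degree ?q < degree p"
    proof -
      have "coeff ?q i = 0" if "i \<ge> degree p" for i
        using r(1) that by (simp add: coeff_pderiv coeff_eq_0)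
      then show ?thesis using p(3) by (metis degree_lessI)
    qed
    ultimately have "?q = 0" by (rule p(4))
    \<comment> \<open>The remainder \<open>r\<close> does not reach this coefficient. What is left
      is the derivative of the leading term, and the degree is invertible in characteristic
      0.\<close>
    from arg_cong[OF this, of "\<lambda>q. coeff q (degree p - 1)"]
    have "l (br y x) * (of_nat (degree p) * lead_coeff p) = 0"
      using r(1) p(3) by (simp add: coeff_pderiv)
    then show ?thesis using p by simp
  qed
  have E2: "csc c z \<in> E" if "z \<in> E" for z c
    using that WW(2) by (simp add: E_def cmap_simps[OF lin] csc_simps mult.commute)
  have E1: "subspace E"
  proof (rule subspaceI)
    show "0 \<in> E" using subspace_0[OF WW(1)] by (simp add: E_def cmap_simps[OF lin] csc_simps)
    show "u + v \<in> E" if "u \<in> E" "v \<in> E" for u v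
      using that subspace_add[OF WW(1)] by (simp add: E_def cmap_simps[OF lin] csc_simps)
    show "r *\<^sub>R u \<in> E" if "u \<in> E" for u r
      using E2[OF that, of "complex_of_real r"] by (simp add: csc_simps)
  qed
  note E = E1 E2
  have Ex: "cmap (\<rho> x) z \<in> E" if z: "z \<in> E" for z
  proof (cases "z = 0")
    case True then show ?thesis using cmap_simps(4)[OF lin] subspace_0[OF E(1)] by simp
  next
    case False
    have "cmap (\<rho> y) (cmap (\<rho> x) z) = csc (l y) (cmap (\<rho> x) z)" if y: "y \<in> K" for y
    proof -
      have "cmap (\<rho> (br y x)) z = csc (l (br y x)) z" using z insert.hyps(2)[OF y] by (simp add: E_def)
      then have "cmap (\<rho> (br y x)) z = 0" using l0[OF y z False] by (simp add: csc_simps)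
      then show ?thesis using com[of z y] z y by (simp add: E_def cmap_simps[OF lin])
    qed
    then show ?thesis using z WW(3) by (simp add: E_def)
  qed
  have "z0 \<in> E" using z0 by (simp add: E_def)
  then obtain w c where w: "w \<in> E" "w \<noteq> 0" "cmap (\<rho> x) w = csc c w"
    using eigenvector_exists[OF lin E Ex _ z0(2)] by blast
  have "\<exists>d. cmap (\<rho> v) w = csc d w" if v: "v \<in> span (insert x K)" for v
  proof -
    obtain t where "v - t *\<^sub>R x \<in> span K" using v span_breakdown_eq by blast
    then have k: "v - t *\<^sub>R x \<in> K" using solvable_chain_subspace[OF insert.hyps(1)] by (metis span_eq_iff)
    have "\<rho> v u = \<rho> (v - t *\<^sub>R x) u + t *\<^sub>R \<rho> x u" for u
      by (simp add: linear_diff[OF lin2] linear_scale[OF lin2])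
    then have "cmap (\<rho> v) w = cmap (\<rho> (v - t *\<^sub>R x)) w + t *\<^sub>R cmap (\<rho> x) w"
      by (simp add: cmap_def)
    also have "\<dots> = csc (l (v - t *\<^sub>R x) + complex_of_real t * c) w"
      using w k by (simp add: E_def csc_simps csc_simps(10)[symmetric])
    finally show ?thesis by blast
  qed
  then obtain l' where "\<And>v. v \<in> span (insert x K) \<Longrightarrow> cmap (\<rho> v) w = csc (l' v) w" by metis
  then show ?case using w by (intro exI[of _ l'] exI[of _ w]) (auto simp: E_def)
qed


section \<open>Block triangular bases\<close>

text \<open>A basis \<open>F\<close> of \<open>W\<close>, filtered by the level \<open>lv\<close>, in which the operators \<open>\<rho> x\<close> are block triangular.
  The involution \<open>\<pi>\<close> pairs the two vectors of a block of size 2 and fixes a block of size 1; the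
  block of \<open>f\<close> carries the weights \<open>a f \<plusminus> i b f\<close>.\<close>

definition block_flag ::
  "('g::real_vector \<Rightarrow> 'g \<Rightarrow> 'g) \<Rightarrow> ('g \<Rightarrow> 'v::real_vector \<Rightarrow> 'v) \<Rightarrow> 'v set \<Rightarrow>
   'v set \<Rightarrow> ('v \<Rightarrow> nat) \<Rightarrow> ('v \<Rightarrow> 'v) \<Rightarrow> ('v \<Rightarrow> 'g \<Rightarrow> real) \<Rightarrow> ('v \<Rightarrow> 'g \<Rightarrow> real) \<Rightarrow> bool" where
  "block_flag br \<rho> W F lv \<pi> a b \<longleftrightarrow>
     finite F \<and> independent F \<and> span F = W \<and>
     (\<forall>f\<in>F. \<pi> f \<in> F \<and> \<pi> (\<pi> f) = f \<and> lv (\<pi> f) = lv f \<and> (\<forall>x. a (\<pi> f) x = a f x \<and> b (\<pi> f) x = - b f x)) \<and>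
     (\<forall>f\<in>F. \<forall>x. \<rho> x f - a f x *\<^sub>R f - b f x *\<^sub>R \<pi> f \<in> span {e \<in> F. lv e < lv f}) \<and>
     (\<forall>f\<in>F. linear (a f) \<and> linear (b f) \<and> (\<forall>x y. a f (br x y) = 0 \<and> b f (br x y) = 0))"

text \<open>Real and imaginary part of a common complex eigenvector span an invariant plane, or a
  line if they are dependent.\<close>

lemma invariant_block:
  fixes \<rho> :: "'g::real_vector \<Rightarrow> 'v::euclidean_space \<Rightarrow> 'v"
  assumes sol: "solvable_chain br UNIV" and mod: "lie_module br \<rho> W" and w0: "w0 \<in> W" "w0 \<noteq> 0"
  obtains F \<pi> \<alpha> b where "F \<noteq> {}" "F \<subseteq> W" "independent F"
    "\<And>f. f \<in> F \<Longrightarrow> \<pi> f \<in> F \<and> \<pi> (\<pi> f) = f \<and> (\<forall>x. b (\<pi> f) x = - b f x)"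
    "\<And>f x. f \<in> F \<Longrightarrow> \<rho> x f = \<alpha> x *\<^sub>R f + b f x *\<^sub>R \<pi> f"
    "linear \<alpha>" "\<And>f. f \<in> F \<Longrightarrow> linear (b f)" "\<And>x y. \<alpha> (br x y) = 0" "\<And>f x y. f \<in> F \<Longrightarrow> b f (br x y) = 0"
proof -
  have lin: "linear (\<rho> y)" and lin2: "linear (\<lambda>y. \<rho> y w)" for y w using mod by (auto simp: lie_module_def)
  obtain l z where z: "z \<in> W \<times> W" "z \<noteq> 0" "\<And>y. cmap (\<rho> y) z = csc (l y) z"
    using lie_theorem[OF sol mod w0] by blast
  have eq: "c = d" if "csc c z = csc d z" for c d
  proof -
    have "csc (c - d) z = 0" using that by (simp add: csc_simps)
    then show ?thesis using z(2) by (simp add: csc_eq_0)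
  qed
  have l_add: "l (x + y) = l x + l y" for x y
  proof (rule eq)
    have "csc (l (x + y)) z = cmap (\<rho> x) z + cmap (\<rho> y) z"
      unfolding z(3)[symmetric] by (simp add: cmap_def linear_add[OF lin2])
    then show "csc (l (x + y)) z = csc (l x + l y) z" by (simp add: z(3) csc_simps)
  qed
  have l_scale: "l (r *\<^sub>R x) = complex_of_real r * l x" for r x
  proof (rule eq)
    have "csc (l (r *\<^sub>R x)) z = r *\<^sub>R cmap (\<rho> x) z"
      unfolding z(3)[symmetric] by (simp add: cmap_def linear_scale[OF lin2])
    then show "csc (l (r *\<^sub>R x)) z = csc (complex_of_real r * l x) z"
      by (simp add: z(3) csc_simps(3)[symmetric] csc_simps(10))
  qed
  have l_br: "l (br x y) = 0" for x y
  proof (rule eq)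
    have "csc (l (br x y)) z = cmap (\<rho> x) (cmap (\<rho> y) z) - cmap (\<rho> y) (cmap (\<rho> x) z)"
      unfolding z(3)[symmetric, of "br x y"] using mod z(1) by (auto simp: cmap_def lie_module_def)
    then show "csc (l (br x y)) z = csc 0 z" by (simp add: z(3) cmap_simps[OF lin] csc_simps mult.commute)
  qed
  define \<alpha> \<beta> where "\<alpha> = (\<lambda>y. Re (l y))" and "\<beta> = (\<lambda>y. Im (l y))"
  have ab: "linear \<alpha>" "linear \<beta>" "\<And>x y. \<alpha> (br x y) = 0" "\<And>x y. \<beta> (br x y) = 0"
    by (auto simp: \<alpha>_def \<beta>_def l_add l_scale l_br intro!: linearI)
  obtain p q where pq: "z = (p, q)" "p \<in> W" "q \<in> W" using z(1) by blast
  have r: "\<rho> y p = \<alpha> y *\<^sub>R p - \<beta> y *\<^sub>R q" "\<rho> y q = \<beta> y *\<^sub>R p + \<alpha> y *\<^sub>R q" for y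
    using z(3)[of y] unfolding pq(1) cmap_eigen by (simp_all add: \<alpha>_def \<beta>_def)
  have W: "subspace W" using mod by (simp add: lie_module_def)
  show ?thesis
  proof (cases "p \<noteq> 0 \<and> q \<notin> span {p}")
    case True
    then have q0: "q \<noteq> 0" using span_0 by metis
    have ne: "p \<noteq> - q"
      using True span_neg[of "-q" "{p}"] span_base[of p "{p}"] by auto
    have nq: "- q \<notin> span {p}" using True span_neg[of "-q" "{p}"] by auto
    have ind: "independent {- q, p}"
      using True by (intro independent_insertI[OF nq]) (simp add: dependent_single)
    \<comment> \<open>The basis is \<open>- q, p\<close> instead of \<open>p, q\<close> because then
      both vectors satisfy the same formula, with opposite signs of \<open>b\<close>.\<close>
    define \<pi> where "\<pi> f = (if f = p then - q else p)" for f
    define b where "b f x = (if f = p then \<beta> x else - \<beta> x)" for f x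
    show ?thesis
    proof (rule that[of "{- q, p}" \<pi> b \<alpha>])
      show "{- q, p} \<subseteq> W" using pq subspace_neg[OF W] by auto
      show "linear (b f)" for f unfolding b_def using ab(2) by (cases "f = p") (auto simp: linear_compose_neg)
    qed (use ne ind ab r in \<open>auto simp: \<pi>_def b_def linear_neg[OF lin]\<close>)
  next
    case False
    obtain u where u: "u \<noteq> 0" "u \<in> W" "\<And>y. \<rho> y u = \<alpha> y *\<^sub>R u"
    proof (cases "p = 0")
      case True
      then have "q \<noteq> 0" using z(2) pq(1) by (auto simp: zero_prod_def)
      moreover have "\<rho> y q = \<alpha> y *\<^sub>R q" for y using r(2)[of y] True by simp
      ultimately show ?thesis using that pq by blast
    next
      case p0: False
      then obtain t where t: "q = t *\<^sub>R p" using False by (auto simp: span_singleton)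
      have "\<rho> y p = \<alpha> y *\<^sub>R p" for y
      proof -
        \<comment> \<open>With \<open>q = t *\<^sub>R p\<close> both parts of the eigenvalue
          equation describe \<open>\<rho> y q\<close>; comparing them leaves
          \<open>\<beta> y * (1 + t * t) = 0\<close>, so the weight is real.\<close>
        have "t *\<^sub>R (\<alpha> y *\<^sub>R p - \<beta> y *\<^sub>R q) = \<beta> y *\<^sub>R p + \<alpha> y *\<^sub>R q"
          using r[of y] linear_scale[OF lin, of y t p] t by metis
        then have "(\<beta> y * (1 + t * t)) *\<^sub>R p = 0" unfolding t by (simp add: algebra_simps)
        moreover have "1 + t * t \<noteq> 0" by (smt (verit) zero_le_square)
        ultimately have "\<beta> y = 0" using p0 by simp
        then show ?thesis using r(1) by simp
      qed
      then show ?thesis using that p0 pq by blast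
    qed
    show ?thesis
    proof (rule that[of "{u}" "\<lambda>f. f" "\<lambda>f x. 0" \<alpha>])
      show "linear (\<lambda>x::'g. 0::real)" by (simp add: linear_zero)
    qed (use u ab in \<open>auto simp: dependent_single\<close>)
  qed
qed

text \<open>Induction on the dimension: split off an invariant block \<open>F0\<close> and treat the
  quotient by its span, realised on the complement \<open>W'\<close> by following
  \<open>\<rho> x\<close> with the projection \<open>P\<close> along \<open>F0\<close>.\<close>

lemma block_flag_exists:
  fixes \<rho> :: "'g::real_vector \<Rightarrow> 'v::euclidean_space \<Rightarrow> 'v"
  assumes sol: "solvable_chain br UNIV"
  shows "lie_module br \<rho> W \<Longrightarrow> \<exists>F lv \<pi> a b. block_flag br \<rho> W F lv \<pi> a b"
proof (induction "dim W" arbitrary: W \<rho> rule: less_induct)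
  case (less W \<rho>)
  note mod = less.prems
  have W: "subspace W" and lin: "\<And>x. linear (\<rho> x)" and inv: "\<And>x w. w \<in> W \<Longrightarrow> \<rho> x w \<in> W"
    and lin2: "\<And>w. linear (\<lambda>x. \<rho> x w)"
    and com: "\<And>x y w. w \<in> W \<Longrightarrow> \<rho> (br x y) w = \<rho> x (\<rho> y w) - \<rho> y (\<rho> x w)"
    using mod by (auto simp: lie_module_def)
  show ?case
  proof (cases "W = {0}")
    case True
    then have "block_flag br \<rho> W {} (\<lambda>_. 0) (\<lambda>f. f) (\<lambda>_ _. 0) (\<lambda>_ _. 0)"
      by (simp add: block_flag_def independent_empty)
    then show ?thesis by blast
  next
    case False
    then obtain w0 where w0: "w0 \<in> W" "w0 \<noteq> 0" using subspace_0[OF W] by blast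
    obtain F0 \<pi>0 \<alpha> b0 where F0: "F0 \<noteq> {}" "F0 \<subseteq> W" "independent F0"
      and pi0: "\<And>f. f \<in> F0 \<Longrightarrow> \<pi>0 f \<in> F0 \<and> \<pi>0 (\<pi>0 f) = f \<and> (\<forall>x. b0 (\<pi>0 f) x = - b0 f x)"
      and r0: "\<And>f x. f \<in> F0 \<Longrightarrow> \<rho> x f = \<alpha> x *\<^sub>R f + b0 f x *\<^sub>R \<pi>0 f"
      and l0: "linear \<alpha>" "\<And>f. f \<in> F0 \<Longrightarrow> linear (b0 f)" "\<And>x y. \<alpha> (br x y) = 0"
        "\<And>f x y. f \<in> F0 \<Longrightarrow> b0 f (br x y) = 0"
      by (rule invariant_block[OF sol mod w0]) (rule that)
    obtain B where B: "F0 \<subseteq> B" "B \<subseteq> W" "independent B" "W \<subseteq> span B"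
      using maximal_independent_subset_extend[OF F0(2,3)] by blast
    have sB: "span B = W" using B W by (simp add: span_minimal subset_antisym)
    have fB: "finite B" using B(3) independent_bound by blast
    define W' where "W' = span (B - F0)"
    obtain P where P: "linear P" "\<And>x. x \<in> B \<Longrightarrow> P x = (if x \<in> F0 then 0 else x)"
      using linear_independent_extend[OF B(3), of "\<lambda>x. if x \<in> F0 then 0 else x"] by blast
    have P0: "P w = 0" if w: "w \<in> span F0" for w
    proof -
      have "span F0 \<subseteq> {w. P w = 0}"
        using P B(1) by (intro span_minimal) (auto simp: subspace_def linear_add linear_scale linear_0)
      then show ?thesis using w by blast
    qed
    have P1: "P w = w" if w: "w \<in> W'" for w
    proof -
      have "span (B - F0) \<subseteq> {w. P w = w}"
        using P by (intro span_minimal) (auto simp: subspace_def linear_add linear_scale linear_0)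
      then show ?thesis using w W'_def by blast
    qed
    have PW: "P w \<in> W' \<and> w - P w \<in> span F0" if w: "w \<in> W" for w
    proof -
      have "subspace {w. P w \<in> W' \<and> w - P w \<in> span F0}"
      proof (rule subspaceI)
        show "0 \<in> {w. P w \<in> W' \<and> w - P w \<in> span F0}"
          using linear_0[OF P(1)] by (simp add: W'_def span_0)
        show "x + y \<in> {w. P w \<in> W' \<and> w - P w \<in> span F0}"
          if "x \<in> {w. P w \<in> W' \<and> w - P w \<in> span F0}" "y \<in> {w. P w \<in> W' \<and> w - P w \<in> span F0}" for x y
        proof -
          have eq: "x + y - P (x + y) = (x - P x) + (y - P y)" by (simp add: linear_add[OF P(1)])
          have "(x - P x) + (y - P y) \<in> span F0" using that by (intro span_add) auto
          moreover have "P (x + y) \<in> W'" using that by (simp add: linear_add[OF P(1)] W'_def span_add)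
          ultimately show ?thesis by (simp only: mem_Collect_eq eq simp_thms)
        qed
        show "c *\<^sub>R x \<in> {w. P w \<in> W' \<and> w - P w \<in> span F0}" if "x \<in> {w. P w \<in> W' \<and> w - P w \<in> span F0}" for c x
        proof -
          have "c *\<^sub>R x - P (c *\<^sub>R x) = c *\<^sub>R (x - P x)" by (simp add: linear_scale[OF P(1)] scaleR_diff_right)
          then show ?thesis using that by (simp add: linear_scale[OF P(1)] W'_def span_scale)
        qed
      qed
      moreover have "B \<subseteq> {w. P w \<in> W' \<and> w - P w \<in> span F0}"
        using P(2) by (auto simp: W'_def span_0 intro: span_base)
      ultimately have "span B \<subseteq> {w. P w \<in> W' \<and> w - P w \<in> span F0}" by (intro span_minimal)
      then show ?thesis using w sB by blast
    qed
    have W'W: "W' \<subseteq> W" unfolding W'_def using B W by (intro span_minimal) auto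
    have F0inv: "\<rho> x w \<in> span F0" if w: "w \<in> span F0" for x w
    proof -
      have "\<rho> x f \<in> span F0" if "f \<in> F0" for f
        unfolding r0[OF that] using pi0[OF that] that
        by (intro span_add[OF span_scale[OF span_base] span_scale[OF span_base]]) auto
      then have "span F0 \<subseteq> {w. \<rho> x w \<in> span F0}"
        using lin by (intro span_minimal) (auto simp: subspace_def linear_add linear_scale linear_0 span_add span_scale span_0)
      then show ?thesis using w by blast
    qed
    define \<rho>' where "\<rho>' x w = P (\<rho> x w)" for x w
    \<comment> \<open>The projection may be dropped before applying \<open>\<rho> x\<close>, since
      its kernel is invariant; hence the compressed operators again satisfy the bracket
      relation.\<close>
    have PP: "P (\<rho> x (P w)) = P (\<rho> x w)" if w: "w \<in> W" for x w
    proof -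
      have "P (\<rho> x (w - P w)) = 0" using P0 F0inv PW[OF w] by blast
      then show ?thesis by (simp add: linear_diff[OF lin] linear_diff[OF P(1)])
    qed
    have mod': "lie_module br \<rho>' W'"
      unfolding lie_module_def
    proof (intro conjI allI ballI)
      show "subspace W'" by (simp add: W'_def)
      show "linear (\<rho>' x)" for x
        using linear_compose[OF lin P(1)] by (simp add: \<rho>'_def[abs_def] comp_def)
      show "linear (\<lambda>x. \<rho>' x w)" for w
        using linear_compose[OF lin2 P(1)] by (simp add: \<rho>'_def[abs_def] comp_def)
      fix x y w assume w: "w \<in> W'"
      then have wW: "w \<in> W" using W'W by blast
      show "\<rho>' x w \<in> W'" unfolding \<rho>'_def using PW inv wW by blast
      show "\<rho>' (br x y) w = \<rho>' x (\<rho>' y w) - \<rho>' y (\<rho>' x w)"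
        unfolding \<rho>'_def PP[OF inv[OF wW]] com[OF wW] by (simp add: linear_diff[OF P(1)])
    qed
    have dW: "dim W = card B" using B(3) sB dim_span_eq_card_independent by metis
    have dW': "dim W' = card (B - F0)"
      unfolding W'_def using dim_span_eq_card_independent independent_mono[OF B(3)] by (metis Diff_subset)
    have "card (B - F0) < card B" using F0(1) B(1) fB by (intro psubset_card_mono) auto
    then obtain F' lv' \<pi>' a' b' where F': "block_flag br \<rho>' W' F' lv' \<pi>' a' b'"
      using less.hyps[OF _ mod'] dW dW' by metis
    have fF': "finite F'" "independent F'" "span F' = W'" using F' by (auto simp: block_flag_def)
    have fF0: "finite F0" using B(1) fB finite_subset by blast
    have cF': "card F' = card (B - F0)" using fF' dW' dim_span_eq_card_independent by metis
    have sF: "span (F0 \<union> F') = W"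
    proof
      show "span (F0 \<union> F') \<subseteq> W" using F0(2) W'W fF'(3) W span_superset[of F'] by (intro span_minimal) auto
      have "B \<subseteq> span (F0 \<union> F')"
      proof
        fix x assume x: "x \<in> B"
        show "x \<in> span (F0 \<union> F')"
        proof (cases "x \<in> F0")
          case False
          then have "x \<in> span F'" using x fF'(3) by (auto simp: W'_def intro: span_base)
          then show ?thesis using span_mono[of F' "F0 \<union> F'"] by blast
        qed (simp add: span_base)
      qed
      then show "W \<subseteq> span (F0 \<union> F')" using sB by (metis span_minimal subspace_span)
    qed
    have cB: "card F0 + card F' = card B"
      using cF' card_Diff_subset[OF fF0 B(1)] card_mono[OF fB B(1)] by simp
    \<comment> \<open>Disjointness and independence follow by counting: a spanning set of
      \<open>W\<close> has at least \<open>dim W\<close> elements.\<close>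
    have dle: "card B \<le> card (F0 \<union> F')"
      using dim_le_card[of W "F0 \<union> F'"] sF dW fF0 fF'(1) by simp
    have disj: "F0 \<inter> F' = {}"
    proof -
      have "card F0 + card F' = card (F0 \<union> F') + card (F0 \<inter> F')" by (rule card_Un_Int[OF fF0 fF'(1)])
      then have "card (F0 \<inter> F') = 0" using dle cB by simp
      then show ?thesis using fF0 by simp
    qed
    have ind: "independent (F0 \<union> F')"
    proof (rule card_le_dim_spanning[of _ W])
      show "card (F0 \<union> F') \<le> dim W" using card_Un_le[of F0 F'] cB dW by simp
    qed (use sF span_superset[of "F0 \<union> F'"] fF0 fF' in auto)
    \<comment> \<open>The invariant block is the bottom level, and the levels of the quotient move
      up by one.\<close>
    define lv where "lv f = (if f \<in> F0 then 0 else Suc (lv' f))" for f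
    define \<pi> where "\<pi> f = (if f \<in> F0 then \<pi>0 f else \<pi>' f)" for f
    define a where "a f = (if f \<in> F0 then \<alpha> else a' f)" for f
    define b where "b f = (if f \<in> F0 then b0 f else b' f)" for f
    have F'not: "f \<notin> F0" if "f \<in> F'" for f using that disj by blast
    have pi': "\<pi>' f \<in> F' \<and> \<pi>' (\<pi>' f) = f \<and> lv' (\<pi>' f) = lv' f \<and> (\<forall>x. a' (\<pi>' f) x = a' f x \<and> b' (\<pi>' f) x = - b' f x)"
      and sp': "\<And>x. \<rho>' x f - a' f x *\<^sub>R f - b' f x *\<^sub>R \<pi>' f \<in> span {e \<in> F'. lv' e < lv' f}"
      and l': "linear (a' f) \<and> linear (b' f) \<and> (\<forall>x y. a' f (br x y) = 0 \<and> b' f (br x y) = 0)"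
      if "f \<in> F'" for f using F' that unfolding block_flag_def by blast+
    have "block_flag br \<rho> W (F0 \<union> F') lv \<pi> a b"
      unfolding block_flag_def
    proof (intro conjI ballI)
      fix f assume f: "f \<in> F0 \<union> F'"
      show "\<pi> f \<in> F0 \<union> F'" "\<pi> (\<pi> f) = f" "lv (\<pi> f) = lv f"
        "\<forall>x. a (\<pi> f) x = a f x \<and> b (\<pi> f) x = - b f x" "linear (a f)" "linear (b f)"
        "\<forall>x y. a f (br x y) = 0 \<and> b f (br x y) = 0"
        using f pi0 pi' F'not l0 l' unfolding \<pi>_def lv_def a_def b_def by auto
      show "\<forall>x. \<rho> x f - a f x *\<^sub>R f - b f x *\<^sub>R \<pi> f \<in> span {e \<in> F0 \<union> F'. lv e < lv f}"
      proof
        fix x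
        show "\<rho> x f - a f x *\<^sub>R f - b f x *\<^sub>R \<pi> f \<in> span {e \<in> F0 \<union> F'. lv e < lv f}"
        proof (cases "f \<in> F0")
          case True
          then show ?thesis using r0[OF True] by (simp add: a_def b_def \<pi>_def span_0)
        next
          case False
          then have f': "f \<in> F'" using f by blast
          then have fW: "f \<in> W" using W'W fF'(3) span_superset by blast
          have "{e \<in> F'. lv' e < lv' f} \<subseteq> {e \<in> F0 \<union> F'. lv e < lv f}"
            using F'not False by (auto simp: lv_def)
          from subsetD[OF span_mono[OF this] sp'[OF f', of x]]
          have 1: "\<rho>' x f - a' f x *\<^sub>R f - b' f x *\<^sub>R \<pi>' f \<in> span {e \<in> F0 \<union> F'. lv e < lv f}" .
          have F0s: "F0 \<subseteq> {e \<in> F0 \<union> F'. lv e < lv f}" using False by (auto simp: lv_def)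
          have 2: "\<rho> x f - \<rho>' x f \<in> span {e \<in> F0 \<union> F'. lv e < lv f}"
            using subsetD[OF span_mono[OF F0s]] PW[OF inv[OF fW]] by (simp add: \<rho>'_def)
          show ?thesis using span_add[OF 1 2] False by (simp add: a_def b_def \<pi>_def algebra_simps)
        qed
      qed
    qed (use ind sF fF0 fF' in auto)
    then show ?thesis by blast
  qed
qed

section \<open>Spectrum and trace of a single block triangular operator\<close>

locale flagged_operator =
  fixes T :: "'v::euclidean_space \<Rightarrow> 'v" and W F :: "'v set" and lv :: "'v \<Rightarrow> nat" and \<pi> :: "'v \<Rightarrow> 'v"
    and a b :: "'v \<Rightarrow> real"
  assumes T: "linear T" and fin: "finite F" and ind: "independent F" and span: "span F = W"
    and pi: "f \<in> F \<Longrightarrow> \<pi> f \<in> F" "f \<in> F \<Longrightarrow> \<pi> (\<pi> f) = f" "f \<in> F \<Longrightarrow> lv (\<pi> f) = lv f"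
      "f \<in> F \<Longrightarrow> a (\<pi> f) = a f" "f \<in> F \<Longrightarrow> b (\<pi> f) = - b f"
    and tri: "f \<in> F \<Longrightarrow> T f - a f *\<^sub>R f - b f *\<^sub>R \<pi> f \<in> span {e \<in> F. lv e < lv f}"
begin

abbreviation V :: "nat \<Rightarrow> 'v set" where "V l \<equiv> span {e \<in> F. lv e < l}"

lemma V_mono: "l \<le> m \<Longrightarrow> V l \<subseteq> V m"
  by (intro span_mono) auto

lemma V_W: "V l \<subseteq> W"
  unfolding span[symmetric] by (intro span_mono) auto

lemma V_max: obtains l where "V l = W"
proof -
  have "{e \<in> F. lv e < Suc (Max (lv ` F))} = F" using fin by (auto simp: less_Suc_eq_le)
  then show ?thesis using that span by metis
qed

lemma F_V: "f \<in> F \<Longrightarrow> lv f < l \<Longrightarrow> f \<in> V l"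
  by (auto intro: span_base)

lemma T_gen: "f \<in> F \<Longrightarrow> lv f < l \<Longrightarrow> T f \<in> V l"
proof -
  assume f: "f \<in> F" "lv f < l"
  have "T f - a f *\<^sub>R f - b f *\<^sub>R \<pi> f \<in> V l" using tri[OF f(1)] V_mono[of "lv f" l] f(2) by auto
  moreover have "a f *\<^sub>R f + b f *\<^sub>R \<pi> f \<in> V l"
    using f pi by (intro span_add span_scale F_V) auto
  ultimately have "(T f - a f *\<^sub>R f - b f *\<^sub>R \<pi> f) + (a f *\<^sub>R f + b f *\<^sub>R \<pi> f) \<in> V l"
    by (rule span_add)
  then show ?thesis by simp
qed

lemma T_V: "w \<in> V l \<Longrightarrow> T w \<in> V l"
proof -
  have "V l \<subseteq> {w. T w \<in> V l}"
    using T_gen T by (intro span_minimal) (auto simp: subspace_def linear_add linear_scale linear_0 span_add span_scale span_0)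
  then show "w \<in> V l \<Longrightarrow> T w \<in> V l" by blast
qed

lemma F_not_V: "f \<in> F \<Longrightarrow> f \<notin> V (lv f)"
proof
  assume f: "f \<in> F" "f \<in> V (lv f)"
  then have "f \<in> span (F - {f})" using span_mono[of "{e \<in> F. lv e < lv f}" "F - {f}"] by auto
  then show False using f(1) ind by (auto simp: dependent_def)
qed

text \<open>Modulo lower levels \<open>(f, - \<pi> f)\<close> is an eigenvector. If the operator
  minus \<open>?c\<close> is injective on the lower levels it is surjective there, and the error can
  be corrected; otherwise its kernel there already contains an eigenvector.\<close>

lemma weight_is_eigenvalue:
  assumes f: "f \<in> F"
  shows "\<exists>z \<in> W \<times> W. z \<noteq> 0 \<and> cmap T z = csc (Complex (a f) (b f)) z"
proof -
  let ?c = "Complex (a f) (b f)" and ?U = "V (lv f) \<times> V (lv f)"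
  let ?M = "\<lambda>z. cmap T z - csc ?c z"
  have M: "linear ?M"
  proof (rule linearI)
    show "?M (x + y) = ?M x + ?M y" for x y by (simp add: cmap_simps[OF T] csc_simps)
    show "?M (r *\<^sub>R x) = r *\<^sub>R ?M x" for r x
      by (simp add: csc_simps(10)[symmetric] cmap_simps[OF T] csc_simps(3,7) mult.commute)
  qed
  have U: "subspace ?U" by (simp add: subspace_Times)
  have MU: "?M ` ?U \<subseteq> ?U"
    using T_V by (auto simp: cmap_def csc_def intro!: span_diff span_add span_scale)
  show ?thesis
  proof (cases "inj_on ?M ?U")
    case False
    then obtain z where "z \<in> ?U" "z \<noteq> 0" "?M z = 0" using linear_injective_on_subspace_0[OF M U] by blast
    moreover have "?U \<subseteq> W \<times> W" using V_W by blast
    ultimately show ?thesis by (intro bexI[of _ z]) auto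
  next
    case True
    have "dim (?M ` ?U) = dim ?U"
      using dim_image_eq[OF M, of ?U] True U by (simp add: span_eq_iff[THEN iffD2])
    then have surj: "?M ` ?U = ?U"
      using subspace_dim_equal[OF linear_subspace_image[OF M U] U MU] by simp
    let ?z = "(f, - \<pi> f)"
    have "T (\<pi> f) - a f *\<^sub>R \<pi> f + b f *\<^sub>R f \<in> V (lv f)"
      using tri[OF pi(1)[OF f]] f by (simp add: pi)
    then have 2: "- (T (\<pi> f) - a f *\<^sub>R \<pi> f + b f *\<^sub>R f) \<in> V (lv f)" by (rule span_neg)
    have 1: "?M ?z = (T f - a f *\<^sub>R f - b f *\<^sub>R \<pi> f, - (T (\<pi> f) - a f *\<^sub>R \<pi> f + b f *\<^sub>R f))"
      by (simp add: cmap_def csc_def linear_neg[OF T])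
    have "?M ?z \<in> ?U" unfolding 1 using tri[OF f] 2 by blast
    then have "?M ?z \<in> ?M ` ?U" by (simp only: surj)
    then obtain v where v: "v \<in> ?U" "?M ?z = ?M v" by (rule imageE)
    have "?M (?z - v) = 0" using v(2) linear_diff[OF M, of ?z v] by simp
    moreover have "?z - v \<noteq> 0" using v(1) F_not_V[OF f] by auto
    moreover have "?z - v \<in> W \<times> W"
    proof -
      have "f \<in> W" "\<pi> f \<in> W" using f pi(1) span span_superset by blast+
      moreover have "fst v \<in> W" "snd v \<in> W" using v(1) V_W by (auto simp: mem_Times_iff)
      moreover have "subspace W" using span by auto
      ultimately show ?thesis by (simp add: mem_Times_iff subspace_diff subspace_neg)
    qed
    ultimately show ?thesis by (intro bexI[of _ "?z - v"]) auto
  qed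
qed

abbreviation rep :: "'v \<Rightarrow> 'v \<Rightarrow> real" where "rep \<equiv> representation F"

lemma rep_linear: "u \<in> W \<Longrightarrow> v \<in> W \<Longrightarrow> rep (u + v) f = rep u f + rep v f"
  "u \<in> W \<Longrightarrow> rep (r *\<^sub>R u) f = r * rep u f"
  using representation_add[OF ind] representation_scale[OF ind] span by (metis)+

lemma rep_base: "f \<in> F \<Longrightarrow> rep f e = (if e = f then 1 else 0)"
  using representation_basis[OF ind] by simp

lemma rep_V: "w \<in> V l \<Longrightarrow> l \<le> lv f \<Longrightarrow> rep w f = 0"
proof -
  assume l: "l \<le> lv f"
  have "V l \<subseteq> {w \<in> W. rep w f = 0}"
  proof (rule span_minimal)
    show "{e \<in> F. lv e < l} \<subseteq> {w \<in> W. rep w f = 0}"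
      using l rep_base span_superset[of F] span by auto
    show "subspace {w \<in> W. rep w f = 0}"
      using span by (auto simp: subspace_def rep_linear span_add span_scale span_0 representation_zero simp flip: span)
  qed
  then show "w \<in> V l \<Longrightarrow> rep w f = 0" by blast
qed

lemma rep_zero_V:
  assumes w: "w \<in> V (Suc l)" and 0: "\<And>f. f \<in> F \<Longrightarrow> lv f = l \<Longrightarrow> rep w f = 0"
  shows "w \<in> V l"
proof -
  have wW: "w \<in> W" using w V_W by blast
  have "w = (\<Sum>f\<in>F. rep w f *\<^sub>R f)"
    using sum_representation_eq[OF ind _ fin] wW span by auto
  also have "\<dots> \<in> V l"
  proof (rule span_sum)
    fix f assume f: "f \<in> F"
    show "rep w f *\<^sub>R f \<in> V l"
    proof (cases "lv f < l")
      case True then show ?thesis using f by (intro span_scale F_V)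
    next
      case False
      then have "rep w f = 0" using 0[OF f] rep_V[OF w, of f] by (cases "lv f = l") auto
      then show ?thesis by (simp add: span_0)
    qed
  qed
  finally show ?thesis .
qed

text \<open>On coordinates of the highest level the operator acts by its diagonal blocks alone. The
  minus sign is that of \<open>b (\<pi> f) = - b f\<close>.\<close>

lemma rep_T:
  assumes f: "f \<in> F" "lv f = l" and w: "w \<in> V (Suc l)"
  shows "rep (T w) f = a f * rep w f - b f * rep w (\<pi> f)"
proof -
  have VW: "V (Suc l) \<subseteq> W" by (rule V_W)
  have "V (Suc l) \<subseteq> {w \<in> V (Suc l). rep (T w) f = a f * rep w f - b f * rep w (\<pi> f)}" (is "_ \<subseteq> ?S")
  proof (rule span_minimal)
    show "subspace ?S"
    proof (rule subspaceI)
      show "0 \<in> ?S" using span_0 linear_0[OF T] by (simp add: representation_zero)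
      fix x y r assume x: "x \<in> ?S"
      then have xW: "x \<in> W" "T x \<in> W" using VW T_V by auto
      have ex: "rep (T x) f = a f * rep x f - b f * rep x (\<pi> f)" and xV: "x \<in> V (Suc l)" using x by auto
      show "r *\<^sub>R x \<in> ?S" using xV
        by (simp add: span_scale linear_scale[OF T] rep_linear xW ex right_diff_distrib)
      assume y: "y \<in> ?S"
      then have yW: "y \<in> W" "T y \<in> W" using VW T_V by auto
      show "x + y \<in> ?S" using x y by (simp add: span_add linear_add[OF T] rep_linear xW yW algebra_simps)
    qed
    show "{e \<in> F. lv e < Suc l} \<subseteq> ?S"
    proof
      fix e assume "e \<in> {e \<in> F. lv e < Suc l}"
      then have e: "e \<in> F" "lv e \<le> l" by auto
      have eV: "e \<in> V (Suc l)" using e by (intro F_V) auto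
      let ?v = "T e - a e *\<^sub>R e - b e *\<^sub>R \<pi> e"
      have v: "?v \<in> V (lv e)" "?v \<in> W" using tri[OF e(1)] V_W by auto
      have eW: "e \<in> W" "\<pi> e \<in> W" using e(1) pi span span_superset by blast+
      have W: "subspace W" using span by auto
      have "T e = ?v + (a e *\<^sub>R e + b e *\<^sub>R \<pi> e)" by simp
      then have "rep (T e) f = rep ?v f + (a e * rep e f + b e * rep (\<pi> e) f)"
        using v eW W by (metis (no_types, lifting) rep_linear subspace_add subspace_scale)
      also have "rep ?v f = 0" using rep_V[OF v(1)] e(2) f(2) by simp
      finally have "rep (T e) f = a e * rep e f + b e * rep (\<pi> e) f" by simp
      moreover have "\<pi> e = f \<longleftrightarrow> e = \<pi> f" using e f pi(2) by auto
      moreover have "b e = 0" if "\<pi> e = e" using pi(5)[OF e(1)] that by simp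
      ultimately show "e \<in> ?S" using eV e f pi by (auto simp: rep_base)
    qed
  qed
  then show ?thesis using w by blast
qed

text \<open>Descent through the levels: if \<open>Re c\<close> differs from every
  \<open>a f\<close>, the top coordinates of an eigenvector vanish, so it lies one level lower, and
  finally it is 0.\<close>

lemma eigenvalue_Re:
  assumes z: "z \<in> W \<times> W" "z \<noteq> 0" "cmap T z = csc c z"
  shows "\<exists>f\<in>F. Re c = a f"
proof (rule ccontr)
  assume no: "\<not> (\<exists>f\<in>F. Re c = a f)"
  have main: "z \<in> V l \<times> V l \<Longrightarrow> z = 0" for l
  proof (induction l)
    case 0
    then show ?case by (auto simp: zero_prod_def)
  next
    case (Suc l)
    obtain u v where uv: "z = (u, v)" "u \<in> V (Suc l)" "v \<in> V (Suc l)" using Suc.prems by auto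
    then have uvW: "u \<in> W" "v \<in> W" using V_W by auto
    have W: "subspace W" using span by auto
    have Tuv: "T u = Re c *\<^sub>R u - Im c *\<^sub>R v" "T v = Im c *\<^sub>R u + Re c *\<^sub>R v"
      using z(3) unfolding uv(1) cmap_eigen by auto
    have "rep u f = 0 \<and> rep v f = 0" if f: "f \<in> F" "lv f = l" for f
    proof -
      have Ru: "rep (T u) g = Re c * rep u g - Im c * rep v g"
        and Rv: "rep (T v) g = Im c * rep u g + Re c * rep v g" for g
      proof -
        have "T u = Re c *\<^sub>R u + (- Im c) *\<^sub>R v" using Tuv by simp
        then have "rep (T u) g = rep (Re c *\<^sub>R u) g + rep ((- Im c) *\<^sub>R v) g"
          using rep_linear(1)[OF subspace_scale[OF W uvW(1)] subspace_scale[OF W uvW(2)]] by metis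
        then show "rep (T u) g = Re c * rep u g - Im c * rep v g"
          unfolding rep_linear(2)[OF uvW(1)] rep_linear(2)[OF uvW(2)] by simp
        show "rep (T v) g = Im c * rep u g + Re c * rep v g"
          using rep_linear(1)[of "Im c *\<^sub>R u" "Re c *\<^sub>R v" g] uvW W Tuv by (simp add: rep_linear(2) subspace_scale)
      qed
      define \<zeta> where "\<zeta> g = Complex (rep u g) (rep v g)" for g
      have e: "c * \<zeta> g = complex_of_real (a g) * \<zeta> g - complex_of_real (b g) * \<zeta> (\<pi> g)" if g: "g \<in> F" "lv g = l" for g
        using rep_T[OF g uv(2)] rep_T[OF g uv(3)] Ru[of g] Rv[of g] by (simp add: \<zeta>_def complex_eq_iff)
      have e1: "(c - complex_of_real (a f)) * \<zeta> f = - complex_of_real (b f) * \<zeta> (\<pi> f)"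
        using e[OF f] by (simp add: algebra_simps)
      have e2: "(c - complex_of_real (a f)) * \<zeta> (\<pi> f) = complex_of_real (b f) * \<zeta> f"
        using e[of "\<pi> f"] f pi by (simp add: algebra_simps)
      let ?d = "c - complex_of_real (a f)" and ?b = "complex_of_real (b f)"
      \<comment> \<open>Eliminating \<open>\<zeta> (\<pi> f)\<close> gives the characteristic
        equation of the block, with roots \<open>a f \<plusminus> \<i> b f\<close>.\<close>
      have "?d * (?d * \<zeta> f) = - ?b * (?b * \<zeta> f)"
        unfolding e1 using e2 by (simp add: algebra_simps)
      then have "(?d - \<i> * ?b) * (?d + \<i> * ?b) * \<zeta> f = 0" by (simp add: algebra_simps)
      moreover have "?d - \<i> * ?b \<noteq> 0" "?d + \<i> * ?b \<noteq> 0"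
        using no f by (auto simp: complex_eq_iff)
      ultimately have "\<zeta> f = 0" by simp
      then show ?thesis by (simp add: \<zeta>_def complex_eq_iff)
    qed
    then have "u \<in> V l" "v \<in> V l" using uv rep_zero_V by blast+
    then show ?case using Suc.IH uv(1) by simp
  qed
  obtain l where "V l = W" using V_max .
  then have "z \<in> V l \<times> V l" using z(1) by (simp only:)
  from main[OF this] z(2) show False by contradiction
qed

lemma nilpotent_on:
  assumes "\<And>f. f \<in> F \<Longrightarrow> a f = 0 \<and> b f = 0"
  shows "\<exists>k. \<forall>w\<in>W. (T ^^ k) w = 0"
proof -
  have "V (Suc l) \<subseteq> {w. T w \<in> V l}" for l
  proof (rule span_minimal)
    show "{e \<in> F. lv e < Suc l} \<subseteq> {w. T w \<in> V l}"
      using tri assms V_mono by (fastforce simp: less_Suc_eq_le)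
    show "subspace {w. T w \<in> V l}"
      using T by (auto simp: subspace_def linear_add linear_scale linear_0 span_add span_scale span_0)
  qed
  then have step: "T w \<in> V l" if "w \<in> V (Suc l)" for w l using that by blast
  have "(T ^^ l) w = 0" if "w \<in> V l" for w l
    using that by (induction l arbitrary: w) (auto simp: funpow_swap1 simp del: funpow.simps(2) intro: step simp: funpow_Suc_right)
  moreover obtain l where "V l = W" using V_max .
  ultimately show ?thesis by blast
qed

text \<open>Only diagonal blocks contribute, and the square of a block with weights
  \<open>a \<plusminus> \<i> b\<close> has diagonal entries
  \<open>a\<^sup>2 - b\<^sup>2\<close>.\<close>

lemma trace_square:
  assumes "W = UNIV"
  shows "tr (\<lambda>x. T (T x)) = (\<Sum>f\<in>F. (a f)\<^sup>2 - (b f)\<^sup>2)"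
proof -
  have "tr (\<lambda>x. T (T x)) = (\<Sum>f\<in>F. rep (T (T f)) f)"
    using tr_basis[OF linear_compose[OF T T] fin ind] span assms by (simp add: comp_def)
  also have "\<dots> = (\<Sum>f\<in>F. (a f)\<^sup>2 - (b f)\<^sup>2)"
  proof (rule sum.cong[OF refl])
    fix f assume f: "f \<in> F"
    have fV: "f \<in> V (Suc (lv f))" using f by (intro F_V) auto
    have "b f = 0" if "\<pi> f = f" using pi(5)[OF f] that by simp
    then have bb: "b f * rep f (\<pi> f) = 0" using rep_base[OF f] by auto
    have 1: "rep (T f) f = a f"
      using rep_T[OF f refl fV] bb rep_base[OF f] by simp
    have 2: "b f * rep (T f) (\<pi> f) = (b f)\<^sup>2"
    proof (cases "\<pi> f = f")
      case False
      then show ?thesis using rep_T[OF pi(1)[OF f] pi(3)[OF f] fV] f rep_base[OF f] pi[OF f] by (simp add: power2_eq_square)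
    qed (use \<open>\<pi> f = f \<Longrightarrow> b f = 0\<close> in simp)
    show "rep (T (T f)) f = (a f)\<^sup>2 - (b f)\<^sup>2"
      using rep_T[OF f refl T_V[OF fV]] 1 2 by (simp add: power2_eq_square)
  qed
  finally show ?thesis .
qed

end

lemma block_flag_operator:
  assumes "block_flag br \<rho> W F lv \<pi> a b" "linear (\<rho> x)"
  shows "flagged_operator (\<rho> x) W F lv \<pi> (\<lambda>f. a f x) (\<lambda>f. b f x)"
  using assms unfolding block_flag_def flagged_operator_def by simp


section \<open>The real type estimate\<close>

text \<open>Both quadratic forms are unchanged along the common kernel of the \<open>a f\<close>. On
  the unit sphere of its orthogonal complement the right-hand form is positive, and compactness
  bounds the quotient.\<close>

lemma linear_forms_dominated:
  fixes a b :: "'i \<Rightarrow> 'e::euclidean_space \<Rightarrow> real"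
  assumes fin: "finite F" and lin: "\<And>f. f \<in> F \<Longrightarrow> linear (a f)" "\<And>f. f \<in> F \<Longrightarrow> linear (b f)"
    and ker: "\<And>x. (\<And>f. f \<in> F \<Longrightarrow> a f x = 0) \<Longrightarrow> (\<And>f. f \<in> F \<Longrightarrow> b f x = 0)"
  shows "\<exists>C\<ge>0. \<forall>x. (\<Sum>f\<in>F. (b f x)\<^sup>2) \<le> C * (\<Sum>f\<in>F. (a f x)\<^sup>2)"
proof -
  let ?p = "\<lambda>x. \<Sum>f\<in>F. (a f x)\<^sup>2" and ?q = "\<lambda>x. \<Sum>f\<in>F. (b f x)\<^sup>2"
  define N where "N = {x. \<forall>f\<in>F. a f x = 0}"
  have N: "subspace N"
    unfolding N_def using lin by (auto simp: subspace_def linear_add linear_scale linear_0)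
  define S where "S = sphere 0 1 \<inter> {z. \<forall>w\<in>N. orthogonal z w}"
  have clo: "closed {z. \<forall>w\<in>N. orthogonal z w}"
  proof -
    have "{z. \<forall>w\<in>N. orthogonal z w} = (\<Inter>w\<in>N. {z. z \<bullet> w = 0})" by (auto simp: orthogonal_def)
    then show ?thesis by (auto intro!: closed_INT closed_Collect_eq continuous_intros)
  qed
  then have cS: "compact S" unfolding S_def by (intro compact_Int_closed compact_sphere)
  have cont: "continuous_on S (a f)" "continuous_on S (b f)" if "f \<in> F" for f
    using lin[OF that] linear_continuous_on linear_conv_bounded_linear by blast+
  have p0: "?p x \<noteq> 0" if "x \<in> S" for x
  proof
    assume "?p x = 0"
    then have "x \<in> N" using fin by (simp add: N_def sum_nonneg_eq_0_iff)
    then have "x = 0" using that by (auto simp: S_def orthogonal_self)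
    then show False using that by (simp add: S_def)
  qed
  have "continuous_on S (\<lambda>x. ?q x / ?p x)"
    using cont p0 by (intro continuous_on_divide continuous_on_sum continuous_on_power) auto
  then have "bounded ((\<lambda>x. ?q x / ?p x) ` S)" using cS compact_continuous_image compact_imp_bounded by blast
  then obtain C where C: "\<And>x. x \<in> S \<Longrightarrow> \<bar>?q x / ?p x\<bar> \<le> C" by (auto simp: bounded_iff)
  have pn: "?p x \<ge> 0" "?q x \<ge> 0" for x by (auto intro: sum_nonneg)
  have onS: "?q x \<le> \<bar>C\<bar> * ?p x" if "x \<in> S" for x
  proof -
    have "?q x / ?p x \<le> \<bar>C\<bar>" using C[OF that] by linarith
    moreover have "?p x > 0" using p0[OF that] pn(1)[of x] by linarith
    ultimately show ?thesis by (simp add: divide_le_eq)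
  qed
  have "?q x \<le> \<bar>C\<bar> * ?p x" for x
  proof -
    obtain y z where yz: "y \<in> span N" "\<And>w. w \<in> span N \<Longrightarrow> orthogonal z w" "x = y + z"
      using orthogonal_subspace_decomp_exists[of N x] by metis
    have y: "y \<in> N" using yz(1) N by (metis span_eq_iff)
    then have "a f x = a f z" "b f x = b f z" if "f \<in> F" for f
      using that ker[of y] lin[OF that] by (auto simp: N_def yz(3) linear_add)
    then have pq: "?p x = ?p z" "?q x = ?q z" by auto
    show ?thesis
    proof (cases "z = 0")
      case True
      then have "?q z = 0" using lin by (auto simp: linear_0)
      then show ?thesis using pq pn(1)[of x] by simp
    next
      case False
      let ?z = "z /\<^sub>R norm z"
      have "?z \<in> S" using False yz(2) span_base[of _ N] by (auto simp: S_def orthogonal_clauses)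
      from onS[OF this] have "(norm z)\<^sup>2 * ?q ?z \<le> (norm z)\<^sup>2 * (\<bar>C\<bar> * ?p ?z)" by (intro mult_left_mono) auto
      moreover have "(norm z)\<^sup>2 * ?q ?z = ?q z" "(norm z)\<^sup>2 * ?p ?z = ?p z"
        using lin False by (auto simp: sum_distrib_left linear_scale power_mult_distrib field_simps intro!: sum.cong)
      ultimately show ?thesis using pq by (simp add: algebra_simps)
    qed
  qed
  then show ?thesis by (intro exI[of _ "\<bar>C\<bar>"]) auto
qed

lemma nilpotent_eigenvalue:
  assumes T: "linear T" and nil: "nilpotent_op T" and z: "z \<noteq> 0" "cmap T z = csc c z"
  shows "c = 0"
proof -
  obtain k where k: "\<And>x. (T ^^ k) x = 0" using nil by (auto simp: nilpotent_op_def)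
  have "((T ^^ n) (fst z), (T ^^ n) (snd z)) = csc (c ^ n) z" for n
  proof (induction n)
    case (Suc n)
    have "((T ^^ Suc n) (fst z), (T ^^ Suc n) (snd z)) = cmap T ((T ^^ n) (fst z), (T ^^ n) (snd z))"
      by (simp add: cmap_def)
    also have "\<dots> = csc (c ^ Suc n) z"
      unfolding Suc by (simp add: cmap_simps[OF T] z(2) csc_simps mult.commute)
    finally show ?case .
  qed (simp add: csc_simps)
  from this[of k] k have "csc (c ^ k) z = 0" by (simp add: zero_prod_def)
  then show ?thesis using z(1) by (simp add: csc_eq_0)
qed

lemma complex_eigenvalue_cmap: "complex_eigenvalue T c \<longleftrightarrow> (\<exists>z. z \<noteq> 0 \<and> cmap T z = csc c z)"
  unfolding complex_eigenvalue_def by (auto simp: zero_prod_def cmap_eigen)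

lemma Cauchy_Schwarz_double_sum:
  fixes f g :: "'i \<Rightarrow> 'j \<Rightarrow> real"
  shows "(\<Sum>j\<in>J. \<Sum>k\<in>K. f j k * g j k)\<^sup>2 \<le> (\<Sum>j\<in>J. \<Sum>k\<in>K. (f j k)\<^sup>2) * (\<Sum>j\<in>J. \<Sum>k\<in>K. (g j k)\<^sup>2)"
proof -
  have e: "(\<Sum>j\<in>J. \<Sum>k\<in>K. F j k) = (\<Sum>z\<in>J \<times> K. F (fst z) (snd z))" for F :: "'i \<Rightarrow> 'j \<Rightarrow> real"
    by (simp add: sum.cartesian_product case_prod_beta)
  show ?thesis unfolding e by (rule Cauchy_Schwarz_ineq_sum)
qed

lemma Cauchy_Schwarz_triple_sum:
  fixes f g :: "'i \<Rightarrow> 'j \<Rightarrow> 'k \<Rightarrow> real"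
  shows "(\<Sum>i\<in>I. \<Sum>j\<in>J. \<Sum>k\<in>K. f i j k * g i j k)\<^sup>2
    \<le> (\<Sum>i\<in>I. \<Sum>j\<in>J. \<Sum>k\<in>K. (f i j k)\<^sup>2) * (\<Sum>i\<in>I. \<Sum>j\<in>J. \<Sum>k\<in>K. (g i j k)\<^sup>2)"
proof -
  have e: "(\<Sum>j\<in>J. \<Sum>k\<in>K. F j k) = (\<Sum>z\<in>J \<times> K. F (fst z) (snd z))" for F :: "'j \<Rightarrow> 'k \<Rightarrow> real"
    by (simp add: sum.cartesian_product case_prod_beta)
  show ?thesis unfolding e by (rule Cauchy_Schwarz_double_sum)
qed

context inner_form
begin

text \<open>The quadratic form of \<open>T\<close> sees its symmetric part only; Cauchy-Schwarz then
  bounds it by the Frobenius norm of that part.\<close>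

lemma frame_bilinear_bound:
  assumes fr: "frame h I e" and T: "linear T"
  shows "\<bar>h (T u) u\<bar> \<le> sqrt (\<Sum>j\<in>I. \<Sum>k\<in>I. ((h (T (e j)) (e k) + h (T (e k)) (e j)) / 2)\<^sup>2) * h u u"
proof -
  define x where "x i = h u (e i)" for i
  define m where "m j k = h (T (e j)) (e k)" for j k
  have u: "u = (\<Sum>i\<in>I. x i *\<^sub>R e i)" unfolding x_def by (rule frame_expand[OF fr])
  have 1: "h (T u) w = (\<Sum>j\<in>I. x j * h (T (e j)) w)" for w
    by (subst u) (simp add: h_simps linear_sum[OF T] linear_scale[OF T])
  have 2: "h w u = (\<Sum>k\<in>I. x k * h w (e k))" for w
    by (subst u) (simp add: h_simps)
  have huu: "h u u = (\<Sum>i\<in>I. (x i)\<^sup>2)"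
    unfolding 2[of u] by (simp add: x_def power2_eq_square)
  have "h (T u) u = (\<Sum>j\<in>I. x j * (\<Sum>k\<in>I. x k * m j k))"
    by (simp only: 1[of u] 2[of "T (e _)"] m_def)
  then have "h (T u) u = (\<Sum>j\<in>I. \<Sum>k\<in>I. x j * x k * m j k)"
    by (simp add: sum_distrib_left mult.assoc)
  moreover have "(\<Sum>j\<in>I. \<Sum>k\<in>I. x j * x k * m j k) = (\<Sum>j\<in>I. \<Sum>k\<in>I. x j * x k * m k j)"
    by (subst sum.swap) (simp add: ac_simps)
  ultimately have "h (T u) u = ((\<Sum>j\<in>I. \<Sum>k\<in>I. x j * x k * m j k) + (\<Sum>j\<in>I. \<Sum>k\<in>I. x j * x k * m k j)) / 2"
    by simp
  also have "\<dots> = (\<Sum>j\<in>I. \<Sum>k\<in>I. x j * x k * ((m j k + m k j) / 2))"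
    by (simp add: sum.distrib[symmetric] sum_divide_distrib algebra_simps add_divide_distrib)
  finally have eq: "h (T u) u = (\<Sum>j\<in>I. \<Sum>k\<in>I. x j * x k * ((m j k + m k j) / 2))" .
  have "(h (T u) u)\<^sup>2 \<le> (\<Sum>j\<in>I. \<Sum>k\<in>I. (x j * x k)\<^sup>2) * (\<Sum>j\<in>I. \<Sum>k\<in>I. ((m j k + m k j) / 2)\<^sup>2)"
    unfolding eq by (rule Cauchy_Schwarz_double_sum)
  also have "(\<Sum>j\<in>I. \<Sum>k\<in>I. (x j * x k)\<^sup>2) = h u u * h u u"
    unfolding huu sum_product power_mult_distrib by (rule refl)
  also have "\<dots> = (h u u)\<^sup>2" by (simp add: power2_eq_square)
  finally have "(h (T u) u)\<^sup>2 \<le> (h u u)\<^sup>2 * (\<Sum>j\<in>I. \<Sum>k\<in>I. ((m j k + m k j) / 2)\<^sup>2)" .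
  from real_sqrt_le_mono[OF this]
  have "\<bar>h (T u) u\<bar> \<le> sqrt ((h u u)\<^sup>2 * (\<Sum>j\<in>I. \<Sum>k\<in>I. ((m j k + m k j) / 2)\<^sup>2))"
    by (simp only: real_sqrt_abs)
  then show ?thesis using h_nonneg[of u] by (simp add: real_sqrt_mult m_def mult.commute)
qed

text \<open>In \<open>h (T u) u + h (T v) v\<close> the imaginary part of the eigenvalue
  cancels.\<close>

lemma eigenvalue_Re_bound:
  assumes fr: "frame h I e" and T: "linear T" and z: "z \<noteq> 0" "cmap T z = csc c z"
  shows "(Re c)\<^sup>2 \<le> (\<Sum>j\<in>I. \<Sum>k\<in>I. ((h (T (e j)) (e k) + h (T (e k)) (e j)) / 2)\<^sup>2)" (is "_ \<le> ?s")
proof -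
  obtain u v where uv: "z = (u, v)" by (cases z)
  have Tuv: "T u = Re c *\<^sub>R u - Im c *\<^sub>R v" "T v = Im c *\<^sub>R u + Re c *\<^sub>R v"
    using z(2) unfolding uv cmap_eigen by auto
  have "h (T u) u + h (T v) v = Re c * (h u u + h v v)"
    unfolding Tuv by (simp add: h_simps sym[of v u] algebra_simps)
  moreover have "\<bar>h (T u) u + h (T v) v\<bar> \<le> sqrt ?s * (h u u + h v v)"
    using frame_bilinear_bound[OF fr T, of u] frame_bilinear_bound[OF fr T, of v] by (simp add: algebra_simps)
  moreover have pos: "h u u + h v v > 0"
  proof -
    have "u \<noteq> 0 \<or> v \<noteq> 0" using z(1) uv by (auto simp: zero_prod_def)
    then have "h u u > 0 \<or> h v v > 0" using pos by blast
    then show ?thesis using h_nonneg[of u] h_nonneg[of v] by linarith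
  qed
  ultimately have "\<bar>Re c\<bar> * (h u u + h v v) \<le> sqrt ?s * (h u u + h v v)" by (simp add: abs_mult)
  then have "\<bar>Re c\<bar> \<le> sqrt ?s" using pos by simp
  then have "\<bar>Re c\<bar>\<^sup>2 \<le> (sqrt ?s)\<^sup>2" by (rule power_mono) simp
  moreover have "?s \<ge> 0" by (intro sum_nonneg) simp
  ultimately show ?thesis by simp
qed

end

context metric_lie_algebra
begin

text \<open>Passes from one frame to arbitrary unit vectors, so that the final estimate no longer
  mentions the adapted basis in which it is proved.\<close>

lemma bracket_bound:
  assumes fr: "frame h I e" and unit: "h u u = 1" "h v v = 1" "h w w = 1"
  shows "(h (br u v) w)\<^sup>2 \<le> (\<Sum>i\<in>I. \<Sum>j\<in>I. \<Sum>k\<in>I. (cst e i j k)\<^sup>2)"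
proof -
  have sq: "(\<Sum>i\<in>I. (h x (e i))\<^sup>2) = h x x" for x
  proof -
    from arg_cong[OF frame_expand[OF fr, of x], of "h x"]
    show ?thesis by (simp only: h_simps power2_eq_square real_scaleR_def)
  qed
  let ?x = "\<lambda>i. h u (e i)" and ?y = "\<lambda>i. h v (e i)" and ?z = "\<lambda>i. h w (e i)"
  have 1: "h (br u v) w = (\<Sum>i\<in>I. ?x i * h (br (e i) v) w)"
    using arg_cong[OF frame_expand[OF fr, of u], of "\<lambda>y. h (br y v) w"] by (simp only: h_simps br_simps real_scaleR_def)
  have 2: "h (br (e i) v) w = (\<Sum>j\<in>I. ?y j * h (br (e i) (e j)) w)" for i
    using arg_cong[OF frame_expand[OF fr, of v], of "\<lambda>y. h (br (e i) y) w"] by (simp only: h_simps br_simps real_scaleR_def)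
  have 3: "h (br (e i) (e j)) w = (\<Sum>k\<in>I. ?z k * cst e i j k)" for i j
    using arg_cong[OF frame_expand[OF fr, of w], of "\<lambda>y. h (br (e i) (e j)) y"] by (simp only: h_simps real_scaleR_def)
  have eq: "h (br u v) w = (\<Sum>i\<in>I. \<Sum>j\<in>I. \<Sum>k\<in>I. (?x i * ?y j * ?z k) * cst e i j k)"
    unfolding 1 2 3 by (simp only: sum_distrib_left mult.assoc)
  have "(h (br u v) w)\<^sup>2 \<le> (\<Sum>i\<in>I. \<Sum>j\<in>I. \<Sum>k\<in>I. (?x i * ?y j * ?z k)\<^sup>2) * (\<Sum>i\<in>I. \<Sum>j\<in>I. \<Sum>k\<in>I. (cst e i j k)\<^sup>2)"
    unfolding eq by (rule Cauchy_Schwarz_triple_sum)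
  also have "(\<Sum>i\<in>I. \<Sum>j\<in>I. \<Sum>k\<in>I. (?x i * ?y j * ?z k)\<^sup>2) = (\<Sum>i\<in>I. (?x i)\<^sup>2) * ((\<Sum>j\<in>I. (?y j)\<^sup>2) * (\<Sum>k\<in>I. (?z k)\<^sup>2))"
    unfolding sum_product unfolding sum_distrib_left power_mult_distrib mult.assoc by (rule refl)
  also have "\<dots> = 1" by (simp add: sq unit)
  finally show ?thesis by simp
qed

end

text \<open>\<open>N\<close> indexes an orthonormal basis of the derived algebra, \<open>M\<close> one of its complement, and
  \<open>s i\<close> is the squared norm of the symmetric part of \<open>ad e\<^sub>i\<close>.\<close>

lemma Sc_estimate:
  fixes c :: "'i \<Rightarrow> 'i \<Rightarrow> 'i \<Rightarrow> real" and K :: real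
  assumes fin: "finite N" "finite M" "N \<inter> M = {}"
    and anti: "\<And>i j k. c i j k = - c j i k" and der: "\<And>i j k. k \<in> M \<Longrightarrow> c i j k = 0"
    and q0: "\<And>i. i \<in> N \<Longrightarrow> (\<Sum>j\<in>N\<union>M. \<Sum>k\<in>N\<union>M. c i j k * c i k j) = 0"
    and K: "K \<ge> 0" "\<And>i. i \<in> M \<Longrightarrow> - (\<Sum>j\<in>N\<union>M. \<Sum>k\<in>N\<union>M. c i j k * c i k j)
        \<le> K * (\<Sum>j\<in>N\<union>M. \<Sum>k\<in>N\<union>M. ((c i j k + c i k j) / 2)\<^sup>2)"
  shows "(\<Sum>i\<in>N\<union>M. \<Sum>j\<in>N\<union>M. \<Sum>k\<in>N\<union>M. (c i j k)\<^sup>2) \<le> 4 * (1 + K) * (- Sc (N \<union> M) c)"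
proof -
  let ?B = "N \<union> M"
  define t where "t i j = (\<Sum>k\<in>?B. (c i j k)\<^sup>2)" for i j
  define q where "q i = (\<Sum>j\<in>?B. \<Sum>k\<in>?B. c i j k * c i k j)" for i
  define s where "s i = (\<Sum>j\<in>?B. \<Sum>k\<in>?B. ((c i j k + c i k j) / 2)\<^sup>2)" for i
  define H where "H = (\<Sum>i\<in>?B. (\<Sum>j\<in>?B. c i j j)\<^sup>2)"
  have un: "(\<Sum>i\<in>?B. f i) = (\<Sum>i\<in>N. f i) + (\<Sum>i\<in>M. f i)" for f :: "'i \<Rightarrow> real"
    by (rule sum.union_disjoint[OF fin])
  have t0: "t i j \<ge> 0" and s0: "s i \<ge> 0" and H0: "H \<ge> 0" for i j
    by (auto simp: t_def s_def H_def intro!: sum_nonneg)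
  have tsym: "t i j = t j i" for i j unfolding t_def by (subst anti) simp
  define Tt where "Tt i = (\<Sum>j\<in>?B. t i j)" for i
  \<comment> \<open>The squared norm of \<open>ad e\<^sub>i\<close> is twice that of its symmetric
    part minus the trace of its square.\<close>
  have Ts: "Tt i = 2 * s i - q i" for i
  proof -
    have e: "((c i j k + c i k j) / 2)\<^sup>2 = ((c i j k)\<^sup>2 + (c i k j)\<^sup>2 + 2 * (c i j k * c i k j)) / 4" for j k
      by (simp add: power2_eq_square field_simps)
    have "(\<Sum>j\<in>?B. \<Sum>k\<in>?B. (c i k j)\<^sup>2) = (\<Sum>j\<in>?B. \<Sum>k\<in>?B. (c i j k)\<^sup>2)" by (rule sum.swap)
    then have "4 * s i = 2 * Tt i + 2 * q i"
      unfolding s_def e Tt_def t_def q_def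
      by (simp only: sum_divide_distrib[symmetric] sum.distrib sum_distrib_left[symmetric]) simp
    then show ?thesis by simp
  qed
  \<comment> \<open>\<open>ad e\<^sub>i\<close> has its values in the span of \<open>N\<close>, so
    the block from \<open>M\<close> to \<open>N\<close> has no transposed counterpart and enters the
    symmetrisation twice.\<close>
  have sM: "2 * (\<Sum>j\<in>M. t i j) \<le> 4 * s i" for i
  proof -
    have tN: "t i j = (\<Sum>k\<in>N. (c i j k)\<^sup>2)" for j
      unfolding t_def un using der by simp
    have NM: "(\<Sum>j\<in>N. \<Sum>k\<in>M. (c i j k + c i k j)\<^sup>2) = (\<Sum>j\<in>M. t i j)"
      unfolding tN by (subst sum.swap) (simp add: der)
    have MN: "(\<Sum>j\<in>M. \<Sum>k\<in>N. (c i j k + c i k j)\<^sup>2) = (\<Sum>j\<in>M. t i j)"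
      unfolding tN by (simp add: der)
    have "4 * s i = (\<Sum>j\<in>?B. \<Sum>k\<in>?B. (c i j k + c i k j)\<^sup>2)"
      by (simp add: s_def power_divide sum_divide_distrib[symmetric])
    also have "\<dots> = ((\<Sum>j\<in>N. \<Sum>k\<in>N. (c i j k + c i k j)\<^sup>2) + (\<Sum>j\<in>N. \<Sum>k\<in>M. (c i j k + c i k j)\<^sup>2))
       + ((\<Sum>j\<in>M. \<Sum>k\<in>N. (c i j k + c i k j)\<^sup>2) + (\<Sum>j\<in>M. \<Sum>k\<in>M. (c i j k + c i k j)\<^sup>2))"
      unfolding un by (simp add: sum.distrib)
    also have "\<dots> \<ge> 2 * (\<Sum>j\<in>M. t i j)"
      unfolding NM MN by (smt (verit, best) sum_nonneg zero_le_power2)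
    finally show ?thesis .
  qed
  have P: "(\<Sum>i\<in>?B. \<Sum>j\<in>?B. \<Sum>k\<in>?B. (c i j k)\<^sup>2) = (\<Sum>i\<in>?B. Tt i)"
    by (simp add: Tt_def t_def)
  have Sc: "Sc ?B c = - (\<Sum>i\<in>?B. Tt i) / 4 - (\<Sum>i\<in>M. q i) / 2 - H"
    unfolding Sc_formula[OF anti] P H_def using q0 by (simp add: un[of q] q_def[symmetric])
  have NN: "(\<Sum>i\<in>N. Tt i) \<ge> (\<Sum>i\<in>M. Tt i) - (\<Sum>i\<in>M. \<Sum>j\<in>M. t i j)"
  proof -
    have "(\<Sum>i\<in>N. \<Sum>j\<in>M. t i j) = (\<Sum>i\<in>M. \<Sum>j\<in>N. t i j)" by (subst sum.swap) (simp add: tsym)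
    moreover have "(\<Sum>i\<in>N. \<Sum>j\<in>N. t i j) \<ge> 0" using t0 by (intro sum_nonneg)
    ultimately show ?thesis unfolding Tt_def un by (simp add: sum.distrib)
  qed
  have MM: "(\<Sum>i\<in>M. \<Sum>j\<in>M. t i j) \<le> 2 * (\<Sum>i\<in>M. s i)"
  proof -
    have "(\<Sum>j\<in>M. t i j) \<le> 2 * s i" for i using sM[of i] by simp
    then show ?thesis unfolding sum_distrib_left by (rule sum_mono)
  qed
  have TM: "(\<Sum>i\<in>M. Tt i) = 2 * (\<Sum>i\<in>M. s i) - (\<Sum>i\<in>M. q i)"
    by (simp add: Ts sum_subtractf sum_distrib_left)
  \<comment> \<open>The traces \<open>q\<close> cancel: the bound for the part over \<open>N\<close>
    adds a second copy of the part over \<open>M\<close>, whose \<open>q\<close> terms compensate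
    those in \<open>Sc\<close>.\<close>
  have s2: "2 * (\<Sum>i\<in>M. s i) \<le> - 4 * Sc ?B c"
  proof -
    have "- 4 * Sc ?B c = (\<Sum>i\<in>N. Tt i) + (\<Sum>i\<in>M. Tt i) + 2 * (\<Sum>i\<in>M. q i) + 4 * H"
      unfolding Sc un[of Tt] by (simp add: field_simps)
    then show ?thesis using NN MM TM H0 by linarith
  qed
  have "- (\<Sum>i\<in>M. q i) \<le> K * (\<Sum>i\<in>M. s i)"
    using K(2) by (simp add: sum_negf[symmetric] sum_distrib_left q_def[symmetric] s_def[symmetric] sum_mono)
  moreover have "K * (2 * (\<Sum>i\<in>M. s i)) \<le> K * (- 4 * Sc ?B c)" by (rule mult_left_mono[OF s2 K(1)])
  moreover have "- 2 * x \<le> - 4 * K * z" if "- x \<le> K * y" "K * (2 * y) \<le> K * (- 4 * z)" for x y z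
    using that by (simp add: algebra_simps)
  ultimately have "- 2 * (\<Sum>i\<in>M. q i) \<le> - 4 * K * Sc ?B c" by blast
  moreover have "(\<Sum>i\<in>?B. Tt i) = - 4 * Sc ?B c - 2 * (\<Sum>i\<in>M. q i) - 4 * H" unfolding Sc by simp
  ultimately show ?thesis unfolding P using H0 by (simp add: algebra_simps)
qed

text \<open>The block flag and the domination constant are obtained before \<open>h\<close> is
  introduced, so the resulting constant serves all inner products.\<close>

lemma real_type_bracket_bound:
  fixes br :: "'e::euclidean_space \<Rightarrow> 'e \<Rightarrow> 'e"
  assumes lie: "lie_algebra br" and sol: "solvable_chain br UNIV"
    and real: "\<And>u. (\<And>z. complex_eigenvalue (br u) z \<Longrightarrow> Re z = 0) \<Longrightarrow> nilpotent_op (br u)"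
  obtains C where "C \<ge> 0" "\<And>h u v w. inner_form h \<Longrightarrow> h u u = 1 \<Longrightarrow> h v v = 1 \<Longrightarrow> h w w = 1 \<Longrightarrow>
      (h (br u v) w)\<^sup>2 \<le> C * (- tr (metric_lie_algebra.Rop br h))"
proof -
  interpret lie_algebra br by fact
  have "lie_module br br UNIV"
    by (simp add: lie_module_def br_linear br_linear_left ad_bracket)
  from block_flag_exists[OF sol this] obtain F lv \<pi> a b where fl: "block_flag br br UNIV F lv \<pi> a b" by blast
  have fo: "flagged_operator (br x) UNIV F lv \<pi> (\<lambda>f. a f x) (\<lambda>f. b f x)" for x
    by (rule block_flag_operator[OF fl br_linear])
  have F: "finite F" and la: "\<And>f. f \<in> F \<Longrightarrow> linear (a f)" and lbb: "\<And>f. f \<in> F \<Longrightarrow> linear (b f)"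
    and br0: "\<And>f x y. f \<in> F \<Longrightarrow> a f (br x y) = 0 \<and> b f (br x y) = 0"
    using fl by (auto simp: block_flag_def)
  have ev: "\<exists>z. z \<noteq> 0 \<and> cmap (br x) z = csc (Complex (a f x) (b f x)) z" if "f \<in> F" for f x
    using flagged_operator.weight_is_eigenvalue[OF fo that] by blast
  \<comment> \<open>The only use of real type: if all real parts of the weights vanish at
    \<open>x\<close>, the spectrum is imaginary, so \<open>ad x\<close> is nilpotent and all weights
    vanish.\<close>
  have ker: "b f x = 0" if a0: "\<And>f. f \<in> F \<Longrightarrow> a f x = 0" and f: "f \<in> F" for f x
  proof -
    have "Re z = 0" if "complex_eigenvalue (br x) z" for z
      using flagged_operator.eigenvalue_Re[OF fo, of _ x z] that a0 by (auto simp: complex_eigenvalue_cmap)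
    then have "nilpotent_op (br x)" by (rule real)
    then have "Complex (a f x) (b f x) = 0" using ev[OF f, of x] nilpotent_eigenvalue[OF br_linear] by blast
    then show ?thesis by (simp add: complex_eq_iff)
  qed
  have "\<exists>C\<ge>0. \<forall>x. (\<Sum>f\<in>F. (b f x)\<^sup>2) \<le> C * (\<Sum>f\<in>F. (a f x)\<^sup>2)"
    by (rule linear_forms_dominated[OF F la lbb ker])
  then obtain C where C: "C \<ge> 0" "\<And>x. (\<Sum>f\<in>F. (b f x)\<^sup>2) \<le> C * (\<Sum>f\<in>F. (a f x)\<^sup>2)"
    by blast
  \<comment> \<open>Each \<open>(a f x)\<^sup>2\<close> is bounded by the same symmetric part, so
    their sum costs the factor \<open>card F\<close>.\<close>
  define K where "K = C * real (card F)"
  have K: "K \<ge> 0" using C(1) by (simp add: K_def)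
  show ?thesis
  proof (rule that[of "4 * (1 + K)"])
    show "4 * (1 + K) \<ge> 0" using K by simp
    fix h :: "'e \<Rightarrow> 'e \<Rightarrow> real" and u v w
    assume hf: "inner_form h" and unit: "h u u = 1" "h v v = 1" "h w w = 1"
    interpret metric_lie_algebra br h using lie hf by (simp add: metric_lie_algebra_def)
    define D where "D = span {br x y | x y. True}"
    obtain N where N: "ortho h N" "span N = D"
      using ortho_extend[of "{}" D] by (auto simp: D_def ortho_def)
    obtain B where B: "N \<subseteq> B" "ortho h B" "span B = UNIV"
      using ortho_extend[OF N(1), of UNIV] by auto
    define M where "M = B - N"
    have BNM: "B = N \<union> M" "N \<inter> M = {}" using B(1) by (auto simp: M_def)
    have fin: "finite N" "finite M" using ortho_finite N(1) B(2) by (auto simp: M_def)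
    have fr: "frame h (N \<union> M) (\<lambda>x. x)"
      using frame_id[of B] B BNM by (simp add: orthonormal_basis_ortho)
    have der: "h (br i j) k = 0" if k: "k \<in> M" for i j k
    proof -
      have "h n k = 0" if n: "n \<in> N" for n
      proof -
        have "n \<in> B" "k \<in> B" "n \<noteq> k" using k n BNM by auto
        then show ?thesis using B(2) unfolding ortho_def by metis
      qed
      then have "span N \<subseteq> {x. h x k = 0}" by (intro span_minimal) (auto simp: subspace_def h_simps)
      moreover have "br i j \<in> span N" unfolding N(2) D_def by (intro span_base) blast
      ultimately show ?thesis by blast
    qed
    have q: "(\<Sum>j\<in>N\<union>M. \<Sum>k\<in>N\<union>M. h (br i j) k * h (br i k) j) = (\<Sum>f\<in>F. (a f i)\<^sup>2 - (b f i)\<^sup>2)" for i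
    proof -
      have "h (br i (br i j)) j = (\<Sum>k\<in>N\<union>M. h (br i j) k * h (br i k) j)" for j
        using arg_cong[OF frame_expand[OF fr, of "br i j"], of "\<lambda>y. h (br i y) j"]
        by (simp only: br_simps h_simps real_scaleR_def)
      then have "(\<Sum>j\<in>N\<union>M. \<Sum>k\<in>N\<union>M. h (br i j) k * h (br i k) j) = tr (\<lambda>x. br i (br i x))"
        using frame_tr[OF fr linear_compose[OF br_linear br_linear, of i i]] by (simp add: comp_def)
      then show ?thesis using flagged_operator.trace_square[OF fo] by simp
    qed
    have "(\<Sum>i\<in>N\<union>M. \<Sum>j\<in>N\<union>M. \<Sum>k\<in>N\<union>M. (h (br i j) k)\<^sup>2) \<le> 4 * (1 + K) * (- Sc (N \<union> M) (\<lambda>i j k. h (br i j) k))"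
    proof (rule Sc_estimate[OF fin BNM(2)])
      show "h (br i j) k = - h (br j i) k" for i j k using br_antisym[of i j] by (simp add: h_simps)
      show "h (br i j) k = 0" if "k \<in> M" for i j k using der[OF that] .
      \<comment> \<open>Weights vanish on brackets, hence on the derived algebra.\<close>
      show "(\<Sum>j\<in>N\<union>M. \<Sum>k\<in>N\<union>M. h (br i j) k * h (br i k) j) = 0" if i: "i \<in> N" for i
      proof -
        have "i \<in> span {br x y | x y. True}" using i N(2) span_superset D_def by blast
        moreover have "span {br x y | x y. True} \<subseteq> {x. \<forall>f\<in>F. a f x = 0 \<and> b f x = 0}"
          using la lbb br0 by (intro span_minimal) (auto simp: subspace_def linear_add linear_scale linear_0)
        ultimately show ?thesis unfolding q by auto
      qed
      show "K \<ge> 0" by (rule K)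
      fix i
      let ?s = "\<Sum>j\<in>N\<union>M. \<Sum>k\<in>N\<union>M. ((h (br i j) k + h (br i k) j) / 2)\<^sup>2"
      have "(a f i)\<^sup>2 \<le> ?s" if f: "f \<in> F" for f
        using ev[OF f, of i] eigenvalue_Re_bound[OF fr br_linear, of _ i "Complex (a f i) (b f i)"] by auto
      then have "(\<Sum>f\<in>F. (a f i)\<^sup>2) \<le> real (card F) * ?s" by (rule sum_bounded_above)
      then have "C * (\<Sum>f\<in>F. (a f i)\<^sup>2) \<le> K * ?s" unfolding K_def mult.assoc by (rule mult_left_mono[OF _ C(1)])
      moreover have "- (\<Sum>f\<in>F. (a f i)\<^sup>2 - (b f i)\<^sup>2) \<le> (\<Sum>f\<in>F. (b f i)\<^sup>2)"
        by (simp add: sum_subtractf sum_nonneg)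
      ultimately show "- (\<Sum>j\<in>N\<union>M. \<Sum>k\<in>N\<union>M. h (br i j) k * h (br i k) j) \<le> K * ?s"
        unfolding q using C(2)[of i] by linarith
    qed
    then show "(h (br u v) w)\<^sup>2 \<le> 4 * (1 + K) * (- tr Rop)"
      using bracket_bound[OF fr unit] tr_Rop_Sc[OF fr] by simp
  qed
qed

text \<open>Each \<open>Gam\<close> is at most \<open>3/2 * M\<close>, so a summand is at most
  \<open>(9/4 + 9/4 + 3/2) * M\<^sup>2 = 6 * M\<^sup>2\<close>.\<close>

lemma curvature_component_bound:
  fixes c :: "'i \<Rightarrow> 'i \<Rightarrow> 'i \<Rightarrow> real"
  assumes fin: "finite I" and c: "\<And>i j k. i \<in> I \<Longrightarrow> j \<in> I \<Longrightarrow> k \<in> I \<Longrightarrow> \<bar>c i j k\<bar> \<le> M"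
    and ijkl: "i \<in> I" "j \<in> I" "k \<in> I" "l \<in> I"
  shows "\<bar>Rm I c i j k l\<bar> \<le> real (card I) * (6 * M\<^sup>2)"
proof -
  have M: "M \<ge> 0" using c[OF ijkl(1,1,1)] by linarith
  have G: "\<bar>Gam c i j k\<bar> \<le> 3 / 2 * M" if "i \<in> I" "j \<in> I" "k \<in> I" for i j k
    using c[OF that] c[OF that(2,3,1)] c[OF that(3,1,2)] unfolding Gam_def
    by (simp add: abs_le_iff field_simps)
  have m: "\<bar>x * y\<bar> \<le> a * b" if "\<bar>x\<bar> \<le> a" "\<bar>y\<bar> \<le> b" for x y a b :: real
    unfolding abs_mult using that by (intro mult_mono) auto
  have "\<bar>Gam c j k m * Gam c i m l - Gam c i k m * Gam c j m l - c i j m * Gam c m k l\<bar> \<le> 6 * M\<^sup>2" if "m \<in> I" for m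
  proof -
    have "\<bar>Gam c j k m * Gam c i m l\<bar> \<le> (3/2*M) * (3/2*M)" "\<bar>Gam c i k m * Gam c j m l\<bar> \<le> (3/2*M) * (3/2*M)"
      "\<bar>c i j m * Gam c m k l\<bar> \<le> M * (3/2*M)"
      using m[OF G[OF ijkl(2,3) that] G[OF ijkl(1) that ijkl(4)]] m[OF G[OF ijkl(1,3) that] G[OF ijkl(2) that ijkl(4)]]
        m[OF c[OF ijkl(1,2) that] G[OF that ijkl(3,4)]] by blast+
    moreover have "(3/2*M) * (3/2*M) + (3/2*M) * (3/2*M) + M * (3/2*M) = 6 * M\<^sup>2" by (simp add: power2_eq_square)
    ultimately show ?thesis by linarith
  qed
  then have "(\<Sum>m\<in>I. \<bar>Gam c j k m * Gam c i m l - Gam c i k m * Gam c j m l - c i j m * Gam c m k l\<bar>) \<le> real (card I) * (6 * M\<^sup>2)"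
    by (rule sum_bounded_above)
  then show ?thesis unfolding Rm_def by (rule order_trans[OF sum_abs])
qed


section \<open>Collapse of the pinching functional\<close>

text \<open>The inner product that declares the rescaled basis \<open>w i *\<^sub>R i\<close>
  orthonormal. Degenerating the bracket in a fixed frame and changing the metric are the same
  thing.\<close>

lemma weighted_basis_inner_form:
  fixes I :: "'e::euclidean_space set" and w :: "'e \<Rightarrow> real"
  assumes I: "finite I" "independent I" "span I = UNIV" and w: "\<And>i. i \<in> I \<Longrightarrow> w i > 0"
  defines "h \<equiv> \<lambda>u v. \<Sum>i\<in>I. (representation I u i / w i) * (representation I v i / w i)"
  shows "inner_form h" "frame h I (\<lambda>i. w i *\<^sub>R i)"
    "k \<in> I \<Longrightarrow> h x (w k *\<^sub>R k) = representation I x k / w k"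
proof -
  let ?r = "representation I"
  have rl: "?r (u + v) i = ?r u i + ?r v i" "?r (c *\<^sub>R u) i = c * ?r u i" for u v c i
    using representation_add[OF I(2)] representation_scale[OF I(2)] I(3) by auto
  have rb: "?r i k = (if k = i then 1 else 0)" if "i \<in> I" for i k
    using representation_basis[OF I(2) that] by simp
  show "inner_form h"
  proof
    show "bilinear h" unfolding bilinear_def h_def
      by (auto intro!: linearI simp: rl sum.distrib sum_distrib_left algebra_simps add_divide_distrib)
    show "h u v = h v u" for u v by (simp add: h_def mult.commute)
    show "h u u > 0" if "u \<noteq> 0" for u
    proof -
      have "\<exists>i\<in>I. ?r u i \<noteq> 0"
      proof (rule ccontr)
        assume "\<not> (\<exists>i\<in>I. ?r u i \<noteq> 0)"
        then have "(\<Sum>i\<in>I. ?r u i *\<^sub>R i) = 0" by simp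
        then show False using sum_representation_eq[OF I(2), of u I] I that by simp
      qed
      then obtain i where i: "i \<in> I" "?r u i \<noteq> 0" by blast
      have "?r u i / w i \<noteq> 0" using i w[OF i(1)] by auto
      then have "0 < (?r u i / w i) * (?r u i / w i)" by (metis not_real_square_gt_zero)
      also have "\<dots> \<le> h u u" unfolding h_def using I(1) i(1)
        by (intro member_le_sum[of i I "\<lambda>i. (?r u i / w i) * (?r u i / w i)"]) auto
      finally show ?thesis .
    qed
  qed
  have hk: "h x (w k *\<^sub>R k) = ?r x k / w k" if k: "k \<in> I" for x k
  proof -
    have "h x (w k *\<^sub>R k) = (\<Sum>i\<in>I. if i = k then ?r x k / w k else 0)"
      unfolding h_def using w[OF k] by (intro sum.cong) (auto simp: rl rb[OF k])
    then show ?thesis using I(1) k by simp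
  qed
  then show "k \<in> I \<Longrightarrow> h x (w k *\<^sub>R k) = ?r x k / w k" .
  have "span ((\<lambda>i. w i *\<^sub>R i) ` I) = UNIV"
  proof -
    have "I \<subseteq> span ((\<lambda>i. w i *\<^sub>R i) ` I)"
    proof
      fix i assume i: "i \<in> I"
      then have "(1 / w i) *\<^sub>R (w i *\<^sub>R i) \<in> span ((\<lambda>i. w i *\<^sub>R i) ` I)" by (intro span_scale span_base) blast
      then show "i \<in> span ((\<lambda>i. w i *\<^sub>R i) ` I)" using w[OF i] by simp
    qed
    then have "span I \<subseteq> span ((\<lambda>i. w i *\<^sub>R i) ` I)" by (rule span_minimal) simp
    then show ?thesis using I(3) by blast
  qed
  then show "frame h I (\<lambda>i. w i *\<^sub>R i)"
    unfolding frame_def using I(1) less_imp_neq[OF w] by (auto simp: hk rl rb)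
qed

lemma tendsto_Rc:
  assumes c: "\<And>i j k. i \<in> I \<Longrightarrow> j \<in> I \<Longrightarrow> k \<in> I \<Longrightarrow> ((\<lambda>n. c n i j k) \<longlongrightarrow> d i j k) F" and jk: "j \<in> I" "k \<in> I"
  shows "((\<lambda>n. Rc I (c n) j k) \<longlongrightarrow> Rc I d j k) F"
  unfolding Rc_def Rm_def Gam_def using jk
  by (intro tendsto_sum tendsto_diff tendsto_mult tendsto_divide tendsto_add tendsto_const c) auto

lemma tendsto_Sc:
  assumes c: "\<And>i j k. i \<in> I \<Longrightarrow> j \<in> I \<Longrightarrow> k \<in> I \<Longrightarrow> ((\<lambda>n. c n i j k) \<longlongrightarrow> d i j k) F"
  shows "((\<lambda>n. Sc I (c n)) \<longlongrightarrow> Sc I d) F"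
  unfolding Sc_def by (intro tendsto_sum tendsto_Rc[OF c]) auto

text \<open>The structure constants of the semidirect product of the line spanned by \<open>X\<close> with the abelian
  algebra spanned by \<open>F\<close>, on which \<open>X\<close> acts by \<open>f \<mapsto> \<beta> f \<cdot> \<pi> f\<close>.\<close>

locale paired_semidirect =
  fixes X :: 'i and F :: "'i set" and \<pi> :: "'i \<Rightarrow> 'i" and \<beta> :: "'i \<Rightarrow> real"
  assumes fin: "finite F" and X: "X \<notin> F" and pi: "f \<in> F \<Longrightarrow> \<pi> f \<in> F" "f \<in> F \<Longrightarrow> \<pi> (\<pi> f) = f"
    and fix0: "f \<in> F \<Longrightarrow> \<pi> f = f \<Longrightarrow> \<beta> f = 0"
begin

definition sc :: "'i \<Rightarrow> 'i \<Rightarrow> 'i \<Rightarrow> real" where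
  "sc i j k = (if i = X \<and> j \<in> F \<and> k = \<pi> j then \<beta> j else if j = X \<and> i \<in> F \<and> k = \<pi> i then - \<beta> i else 0)"

lemma sc_values:
  "f \<in> F \<Longrightarrow> sc X f k = (if k = \<pi> f then \<beta> f else 0)"
  "f \<in> F \<Longrightarrow> sc f X k = (if k = \<pi> f then - \<beta> f else 0)"
  "f \<in> F \<Longrightarrow> g \<in> F \<Longrightarrow> sc f g k = 0"
  "sc X X k = 0" "sc i j X = 0"
  using X pi by (auto simp: sc_def)

text \<open>The action \<open>D\<close> has entries \<open>\<beta> f\<close> and
  \<open>\<beta> (\<pi> f)\<close> in transposed positions and zero trace, so this is minus the
  squared norm of its symmetric part.\<close>

lemma Sc_sc: "Sc (insert X F) sc = - (\<Sum>f\<in>F. (\<beta> f + \<beta> (\<pi> f))\<^sup>2) / 4"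
proof -
  let ?I = "insert X F"
  have s: "(\<Sum>i\<in>?I. g i) = g X + (\<Sum>i\<in>F. g i)" for g :: "'i \<Rightarrow> real" using fin X by simp
  have d: "(\<Sum>k\<in>F. if k = \<pi> f then g k else 0) = g (\<pi> f)" if "f \<in> F" for f and g :: "'i \<Rightarrow> real"
    using fin pi(1)[OF that] by simp
  have anti: "sc i j k = - sc j i k" for i j k using X by (auto simp: sc_def)
  have P: "(\<Sum>i\<in>?I. \<Sum>j\<in>?I. \<Sum>k\<in>?I. (sc i j k)\<^sup>2) = 2 * (\<Sum>f\<in>F. (\<beta> f)\<^sup>2)"
  proof -
    have "(\<Sum>k\<in>F. (if k = \<pi> f then x else 0)\<^sup>2) = x\<^sup>2" if "f \<in> F" for f and x :: real
      using d[OF that, of "\<lambda>_. x\<^sup>2"] by (simp add: if_distrib[of "\<lambda>x. x\<^sup>2"] cong: if_cong)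
    then show ?thesis unfolding s by (simp add: sc_values)
  qed
  have Q: "(\<Sum>i\<in>?I. \<Sum>j\<in>?I. \<Sum>k\<in>?I. sc i j k * sc i k j) = (\<Sum>f\<in>F. \<beta> f * \<beta> (\<pi> f))"
  proof -
    have "(\<Sum>k\<in>F. sc X f k * sc X k f) = \<beta> f * \<beta> (\<pi> f)" if f: "f \<in> F" for f
    proof -
      have "(\<Sum>k\<in>F. sc X f k * sc X k f) = (\<Sum>k\<in>F. if k = \<pi> f then \<beta> f * \<beta> (\<pi> f) else 0)"
        using f pi by (intro sum.cong) (auto simp: sc_values)
      then show ?thesis using d[OF f] by simp
    qed
    then show ?thesis unfolding s by (simp add: sc_values)
  qed
  have H: "(\<Sum>j\<in>?I. sc i j j) = 0" if "i \<in> ?I" for i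
  proof -
    have "sc X j j = 0" if "j \<in> F" for j using fix0[OF that] by (auto simp: sc_values that)
    then show ?thesis unfolding s using that by (auto simp: sc_values)
  qed
  have pr: "(\<Sum>f\<in>F. (\<beta> (\<pi> f))\<^sup>2) = (\<Sum>f\<in>F. (\<beta> f)\<^sup>2)"
    by (rule sum.reindex_bij_witness[of _ \<pi> \<pi>]) (auto simp: pi)
  have "(\<Sum>f\<in>F. (\<beta> f + \<beta> (\<pi> f))\<^sup>2) = 2 * (\<Sum>f\<in>F. (\<beta> f)\<^sup>2) + 2 * (\<Sum>f\<in>F. \<beta> f * \<beta> (\<pi> f))"
    by (simp add: power2_sum sum.distrib pr sum_distrib_left mult.assoc)
  moreover have "(\<Sum>i\<in>?I. (\<Sum>j\<in>?I. sc i j j)\<^sup>2) = 0" using H by (intro sum.neutral) auto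
  ultimately show ?thesis unfolding Sc_formula[OF anti] P Q by simp
qed

text \<open>A diagonal entry of half the commutator of the action with its transpose, the part of
  the Ricci form that is linear in the deviation from skewness.\<close>

lemma Rc_sc:
  assumes f: "f \<in> F" and ne: "\<pi> f \<noteq> f"
  shows "Rc (insert X F) sc f f = ((\<beta> (\<pi> f))\<^sup>2 - (\<beta> f)\<^sup>2) / 2"
proof -
  let ?I = "insert X F" and ?p = "\<pi> f"
  have p: "?p \<in> F" "\<pi> ?p = f" "?p \<noteq> X" using f pi X by auto
  let ?E = "\<lambda>i m. Gam sc f f m * Gam sc i m i - Gam sc i f m * Gam sc f m i - sc i f m * Gam sc m f i"
  have sym: "f = \<pi> m \<longleftrightarrow> m = ?p" if "m \<in> F" for m using that f pi by auto
  have z1: "Gam sc i j k = 0" if "i \<in> F" "j \<in> F" "k \<in> F" for i j k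
    using that by (simp add: Gam_def sc_values)
  have z2: "Gam sc f f X = 0" using f ne by (simp add: Gam_def sc_values)
  \<comment> \<open>Of the double sum only the index pairs \<open>(X, \<pi> f)\<close> and
    \<open>(\<pi> f, X)\<close> survive.\<close>
  have E0: "?E i m = 0" if i: "i \<in> ?I" and m: "m \<in> ?I" and no: "\<not> (i = X \<and> m = ?p)" "\<not> (i = ?p \<and> m = X)" for i m
  proof -
    consider "i \<in> F" "m \<in> F" | "i \<in> F" "m = X" | "i = X" "m \<in> F" | "i = X" "m = X" using i m by auto
    then show ?thesis
    proof cases
      case 1 then show ?thesis using f by (simp add: z1 sc_values)
    next
      case 2
      then have "Gam sc i f X = 0" using f no sym[of i] by (simp add: Gam_def sc_values)
      then show ?thesis using 2 by (simp add: z2 sc_values)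
    next
      case 3
      then have "Gam sc X f m = 0" "sc X f m = 0" using f no sym[of m] by (simp_all add: Gam_def sc_values)
      then show ?thesis using 3 f by (simp add: z1)
    next
      case 4
      have "Gam sc X f X = 0" using f by (simp add: Gam_def sc_values)
      then show ?thesis using 4 f by (simp add: z2 sc_values)
    qed
  qed
  have "Rc ?I sc f f = (\<Sum>i\<in>?I. \<Sum>m\<in>?I. ?E i m)" by (simp only: Rc_def Rm_def)
  also have "\<dots> = (\<Sum>i\<in>?I. if i = X then ?E X ?p else if i = ?p then ?E ?p X else 0)"
  proof (rule sum.cong[OF refl])
    fix i assume i: "i \<in> ?I"
    have "(\<Sum>m\<in>?I. ?E i m) = (\<Sum>m\<in>?I. if m = (if i = X then ?p else X) then
        (if i = X then ?E X ?p else if i = ?p then ?E ?p X else 0) else 0)"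
      using E0[OF i] p(3) by (intro sum.cong) auto
    then show "(\<Sum>m\<in>?I. ?E i m) = (if i = X then ?E X ?p else if i = ?p then ?E ?p X else 0)"
      using fin p by simp
  qed
  also have "\<dots> = ?E X ?p + ?E ?p X"
  proof -
    have "(\<Sum>i\<in>F. if i = X then ?E X ?p else if i = ?p then ?E ?p X else 0) = (\<Sum>i\<in>F. if i = ?p then ?E ?p X else 0)"
      using X by (intro sum.cong) auto
    then show ?thesis using fin X p(1) by simp
  qed
  also have "\<dots> = ((\<beta> ?p)\<^sup>2 - (\<beta> f)\<^sup>2) / 2"
    using f p ne z1 z2 by (simp add: Gam_def sc_values power2_eq_square field_simps)
  finally show ?thesis .
qed

end

text \<open>A single operator is a module over the abelian algebra \<open>real\<close>, which gives
  it a block flag of its own.\<close>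

lemma solvable_chain_real: "solvable_chain (\<lambda>x y. 0) (UNIV :: real set)"
proof -
  have "span (insert 1 {0}) = (UNIV :: real set)"
  proof -
    have "x \<in> span (insert 1 {0})" for x :: real
    proof -
      have "x *\<^sub>R 1 \<in> span (insert (1::real) {0})" by (intro span_scale span_base) simp
      then show ?thesis by (simp only: real_scaleR_def mult_1_right)
    qed
    then show ?thesis by blast
  qed
  moreover have "solvable_chain (\<lambda>x y. 0) (span (insert (1::real) {0}))"
    by (rule solvable_chain.insert[OF solvable_chain.zero]) simp
  ultimately show ?thesis by simp
qed

text \<open>Rescaling a flag basis by \<open>s ^ (N + lv f)\<close> and letting \<open>s\<close> tend to 0 degenerates the bracket
  to a semidirect product in which \<open>X\<close> acts by the diagonal blocks only; the factor \<open>\<sigma>\<close> makes these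
  blocks slightly non-normal. Then the scalar curvature is quadratic, but the Ricci operator only
  linear, in the deviation of \<open>\<tau>\<close> from 1.\<close>

lemma pinching_collapse:
  fixes br :: "'e::euclidean_space \<Rightarrow> 'e \<Rightarrow> 'e"
  assumes lie: "lie_algebra br" and sol: "solvable_chain br UNIV"
    and im: "\<And>z. complex_eigenvalue (br X) z \<Longrightarrow> Re z = 0" and nonnil: "\<not> nilpotent_op (br X)"
    and eps: "\<epsilon> > 0"
  obtains h where "inner_form h" "tr (metric_lie_algebra.Rop br h \<circ> metric_lie_algebra.Rop br h) > 0"
    "(tr (metric_lie_algebra.Rop br h))\<^sup>2 / tr (metric_lie_algebra.Rop br h \<circ> metric_lie_algebra.Rop br h) < \<epsilon>"
proof -
  interpret lie_algebra br by fact
  let ?T = "br X"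
  have T: "linear ?T" by (rule br_linear)
  define D where "D = span {br x y | x y. True}"
  have brD: "br x y \<in> D" for x y unfolding D_def by (intro span_base) blast
  \<comment> \<open>All weights vanish on the derived algebra, so \<open>ad X\<close> would be
    nilpotent for \<open>X\<close> in it.\<close>
  have XD: "X \<notin> D"
  proof
    assume XD: "X \<in> D"
    have "lie_module br br UNIV" by (simp add: lie_module_def br_linear br_linear_left ad_bracket)
    from block_flag_exists[OF sol this] obtain F lv \<pi> a b where fl: "block_flag br br UNIV F lv \<pi> a b" by blast
    have la: "\<And>f. f \<in> F \<Longrightarrow> linear (a f)" "\<And>f. f \<in> F \<Longrightarrow> linear (b f)"
      and br0: "\<And>f x y. f \<in> F \<Longrightarrow> a f (br x y) = 0 \<and> b f (br x y) = 0"
      using fl by (auto simp: block_flag_def)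
    have "D \<subseteq> {x. \<forall>f\<in>F. a f x = 0 \<and> b f x = 0}" unfolding D_def
      using la br0 by (intro span_minimal) (auto simp: subspace_def linear_add linear_scale linear_0)
    then have "\<exists>k. \<forall>w\<in>UNIV. (?T ^^ k) w = 0"
      using XD by (intro flagged_operator.nilpotent_on[OF block_flag_operator[OF fl br_linear]]) auto
    then show False using nonnil by (simp add: nilpotent_op_def)
  qed
  obtain y z where yz: "y \<in> span D" "\<And>w. w \<in> span D \<Longrightarrow> orthogonal z w" "X = y + z"
    using orthogonal_subspace_decomp_exists[of D X] by metis
  have sD: "span D = D" unfolding D_def by (rule span_span)
  have z0: "z \<noteq> 0" using yz(1,3) XD sD by auto
  have zX: "z \<bullet> X = z \<bullet> z" using yz(1,2) by (simp add: yz(3) inner_add_right orthogonal_def)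
  \<comment> \<open>A hyperplane that contains all brackets but not \<open>X\<close>: an ideal
    complementary to the line through \<open>X\<close>.\<close>
  define W where "W = {v. z \<bullet> v = 0}"
  have W: "subspace W" unfolding W_def by (auto simp: subspace_def inner_add_right)
  have XW: "X \<notin> W" unfolding W_def using zX z0 by simp
  have brW: "br x y \<in> W" for x y using yz(2) sD brD unfolding W_def orthogonal_def by auto
  let ?\<rho> = "\<lambda>(t::real) w. t *\<^sub>R ?T w"
  have "lie_module (\<lambda>x y. 0) ?\<rho> W"
    unfolding lie_module_def using W brW
    by (auto intro!: linearI subspace_scale simp: br_simps algebra_simps)
  from block_flag_exists[OF solvable_chain_real this]
  obtain F lv \<pi> a0 b0 where fl: "block_flag (\<lambda>x y. 0) ?\<rho> W F lv \<pi> a0 b0" by blast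
  have l1: "linear (?\<rho> 1)" by (auto intro!: linearI simp: br_simps)
  define b where "b f = b0 f 1" for f
  have "flagged_operator (?\<rho> 1) W F lv \<pi> (\<lambda>f. a0 f 1) b"
    unfolding b_def[abs_def] by (rule block_flag_operator[OF fl l1])
  then interpret fo: flagged_operator ?T W F lv \<pi> "\<lambda>f. a0 f 1" b by simp
  have a0: "a0 f 1 = 0" if f: "f \<in> F" for f
  proof -
    have "complex_eigenvalue ?T (Complex (a0 f 1) (b f))"
      unfolding complex_eigenvalue_cmap using fo.weight_is_eigenvalue[OF f] by blast
    from im[OF this] show ?thesis by simp
  qed
  \<comment> \<open>If all \<open>b f\<close> vanished, \<open>ad X\<close> would be nilpotent on
    \<open>W\<close>; as its image lies in \<open>W\<close>, one more power would kill
    everything.\<close>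
  have "\<exists>f\<in>F. b f \<noteq> 0"
  proof (rule ccontr)
    assume "\<not> (\<exists>f\<in>F. b f \<noteq> 0)"
    then obtain k where k: "\<And>w. w \<in> W \<Longrightarrow> (?T ^^ k) w = 0" using fo.nilpotent_on a0 by blast
    have "(?T ^^ Suc k) v = 0" for v using k[OF brW] by (simp add: funpow_swap1)
    then show False using nonnil unfolding nilpotent_op_def by blast
  qed
  then obtain f0 where f0: "f0 \<in> F" "b f0 > 0"
    using fo.pi(1,5) by (metis linorder_neqE_linordered_idom neg_0_less_iff_less)
  have ne0: "\<pi> f0 \<noteq> f0" using fo.pi(5)[OF f0(1)] f0(2) by auto
  define B where "B = (\<Sum>f\<in>F. (b f)\<^sup>2)"
  \<comment> \<open>\<open>K * \<delta>\<^sup>2\<close> is the bound obtained below for the limit of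
    the functional, and \<open>\<eta>\<close> is chosen so that
    \<open>4 * \<eta>\<^sup>2 * K\<close> stays below half of \<open>\<epsilon>\<close>.\<close>
  define K where "K = B\<^sup>2 / (4 * (b f0) ^ 4)"
  have K: "K \<ge> 0" by (simp add: K_def)
  define \<eta> where "\<eta> = sqrt (\<epsilon> / (8 * (K + 1)))"
  have \<eta>: "\<eta> > 0" "4 * \<eta>\<^sup>2 * K < \<epsilon>"
  proof -
    show "\<eta> > 0" using eps K by (simp add: \<eta>_def)
    have "4 * \<eta>\<^sup>2 * K = \<epsilon> * (K / (2 * (K + 1)))" using eps K by (simp add: \<eta>_def field_simps)
    also have "\<dots> < \<epsilon> * 1" using eps K by (intro mult_strict_left_mono) (simp_all add: divide_less_eq)
    finally show "4 * \<eta>\<^sup>2 * K < \<epsilon>" by simp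
  qed
  define \<tau> where "\<tau> = 1 + \<eta>"
  have \<tau>: "\<tau> > 1" using \<eta> by (simp add: \<tau>_def)
  define \<sigma> where "\<sigma> f = (if b f > 0 then \<tau> else 1)" for f
  have \<sigma>: "\<sigma> f > 0" for f using \<tau> by (simp add: \<sigma>_def)
  \<comment> \<open>The coefficient of \<open>ad X\<close> between
    \<open>\<sigma> f *\<^sub>R f\<close> and its rescaled partner. A factor equal on both partners
    would cancel, so \<open>\<sigma>\<close> distinguishes them by the sign of
    \<open>b\<close>.\<close>
  define \<beta> where "\<beta> f = b f * \<sigma> f / \<sigma> (\<pi> f)" for f
  interpret ps: paired_semidirect X F \<pi> \<beta>
  proof
    show "finite F" by (rule fo.fin)
    show "X \<notin> F" using XW fo.span span_superset by blast
    show "\<pi> f \<in> F" "\<pi> (\<pi> f) = f" if "f \<in> F" for f using fo.pi that by auto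
    show "\<beta> f = 0" if "f \<in> F" "\<pi> f = f" for f using fo.pi(5)[OF that(1)] that(2) by (simp add: \<beta>_def)
  qed
  let ?I = "insert X F"
  have FW: "F \<subseteq> W" using fo.span span_superset by blast
  have indI: "independent ?I" using fo.ind XW fo.span by (intro independent_insertI) auto
  have spI: "span ?I = UNIV"
  proof -
    have "v \<in> span ?I" for v
    proof -
      let ?t = "(z \<bullet> v) / (z \<bullet> X)"
      have "v - ?t *\<^sub>R X \<in> W" unfolding W_def using zX z0 by (simp add: inner_diff_right)
      then show ?thesis using fo.span span_breakdown_eq by blast
    qed
    then show ?thesis by blast
  qed
  have finI: "finite ?I" using fo.fin by simp
  let ?r = "representation ?I"
  have rF: "?r w k = representation F w k" if "w \<in> W" for w k
    using representation_extend[OF indI, of w F] that fo.span by (simp add: subset_insertI)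
  have rX: "?r w X = 0" if "w \<in> W" for w
    using rF[OF that] ps.X representation_ne_zero[of F w X] by auto
  \<comment> \<open>Exceeds all levels, so that a bracket of two vectors of \<open>F\<close> keeps a
    positive power of \<open>s\<close> whatever component it is projected to.\<close>
  define N where "N = Suc (Max (insert 0 (lv ` F)))"
  have N: "lv f < N" if "f \<in> F" for f
    using that fo.fin by (simp add: N_def less_Suc_eq_le)
  define s where "s n = inverse (real (Suc n))" for n :: nat
  have s: "s n > 0" for n by (simp add: s_def)
  have s0: "s \<longlonglongrightarrow> 0" unfolding s_def by (rule LIMSEQ_inverse_real_of_nat)
  define w where "w n i = (if i = X then 1 else s n ^ (N + lv i) * \<sigma> i)" for n i
  have w: "w n i > 0" for n i using s \<sigma> by (simp add: w_def)
  define h where "h n u v = (\<Sum>i\<in>?I. (?r u i / w n i) * (?r v i / w n i))" for n u v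
  define e where "e n i = w n i *\<^sub>R i" for n i
  have hf: "inner_form (h n)" and fr: "frame (h n) ?I (e n)" for n
    using weighted_basis_inner_form(1,2)[OF finI indI spI, of "w n"] w unfolding h_def[abs_def] e_def[abs_def] by auto
  define c where "c n i j k = h n (br (e n i) (e n j)) (e n k)" for n i j k
  have c_eq: "c n i j k = w n i * w n j / w n k * ?r (br i j) k" if "i \<in> ?I" "j \<in> ?I" "k \<in> ?I" for n i j k
  proof -
    have "c n i j k = ?r (br (e n i) (e n j)) k / w n k"
      unfolding c_def h_def e_def[of n k]
      by (rule weighted_basis_inner_form(3)[OF finI indI spI w that(3)])
    also have "?r (br (e n i) (e n j)) k = w n i * w n j * ?r (br i j) k"
      using representation_scale[OF indI] spI by (simp add: e_def br_simps)
    finally show ?thesis by simp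
  qed
  have pow0: "(\<lambda>n. s n ^ m * x) \<longlonglongrightarrow> 0" if "m > 0" for m and x :: real
    using tendsto_mult[OF tendsto_power[OF s0, of m] tendsto_const, of x] that by (simp add: zero_power)
  have lim: "(\<lambda>n. c n i j k) \<longlonglongrightarrow> ps.sc i j k" if ijk: "i \<in> ?I" "j \<in> ?I" "k \<in> ?I" for i j k
  proof -
    have TX: "(\<lambda>n. c n X f k) \<longlonglongrightarrow> ps.sc X f k" if f: "f \<in> F" and k: "k \<in> F" for f k
    proof -
      have kX: "k \<noteq> X" "f \<noteq> X" using ps.X f k by auto
      have cc: "c n X f k = (s n ^ (N + lv f) * \<sigma> f) / (s n ^ (N + lv k) * \<sigma> k) * fo.rep (?T f) k" for n
        using c_eq[of X f k n] f k kX rF[OF brW] by (simp add: w_def)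
      have rT: "fo.rep (?T f) k = (if k = \<pi> f then b f else 0)" if "lv f \<le> lv k"
      proof -
        have fV: "f \<in> fo.V (Suc (lv k))" using f that by (intro fo.F_V) auto
        have "fo.rep (?T f) k = a0 k 1 * fo.rep f k - b k * fo.rep f (\<pi> k)"
          by (rule fo.rep_T[OF k refl fV])
        then show ?thesis using a0[OF k] fo.rep_base[OF f] fo.pi[OF f] fo.pi[OF k] by auto
      qed
      show ?thesis
      proof (cases "lv k < lv f")
        \<comment> \<open>Components in strictly lower levels carry a positive power of
          \<open>s\<close> and disappear in the limit.\<close>
        case True
        then have "k \<noteq> \<pi> f" using fo.pi(3)[OF f] by auto
        then have sc0: "ps.sc X f k = 0" using f by (simp add: ps.sc_values)
        have cs: "c n X f k = s n ^ (lv f - lv k) * (\<sigma> f / \<sigma> k * fo.rep (?T f) k)" for n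
        proof -
          have "s n ^ (N + lv f) = s n ^ (N + lv k) * s n ^ (lv f - lv k)"
            using True by (simp add: power_add[symmetric])
          then show ?thesis unfolding cc using s[of n] \<sigma>[of k] by simp
        qed
        show ?thesis unfolding sc0 cs by (rule pow0) (use True in simp)
      next
        \<comment> \<open>Within a level the powers of \<open>s\<close> cancel and the block entry
          remains for every \<open>n\<close>; higher levels do not occur by triangularity.\<close>
        case False
        then have rT': "fo.rep (?T f) k = (if k = \<pi> f then b f else 0)" using rT by simp
        have "c n X f k = ps.sc X f k" for n
        proof (cases "k = \<pi> f")
          case True
          then show ?thesis unfolding cc rT' using s[of n] f fo.pi(3)[OF f]
            by (simp add: ps.sc_values \<beta>_def)
        qed (simp add: cc rT' ps.sc_values f)
        then show ?thesis by simp
      qed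
    qed
    have anti: "c n i j k = - c n j i k" for n i j k
    proof -
      interpret inner_form "h n" by (rule hf)
      show ?thesis unfolding c_def using br_antisym[of "e n i" "e n j"] by (simp add: h_simps)
    qed
    show ?thesis
    proof (cases "k = X")
      case True
      then have "c n i j k = 0" for n using c_eq[OF ijk] rX[OF brW] by simp
      then show ?thesis using True by (simp add: ps.sc_values)
    next
      case False
      then have k: "k \<in> F" using ijk by simp
      consider "i = X" "j = X" | "i = X" "j \<in> F" | "i \<in> F" "j = X" | "i \<in> F" "j \<in> F" using ijk by auto
      then show ?thesis
      proof cases
        case 1
        have "c n X X k = 0" for n using anti[of n X X k] by simp
        then show ?thesis using 1 by (simp add: ps.sc_values)
      next
        case 2
        then show ?thesis using TX k by simp
      next
        case 3
        have "(\<lambda>n. - c n X i k) \<longlonglongrightarrow> - ps.sc X i k" using TX[OF 3(1) k] by (rule tendsto_minus)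
        then have "(\<lambda>n. c n i X k) \<longlonglongrightarrow> - ps.sc X i k" by (simp add: anti[of _ i X])
        moreover have "ps.sc i X k = - ps.sc X i k" using 3 by (simp add: ps.sc_values)
        ultimately show ?thesis using 3(2) by simp
      next
        case 4
        then have ne: "i \<noteq> X" "j \<noteq> X" using ps.X by auto
        let ?m = "N + lv i + (N + lv j) - (N + lv k)"
        have m: "?m > 0" "N + lv i + (N + lv j) = (N + lv k) + ?m" using N[OF k] by auto
        have "c n i j k = s n ^ ?m * (\<sigma> i * \<sigma> j / \<sigma> k * ?r (br i j) k)" for n
        proof -
          have "s n ^ (N + lv i) * s n ^ (N + lv j) = s n ^ (N + lv k) * s n ^ ?m"
            unfolding power_add[symmetric] by (rule arg_cong[OF m(2)])
          then have ws: "w n i * w n j / w n k = s n ^ ?m * (\<sigma> i * \<sigma> j / \<sigma> k)"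
            using ne False s[of n] \<sigma>[of k] by (simp add: w_def field_simps)
          show ?thesis unfolding c_eq[OF ijk] ws by (simp only: mult.assoc)
        qed
        moreover have "ps.sc i j k = 0" using 4 by (simp add: ps.sc_values)
        ultimately show ?thesis using pow0[OF m(1)] by (simp only:)
      qed
    qed
  qed
  let ?S = "Sc ?I ps.sc" and ?R = "\<Sum>i\<in>?I. \<Sum>j\<in>?I. (Rc ?I ps.sc i j)\<^sup>2"
  have limS: "(\<lambda>n. Sc ?I (c n)) \<longlonglongrightarrow> ?S" by (rule tendsto_Sc[OF lim])
  have limR: "(\<lambda>n. \<Sum>i\<in>?I. \<Sum>j\<in>?I. (Rc ?I (c n) i j)\<^sup>2) \<longlonglongrightarrow> ?R"
    by (intro tendsto_sum tendsto_power tendsto_Rc[OF lim])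
  define \<delta> where "\<delta> = \<tau> - 1 / \<tau>"
  have \<delta>: "\<delta> > 0" "\<delta> \<le> 2 * \<eta>"
  proof -
    have "\<delta> = \<eta> * (2 + \<eta>) / (1 + \<eta>)" unfolding \<delta>_def \<tau>_def using \<eta>(1) by (simp add: field_simps)
    moreover have "(2 + \<eta>) \<le> 2 * (1 + \<eta>)" using \<eta>(1) by simp
    ultimately show "\<delta> > 0" "\<delta> \<le> 2 * \<eta>" using \<eta>(1) by (simp_all add: divide_le_eq)
  qed
  have bb: "(\<beta> f + \<beta> (\<pi> f))\<^sup>2 = (b f)\<^sup>2 * \<delta>\<^sup>2" if f: "f \<in> F" for f
  proof -
    have p: "b (\<pi> f) = - b f" "\<pi> (\<pi> f) = f" using fo.pi f by auto
    consider "b f > 0" | "b f < 0" | "b f = 0" by linarith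
    then show ?thesis
    proof cases
      case 1
      then have "\<beta> f + \<beta> (\<pi> f) = b f * \<delta>" by (simp add: \<beta>_def p \<sigma>_def \<delta>_def algebra_simps)
      then show ?thesis by (simp add: power_mult_distrib)
    next
      case 2
      then have "\<beta> f + \<beta> (\<pi> f) = - b f * \<delta>" by (simp add: \<beta>_def p \<sigma>_def \<delta>_def algebra_simps)
      then show ?thesis by (simp add: power_mult_distrib)
    next
      case 3
      then show ?thesis by (simp add: \<beta>_def p)
    qed
  qed
  have S: "?S = - B * \<delta>\<^sup>2 / 4"
    unfolding ps.Sc_sc B_def using bb by (simp add: sum_distrib_right)
  have Rf: "Rc ?I ps.sc f0 f0 = - (b f0)\<^sup>2 * (\<delta> * (\<tau> + 1 / \<tau>)) / 2"
  proof -
    have p: "b (\<pi> f0) = - b f0" "\<pi> (\<pi> f0) = f0" using fo.pi f0 by auto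
    have be: "\<beta> f0 = b f0 * \<tau>" "\<beta> (\<pi> f0) = - b f0 / \<tau>"
      using f0(2) p by (simp_all add: \<beta>_def \<sigma>_def)
    show ?thesis unfolding ps.Rc_sc[OF f0(1) ne0] \<delta>_def be using \<tau> by (simp add: field_simps power2_eq_square)
  qed
  have Rge: "(b f0) ^ 4 * \<delta>\<^sup>2 / 4 \<le> ?R"
  proof -
    \<comment> \<open>One diagonal Ricci entry suffices, and it is linear in \<open>\<delta>\<close>
      because the cofactor \<open>\<tau> + 1 / \<tau>\<close> stays away from 0.\<close>
    have "1 \<le> \<tau> + 1 / \<tau>" using \<tau> by (simp add: add_increasing2)
    then have "\<delta> * 1 \<le> \<delta> * (\<tau> + 1 / \<tau>)" using \<delta>(1) by (intro mult_left_mono) auto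
    then have "\<delta>\<^sup>2 \<le> (\<delta> * (\<tau> + 1 / \<tau>))\<^sup>2" using \<delta>(1) by (intro power_mono) auto
    then have "(b f0) ^ 4 * \<delta>\<^sup>2 / 4 \<le> (b f0) ^ 4 * (\<delta> * (\<tau> + 1 / \<tau>))\<^sup>2 / 4"
      by (intro divide_right_mono mult_left_mono) auto
    also have "\<dots> = (Rc ?I ps.sc f0 f0)\<^sup>2" unfolding Rf by (simp add: power_mult_distrib power_divide)
    also have "\<dots> \<le> (\<Sum>j\<in>?I. (Rc ?I ps.sc f0 j)\<^sup>2)"
      using f0 finI by (intro member_le_sum[of f0 ?I "\<lambda>j. (Rc ?I ps.sc f0 j)\<^sup>2"]) auto
    also have "\<dots> \<le> ?R"
      using f0 finI by (intro member_le_sum[of f0 ?I "\<lambda>i. \<Sum>j\<in>?I. (Rc ?I ps.sc i j)\<^sup>2"]) (auto intro: sum_nonneg)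
    finally show ?thesis .
  qed
  have low: "(b f0) ^ 4 * \<delta>\<^sup>2 / 4 > 0" using f0 \<delta> by simp
  have Rpos: "?R > 0" using low Rge by (rule less_le_trans)
  have "?S\<^sup>2 / ?R \<le> ?S\<^sup>2 / ((b f0) ^ 4 * \<delta>\<^sup>2 / 4)"
    using low Rge Rpos by (intro divide_left_mono mult_pos_pos) auto
  also have "\<dots> = K * \<delta>\<^sup>2"
    unfolding S K_def using f0(2) \<delta>(1) by (simp add: field_simps power2_eq_square power4_eq_xxxx)
  also have "\<dots> \<le> K * (2 * \<eta>)\<^sup>2" using \<delta> K by (intro mult_left_mono power_mono) auto
  also have "\<dots> < \<epsilon>" using \<eta>(2) by (simp add: power_mult_distrib mult.commute)
  finally have lt: "?S\<^sup>2 / ?R < \<epsilon>" .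
  \<comment> \<open>The limit algebra has nonzero Ricci form, so the quotient is continuous there
    and some metric of the sequence already lies below \<open>\<epsilon>\<close>.\<close>
  have "(\<lambda>n. (Sc ?I (c n))\<^sup>2 / (\<Sum>i\<in>?I. \<Sum>j\<in>?I. (Rc ?I (c n) i j)\<^sup>2)) \<longlonglongrightarrow> ?S\<^sup>2 / ?R"
    using Rpos by (intro tendsto_divide tendsto_power limS limR) simp
  from order_tendstoD(2)[OF this lt] order_tendstoD(1)[OF limR Rpos]
  have "eventually (\<lambda>n. (Sc ?I (c n))\<^sup>2 / (\<Sum>i\<in>?I. \<Sum>j\<in>?I. (Rc ?I (c n) i j)\<^sup>2) < \<epsilon> \<and>
      0 < (\<Sum>i\<in>?I. \<Sum>j\<in>?I. (Rc ?I (c n) i j)\<^sup>2)) sequentially"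
    by (rule eventually_conj)
  then obtain n where n: "(Sc ?I (c n))\<^sup>2 / (\<Sum>i\<in>?I. \<Sum>j\<in>?I. (Rc ?I (c n) i j)\<^sup>2) < \<epsilon>"
      "0 < (\<Sum>i\<in>?I. \<Sum>j\<in>?I. (Rc ?I (c n) i j)\<^sup>2)"
    using eventually_happens[of _ sequentially] by auto
  interpret m: metric_lie_algebra br "h n" using lie hf by (simp add: metric_lie_algebra_def)
  have "tr m.Rop = Sc ?I (c n)" unfolding c_def[abs_def] by (rule m.tr_Rop_Sc[OF fr])
  moreover have "tr (m.Rop \<circ> m.Rop) = (\<Sum>i\<in>?I. \<Sum>j\<in>?I. (Rc ?I (c n) i j)\<^sup>2)"
    unfolding c_def[abs_def] m.tr_Rop_sq[OF fr] m.ricf_Rc[OF fr] by (rule refl)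
  ultimately show ?thesis using that[OF hf[of n]] n by simp
qed


section \<open>Real type and the pinching functional\<close>

text \<open>Any subspace between consecutive members contains the brackets of the larger one, so the
  chain can be refined by adding basis vectors one at a time, starting from its end.\<close>

lemma derived_series_solvable_chain:
  fixes br :: "'e::euclidean_space \<Rightarrow> 'e \<Rightarrow> 'e"
  assumes D: "D 0 = UNIV" "D n = {0}" "\<And>i. subspace (D i)" "\<And>i. D (Suc i) \<subseteq> D i"
    and br: "\<And>i u v. u \<in> D i \<Longrightarrow> v \<in> D i \<Longrightarrow> br u v \<in> D (Suc i)"
  shows "solvable_chain br UNIV"
proof -
  have step: "solvable_chain br (D i)" if K: "solvable_chain br (D (Suc i))" for i
  proof -
    obtain S where S: "S \<subseteq> D i" "independent S" "D i \<subseteq> span S" using maximal_independent_subset by blast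
    have "finite S" using S(2) independent_bound by blast
    then have "S \<subseteq> D i \<Longrightarrow> solvable_chain br (span (S \<union> D (Suc i)))"
    proof (induction S)
      case empty
      then show ?case using K D(3) by (simp add: span_eq_iff[THEN iffD2])
    next
      case (insert x S)
      have "span (S \<union> D (Suc i)) \<subseteq> D i" using insert.prems D(3,4) by (intro span_minimal) auto
      then have "br y x \<in> span (S \<union> D (Suc i))" if "y \<in> span (S \<union> D (Suc i))" for y
        using br[of y i x] that insert.prems by (intro span_base) auto
      then have "solvable_chain br (span (insert x (span (S \<union> D (Suc i)))))"
        using insert by (intro solvable_chain.insert) auto
      moreover have "span (insert x (span (S \<union> D (Suc i)))) = span (insert x S \<union> D (Suc i))"
        by (simp add: span_insert[of x] span_span)
      ultimately show ?case by simp
    qed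
    moreover have "span (S \<union> D (Suc i)) = D i"
    proof
      show "span (S \<union> D (Suc i)) \<subseteq> D i" using S(1) D(3,4) by (intro span_minimal) auto
      show "D i \<subseteq> span (S \<union> D (Suc i))" using S(3) span_mono[of S "S \<union> D (Suc i)"] by blast
    qed
    ultimately show ?thesis using S(1) by simp
  qed
  have "i \<le> n \<Longrightarrow> solvable_chain br (D (n - i))" for i
  proof (induction i)
    case 0
    then show ?case using D(2) solvable_chain.zero by simp
  next
    case (Suc i)
    then have "Suc (n - Suc i) = n - i" by simp
    then show ?case using step[of "n - Suc i"] Suc by simp
  qed
  from this[of n] show ?thesis using D(1) by simp
qed

context left_metric
begin

text \<open>Curvature is quadratic in the bracket, whose square is at most \<open>?x\<close>, so
  components are at most \<open>6 * n * ?x\<close>. The powers of \<open>n\<close> count indices: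
  \<open>n ^ 4\<close> squared components give \<open>36 * n ^ 6 * ?x\<^sup>2\<close>, and so do the
  \<open>n\<^sup>2\<close> squared Ricci entries.\<close>

lemma curvature_bounds:
  assumes C: "C \<ge> 0" "\<forall>u v w. g \<one> u u = 1 \<longrightarrow> g \<one> v v = 1 \<longrightarrow> g \<one> w w = 1 \<longrightarrow>
      (g \<one> (lb u v) w)\<^sup>2 \<le> C * (- tr Rop)"
  defines "n \<equiv> real DIM('b)"
  shows "riem_norm A g p \<le> 6 * n ^ 3 * C * \<bar>tr Rop\<bar>"
    and "tr (Rop \<circ> Rop) \<le> 36 * n ^ 6 * C\<^sup>2 * (tr Rop)\<^sup>2"
    and "\<not> flat A g \<Longrightarrow> tr Rop \<noteq> 0"
    and "tr Rop \<noteq> 0 \<Longrightarrow> tr (Rop \<circ> Rop) > 0"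
proof -
  let ?x = "C * \<bar>tr Rop\<bar>"
  have x0: "?x \<ge> 0" using C(1) by simp
  have key: "\<bar>Rm B (cst (\<lambda>x. x)) u v w z\<bar> \<le> n * (6 * ?x)" and card: "real (card B) = n" and fin: "finite B"
    if B: "orthonormal_basis (g \<one>) B" and uvwz: "u \<in> B" "v \<in> B" "w \<in> B" "z \<in> B" for B u v w z
  proof -
    have o: "ortho (g \<one>) B" "span B = UNIV" using B by (auto simp: orthonormal_basis_ortho)
    show fin: "finite B" using ortho_finite[OF o(1)] .
    show card: "real (card B) = n" unfolding n_def
      using dim_eq_card_independent[OF ortho_independent[OF o(1)]] dim_span[of B] o(2) dim_UNIV by metis
    have "\<bar>g \<one> (lb i j) k\<bar> \<le> sqrt ?x" if "i \<in> B" "j \<in> B" "k \<in> B" for i j k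
    proof -
      have "(g \<one> (lb i j) k)\<^sup>2 \<le> C * (- tr Rop)"
        using o(1) that by (intro C(2)[rule_format]) (auto simp: ortho_def)
      also have "\<dots> \<le> ?x" using C(1) by (intro mult_left_mono) auto
      finally show ?thesis using real_sqrt_le_mono by (metis real_sqrt_abs)
    qed
    from curvature_component_bound[OF fin this uvwz]
    show "\<bar>Rm B (cst (\<lambda>x. x)) u v w z\<bar> \<le> n * (6 * ?x)" using x0 card by simp
  qed
  have cv: "g \<one> (curv u v w) (curv u v w) \<le> n * (n * (6 * ?x))\<^sup>2"
    if B: "orthonormal_basis (g \<one>) B" and uvw: "u \<in> B" "v \<in> B" "w \<in> B" for B u v w
  proof -
    note fr = frame_id[OF B]
    have "g \<one> (curv u v w) (curv u v w) = (\<Sum>z\<in>B. (Rm B (cst (\<lambda>x. x)) u v w z)\<^sup>2)"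
      using arg_cong[OF frame_expand[OF fr, of "curv u v w"], of "g \<one> (curv u v w)"]
      by (simp only: h_simps real_scaleR_def curv_frame[OF fr] power2_eq_square)
    also have "\<dots> \<le> (\<Sum>z\<in>B. (n * (6 * ?x))\<^sup>2)"
      using key[OF B uvw] by (intro sum_mono) (metis abs_ge_zero power2_abs power_mono)
    also have "\<dots> = n * (n * (6 * ?x))\<^sup>2" using card[OF B uvw(1,1,1,1)] by simp
    finally show ?thesis .
  qed
  obtain B where B: "orthonormal_basis (g \<one>) B"
    and norm: "riem_norm A g p = sqrt (\<Sum>u\<in>B. \<Sum>v\<in>B. \<Sum>w\<in>B. g \<one> (curv u v w) (curv u v w))"
    using riem_norm_eq by blast
  note fr = frame_id[OF B]
  have ne: "B \<noteq> {}"
  proof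
    assume "B = {}"
    then have "(UNIV :: 'b set) = {0}" using B by (simp add: orthonormal_basis_def)
    then show False using nonempty_Basis nonzero_Basis by blast
  qed
  then obtain b0 where b0: "b0 \<in> B" by blast
  have cB: "real (card B) = n" and fB: "finite B" using card[OF B b0 b0 b0 b0] fin[OF B b0 b0 b0 b0] .
  have "(\<Sum>u\<in>B. \<Sum>v\<in>B. \<Sum>w\<in>B. g \<one> (curv u v w) (curv u v w)) \<le> (\<Sum>u\<in>B. \<Sum>v\<in>B. \<Sum>w\<in>B. n * (n * (6 * ?x))\<^sup>2)"
    by (intro sum_mono cv[OF B])
  also have "\<dots> = (6 * n ^ 3 * C * \<bar>tr Rop\<bar>)\<^sup>2" by (simp add: cB power2_eq_square power3_eq_cube)
  finally have "riem_norm A g p \<le> sqrt ((6 * n ^ 3 * C * \<bar>tr Rop\<bar>)\<^sup>2)" unfolding norm by (rule real_sqrt_le_mono)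
  then show "riem_norm A g p \<le> 6 * n ^ 3 * C * \<bar>tr Rop\<bar>"
    using C(1) by (simp add: n_def)
  have sq: "tr (Rop \<circ> Rop) = (\<Sum>i\<in>B. \<Sum>j\<in>B. (ricf i j)\<^sup>2)" by (rule tr_Rop_sq[OF fr])
  have "(ricf i j)\<^sup>2 \<le> (n * (n * (6 * ?x)))\<^sup>2" if ij: "i \<in> B" "j \<in> B" for i j
  proof -
    have "\<bar>ricf i j\<bar> \<le> (\<Sum>k\<in>B. \<bar>Rm B (cst (\<lambda>x. x)) k i j k\<bar>)"
      unfolding ricf_Rc[OF fr] Rc_def by (rule sum_abs)
    also have "\<dots> \<le> (\<Sum>k\<in>B. n * (6 * ?x))" using ij by (intro sum_mono key[OF B])
    also have "\<dots> = n * (n * (6 * ?x))" by (simp add: cB)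
    finally show ?thesis by (metis abs_ge_zero power2_abs power_mono)
  qed
  then have "tr (Rop \<circ> Rop) \<le> (\<Sum>i\<in>B. \<Sum>j\<in>B. (n * (n * (6 * ?x)))\<^sup>2)"
    unfolding sq by (intro sum_mono)
  also have "\<dots> = 36 * n ^ 6 * C\<^sup>2 * (tr Rop)\<^sup>2"
    by (simp add: cB power_mult_distrib power2_eq_square eval_nat_numeral)
  finally show "tr (Rop \<circ> Rop) \<le> 36 * n ^ 6 * C\<^sup>2 * (tr Rop)\<^sup>2" .
  show "tr Rop \<noteq> 0" if "\<not> flat A g"
  proof
    \<comment> \<open>With vanishing scalar curvature the bound kills the curvature on basis
      triples, hence everywhere by trilinearity.\<close>
    assume 0: "tr Rop = 0"
    have c0: "curv u v w = 0" if "u \<in> B" "v \<in> B" "w \<in> B" for u v w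
      using cv[OF B that] 0 h_nonneg[of "curv u v w"] h_eq_0[of "curv u v w"] by simp
    have sp: "span B = UNIV" using B by (simp add: orthonormal_basis_def)
    have c1: "curv u v w = 0" if "u \<in> B" "v \<in> B" for u v w
      using linear_eq_0_on_span[OF curv_linear3[of u v], of B w] c0[OF that] sp by auto
    have c2: "curv u v w = 0" if "u \<in> B" for u v w
      using linear_eq_0_on_span[OF curv_linear2[of u w], of B v] c1[OF that] sp by auto
    have "curv u v w = 0" for u v w
      using linear_eq_0_on_span[OF curv_linear1[of v w], of B u] c2 sp by auto
    then show False using that flat_iff by blast
  qed
  show "tr (Rop \<circ> Rop) > 0" if t: "tr Rop \<noteq> 0"
  proof -
    have "\<exists>i\<in>B. ricf i i \<noteq> 0"
    proof (rule ccontr)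
      assume "\<not> (\<exists>i\<in>B. ricf i i \<noteq> 0)"
      then have "(\<Sum>i\<in>B. ricf i i) = 0" by (intro sum.neutral) blast
      then show False using t tr_Rop[OF fr] by metis
    qed
    then obtain i where i: "i \<in> B" "ricf i i \<noteq> 0" by blast
    have "0 < (ricf i i)\<^sup>2" using i by simp
    also have "\<dots> \<le> (\<Sum>j\<in>B. (ricf i j)\<^sup>2)"
      using i fB by (intro member_le_sum[of i B "\<lambda>j. (ricf i j)\<^sup>2"]) auto
    also have "\<dots> \<le> (\<Sum>i\<in>B. \<Sum>j\<in>B. (ricf i j)\<^sup>2)"
      using i fB by (intro member_le_sum[of i B "\<lambda>i. \<Sum>j\<in>B. (ricf i j)\<^sup>2"]) (auto intro: sum_nonneg)
    finally show ?thesis unfolding sq .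
  qed
qed

lemma not_flat_of_Ricci:
  assumes "tr (Rop \<circ> Rop) > 0" shows "\<not> flat A g"
proof
  assume "flat A g"
  then have "ricf u v = 0" for u v by (simp add: flat_iff ricf_def tr_def)
  moreover obtain B where "orthonormal_basis (g \<one>) B" using orthonormal_basis_exists by blast
  ultimately show False using assms tr_Rop_sq[OF frame_id] by simp
qed

end

context lie_grp
begin

lemma solvable_chain_lb:
  assumes "solvable G" shows "solvable_chain lb UNIV"
proof -
  obtain D n where D: "D 0 = UNIV" "D n = {0}" "\<And>i. subspace (D i)" "\<And>i. D (Suc i) \<subseteq> D i"
    "\<And>i u v. u \<in> D i \<Longrightarrow> v \<in> D i \<Longrightarrow> lb u v \<in> D (Suc i)"
    by (rule solvable_lie_algebra[OF assms]) (rule that)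
  from derived_series_solvable_chain[of D n lb, OF D] show ?thesis .
qed

lemma real_type_imp_bounds:
  assumes "solvable G" "real_type G A"
  shows "m_inf G A > 0" "\<exists>C>0. \<forall>g\<in>nonflat_metrics G A. \<forall>p. riem_norm A g p \<le> C * \<bar>scal A g p\<bar>"
proof -
  have real: "nilpotent_op (lb u)" if "\<And>z. complex_eigenvalue (lb u) z \<Longrightarrow> Re z = 0" for u
    using assms(2) that by (auto simp: real_type_def)
  obtain C where C: "C \<ge> 0" "\<And>h u v w. inner_form h \<Longrightarrow> h u u = 1 \<Longrightarrow> h v v = 1 \<Longrightarrow> h w w = 1 \<Longrightarrow>
      (h (lb u v) w)\<^sup>2 \<le> C * (- tr (metric_lie_algebra.Rop lb h))"
    using real_type_bracket_bound[OF lie_algebra_lb solvable_chain_lb[OF assms(1)] real] by blast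
  define n where "n = real DIM('e)"
  have n: "n > 0" by (simp add: n_def)
  \<comment> \<open>\<open>C + 1\<close> instead of \<open>C\<close>, which may be 0.\<close>
  define \<kappa> where "\<kappa> = 1 / (36 * n ^ 6 * (C + 1)\<^sup>2)"
  have \<kappa>: "\<kappa> > 0" using n C(1) by (simp add: \<kappa>_def)
  have main: "F_pinch G A g \<ge> \<kappa> \<and> riem_norm A g p \<le> (6 * n ^ 3 * C + 1) * \<bar>scal A g p\<bar>"
    if g: "g \<in> nonflat_metrics G A" for g p
  proof -
    interpret left_metric G A g
      using g by unfold_locales (auto simp: nonflat_metrics_def)
    have C2: "\<forall>u v w. g \<one> u u = 1 \<longrightarrow> g \<one> v v = 1 \<longrightarrow> g \<one> w w = 1 \<longrightarrow>
        (g \<one> (lb u v) w)\<^sup>2 \<le> C * (- tr Rop)"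
      using C(2)[OF riemannian_inner_form[OF riemannian]] by blast
    note bounds = curvature_bounds[OF C(1) C2, folded n_def]
    have nf: "\<not> flat A g" using g by (simp add: nonflat_metrics_def)
    have t: "tr Rop \<noteq> 0" by (rule bounds(3)[OF nf])
    have pos: "tr (Rop \<circ> Rop) > 0" by (rule bounds(4)[OF t])
    have "tr (Rop \<circ> Rop) \<le> 36 * n ^ 6 * C\<^sup>2 * (tr Rop)\<^sup>2" by (rule bounds(2))
    also have "\<dots> \<le> 36 * n ^ 6 * (C + 1)\<^sup>2 * (tr Rop)\<^sup>2"
      using C(1) n by (intro mult_right_mono mult_left_mono power_mono) auto
    finally have "\<kappa> * tr (Rop \<circ> Rop) \<le> (tr Rop)\<^sup>2" using n C(1) by (simp add: \<kappa>_def divide_le_eq mult.commute)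
    then have "\<kappa> \<le> F_pinch G A g" using pos by (simp add: F_pinch_eq le_divide_eq)
    moreover have "riem_norm A g p \<le> (6 * n ^ 3 * C + 1) * \<bar>scal A g p\<bar>"
      using bounds(1)[of p] by (simp add: scal_eq distrib_right)
    ultimately show ?thesis by blast
  qed
  have "ereal \<kappa> \<le> m_inf G A" unfolding m_inf_def using main by (intro INF_greatest) auto
  then show "m_inf G A > 0" using \<kappa> by (metis ereal_less(2) less_le_trans)
  show "\<exists>C>0. \<forall>g\<in>nonflat_metrics G A. \<forall>p. riem_norm A g p \<le> C * \<bar>scal A g p\<bar>"
    using main C(1) n by (intro exI[of _ "6 * n ^ 3 * C + 1"]) (auto intro: add_nonneg_pos)
qed

lemma not_real_type_collapse:
  assumes "solvable G" "\<not> real_type G A" "\<epsilon> > 0"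
  shows "\<exists>g\<in>nonflat_metrics G A. F_pinch G A g < \<epsilon>"
proof -
  obtain X where X: "\<And>z. complex_eigenvalue (lb X) z \<Longrightarrow> Re z = 0" "\<not> nilpotent_op (lb X)"
    using assms(2) by (auto simp: real_type_def)
  obtain h where h: "inner_form h" "tr (metric_lie_algebra.Rop lb h \<circ> metric_lie_algebra.Rop lb h) > 0"
    "(tr (metric_lie_algebra.Rop lb h))\<^sup>2 / tr (metric_lie_algebra.Rop lb h \<circ> metric_lie_algebra.Rop lb h) < \<epsilon>"
    using pinching_collapse[OF lie_algebra_lb solvable_chain_lb[OF assms(1)] X assms(3)] by blast
  define g where "g = (\<lambda>p u v. h (mc p u) (mc p v))"
  have g: "riemannian_metric A g" "left_invariant G A g"
    unfolding g_def by (rule left_invariant_extension[OF h(1)])+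
  have g1: "g \<one> = h" by (simp add: g_def)
  interpret left_metric G A g using g by unfold_locales
  have "\<not> flat A g" by (rule not_flat_of_Ricci) (simp only: g1 h(2))
  then have "g \<in> nonflat_metrics G A" using g by (simp add: nonflat_metrics_def)
  moreover have "F_pinch G A g < \<epsilon>" unfolding F_pinch_eq g1 by (rule h(3))
  ultimately show ?thesis by blast
qed

end

theorem theorem1p1:
  fixes G :: "'a::{t2_space, second_countable_topology} monoid"
    and A :: "('a, 'e::euclidean_space) chart set"
  assumes "lie_group G A"
    and "connected (UNIV :: 'a set)"
    and "solvable G"
  shows "(real_type G A \<longleftrightarrow> m_inf G A > 0) \<and>
    (real_type G A \<longrightarrow>
      (\<exists>C>0. \<forall>g\<in>nonflat_metrics G A. \<forall>p. riem_norm A g p \<le> C * \<bar>scal A g p\<bar>))"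
proof -
  interpret lie_grp G A using assms(1) by unfold_locales
  have "real_type G A" if m: "m_inf G A > 0"
  proof (rule ccontr)
    assume no: "\<not> real_type G A"
    \<comment> \<open>A real number below the infimum is needed since the latter may be infinite;
      the collapse contradicts that case as well, as it produces a non-flat metric.\<close>
    obtain \<epsilon> where \<epsilon>: "0 < ereal \<epsilon>" "ereal \<epsilon> < m_inf G A" using m ereal_dense2 by blast
    then obtain g where g: "g \<in> nonflat_metrics G A" "F_pinch G A g < \<epsilon>"
      using not_real_type_collapse[OF assms(3) no, of \<epsilon>] by auto
    have "m_inf G A \<le> ereal (F_pinch G A g)" unfolding m_inf_def by (rule INF_lower[OF g(1)])
    also have "\<dots> < ereal \<epsilon>" using g(2) by simp
    finally show False using \<epsilon>(2) by simp
  qed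
  then show ?thesis using real_type_imp_bounds[OF assms(3)] by blast
qed

end
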